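(* Let $n\ge0$ be an integer, and let $\mu,\nu$ be partitions with $l(\mu)+l(\nu)\le 2n$, so that $\lambda=\mu\bar\nu$ is a dominant weight of $U(2n)$. Then $$\frac1Z\int_T P_{\mu\bar\nu}(x_1,\dots,x_n,y_1,\dots,y_n;t)\,\frac{1}{(n!)^2}\prod_{1\le i,j\le n}\frac{1}{(1-tx_iy_j^{-1})(1-ty_ix_j^{-1})}\prod_{1\le i\ne j\le n}(1-x_ix_j^{-1})(1-y_iy_j^{-1})\,dT$$ is equal to $0$ unless $\mu=\nu$, in which case it equals $$\frac{C^0_\mu(t^n,-t^n;0,t)}{C^-_\mu(t;0,t)\,C^+_\mu(t^{2n-2}t;0,t)}.$$ Here the normalization $Z$ is the integral (without the factor $1/Z$) for $\mu=\nu=0$.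
   Context: Let $t\in\mathbb{C}$ with $|t|<1$. $T$ is the torus on which all of the variables $x_i,y_j$ have absolute value $1$, and $dT=\prod_i\frac{dx_i}{2\pi\sqrt{-1}\,x_i}\prod_j\frac{dy_j}{2\pi\sqrt{-1}\,y_j}$. $l(\mu)$ is the number of nonzero parts of $\mu$. For partitions $\mu,\nu$ with $l(\mu)+l(\nu)\le N$, $\mu\bar\nu$ denotes the vector $(\mu_1,\dots,\mu_{l(\mu)},0,\dots,0,-\nu_{l(\nu)},\dots,-\nu_1)$ with $N$ entries (here $N=2n$). $[i]=(1-t^i)/(1-t)$, $[k]!=[k]\cdots[1]$, $[0]!=1$. For a weakly decreasing integer vector $\lambda$ with $N$ entries, $m_i(\lambda)$ is the number of entries equal to $i$ ($i\in\mathbb{Z}$), $v_\lambda(t)=\prod_{i\in\mathbb{Z}}[m_i(\lambda)]!$, and the Hall--Littlewood polynomial is $P_\lambda(z_1,\dots,z_N;t)=\frac{1}{v_\lambda(t)}\sum_{w\in S_N}w\Big(z^\lambda\prod_{1\le i<j\le N}\frac{z_i-tz_j}{z_i-z_j}\Big)$, with $w$ permuting the subscripts of the variables. The $C$-symbols at $q=0$, for a partition $\mu$, are: $C^0_\mu(x;0,t)=\prod_{1\le i\le l(\mu)}(1-t^{1-i}x)$, with $C^0_\mu(a,b;0,t)=C^0_\mu(a;0,t)\,C^0_\mu(b;0,t)$; $C^-_\mu(t;0,t)=(1-t)^{l(\mu)}\prod_{i\ge1}[m_i(\mu)]!$; and $C^+_\mu(x;0,t)=1$. *)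

theory Defs
  imports "HOL-Analysis.Analysis" "HOL-Combinatorics.Permutations"
begin

text \<open>A partition is the list of its positive parts in weakly decreasing order, so \<open>l(\<mu>)\<close> is
  the length of the list, and two partitions are equal iff the lists are. All indices are
  shifted to start at 0.\<close>

definition is_partition :: "nat list \<Rightarrow> bool" where
  "is_partition \<mu> \<longleftrightarrow> sorted_wrt (\<ge>) \<mu> \<and> 0 \<notin> set \<mu>"

definition weight_of :: "nat \<Rightarrow> nat list \<Rightarrow> nat list \<Rightarrow> int list" where
  "weight_of N \<mu> \<nu> =
     map int \<mu> @ replicate (N - (length \<mu> + length \<nu>)) 0 @ rev (map (\<lambda>k. - int k) \<nu>)"

definition t_int :: "complex \<Rightarrow> nat \<Rightarrow> complex" where
  "t_int t i = (1 - t ^ i) / (1 - t)"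

definition t_fact :: "complex \<Rightarrow> nat \<Rightarrow> complex" where
  "t_fact t k = (\<Prod>i = 1..k. t_int t i)"

text \<open>Values \<open>i\<close> that do not occur in the list would contribute the factor \<open>[0]! = 1\<close>.\<close>

definition t_mult :: "complex \<Rightarrow> 'a list \<Rightarrow> complex" where
  "t_mult t \<kappa> = (\<Prod>i\<in>set \<kappa>. t_fact t (count_list \<kappa> i))"

text \<open>The formula gives the value of the Hall--Littlewood polynomial at every point with distinct
  nonzero coordinates. Where two coordinates coincide, the quotients below are \<open>0\<close> by the convention
  for division; these points form a null set of the torus and do not affect integrals over it.\<close>

definition hall_littlewood :: "int list \<Rightarrow> complex \<Rightarrow> (nat \<Rightarrow> complex) \<Rightarrow> complex" where
  "hall_littlewood \<kappa> t z =
     1 / t_mult t \<kappa> *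
     (\<Sum>w | w permutes {..<length \<kappa>}.
        (\<Prod>i<length \<kappa>. z (w i) powi (\<kappa> ! i)) *
        (\<Prod>(i, j)\<in>{(i, j). i < j \<and> j < length \<kappa>}.
           (z (w i) - t * z (w j)) / (z (w i) - z (w j))))"

text \<open>With \<open>z = exp (2 \<pi> \<i> \<theta>)\<close> on the unit circle, \<open>dz / (2 \<pi> \<i> z) = d\<theta>\<close>.\<close>

definition circle_measure :: "complex measure" where
  "circle_measure = distr (uniform_measure lborel {0..1}) borel (\<lambda>\<theta>. cis (2 * pi * \<theta>))"

definition torus_measure :: "nat \<Rightarrow> (nat \<Rightarrow> complex) measure" where
  "torus_measure N = PiM {..<N} (\<lambda>_. circle_measure)"

definition density_factor :: "nat \<Rightarrow> complex \<Rightarrow> (nat \<Rightarrow> complex) \<Rightarrow> (nat \<Rightarrow> complex) \<Rightarrow> complex" where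
  "density_factor n t x y =
     1 / (fact n)\<^sup>2 *
     (\<Prod>i<n. \<Prod>j<n. 1 / ((1 - t * x i * inverse (y j)) * (1 - t * y i * inverse (x j)))) *
     (\<Prod>(i, j)\<in>{(i, j). i < n \<and> j < n \<and> i \<noteq> j}.
        (1 - x i * inverse (x j)) * (1 - y i * inverse (y j)))"

text \<open>The \<open>2n\<close> variables are \<open>z = (x\<^sub>1, \<dots>, x\<^sub>n, y\<^sub>1, \<dots>, y\<^sub>n)\<close>.\<close>

definition torus_integral :: "nat \<Rightarrow> complex \<Rightarrow> nat list \<Rightarrow> nat list \<Rightarrow> complex" where
  "torus_integral n t \<mu> \<nu> =
     (LINT z | torus_measure (2 * n).
        hall_littlewood (weight_of (2 * n) \<mu> \<nu>) t z * density_factor n t z (\<lambda>j. z (n + j)))"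

text \<open>The \<open>C\<close>-symbols at \<open>q = 0\<close>. The negative powers in \<open>C0\<close> are \<open>0\<close> for \<open>t = 0\<close>; this yields
  the intended value of \<open>C0 \<mu> (t ^ n) t\<close> for \<open>length \<mu> \<le> n\<close>, whose factors are \<open>1 - t ^ (n - i)\<close>
  with \<open>i < n\<close>. \<open>C_minus_t\<close> is the symbol with first argument \<open>t\<close>.\<close>

definition C0 :: "nat list \<Rightarrow> complex \<Rightarrow> complex \<Rightarrow> complex" where
  "C0 \<mu> x t = (\<Prod>i<length \<mu>. 1 - t powi (- int i) * x)"

definition C0_pair :: "nat list \<Rightarrow> complex \<Rightarrow> complex \<Rightarrow> complex \<Rightarrow> complex" where
  "C0_pair \<mu> a b t = C0 \<mu> a t * C0 \<mu> b t"

definition C_minus_t :: "nat list \<Rightarrow> complex \<Rightarrow> complex" where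
  "C_minus_t \<mu> t = (1 - t) ^ length \<mu> * t_mult t \<mu>"

definition C_plus :: "nat list \<Rightarrow> complex \<Rightarrow> complex \<Rightarrow> complex" where
  "C_plus \<mu> x t = 1"

end

theory Submission
  imports Defs "HOL-Probability.Infinite_Product_Measure"
    "HOL-Complex_Analysis.Cauchy_Integral_Formula" "HOL-Combinatorics.Multiset_Permutations"
begin

text \<open>
  Let \<open>\<kappa>\<close> be the weight built from \<open>\<mu>\<close> and \<open>\<nu>\<close>, with \<open>2n\<close> entries. The Hall--Littlewood polynomial is a sum
  over the orderings of the \<open>2n\<close> variables, and each ordering can be integrated explicitly, one variable
  at a time. Single terms have poles where some \<open>x\<^sub>i\<close> equals some \<open>y\<^sub>j\<close>, so they are integrated over the
  torus \<open>|x\<^sub>i| = r\<close>, \<open>|y\<^sub>j| = 1\<close> with \<open>|t| < r < 1\<close>. In the sum the poles cancel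
  (\<open>hall_littlewood_laurent\<close>), so the polynomial is bounded and the given integral is the limit
  \<open>r \<rightarrow> 1\<close> by dominated convergence (\<open>deformed_integral_tendsto\<close>).

  Fix an ordering, and let \<open>\<kappa>\<^sub>0 \<ge> \<kappa>\<^sub>1 \<ge> \<dots>\<close> be the exponents of the variables in this order, where
  \<open>\<kappa>\<^sub>0 + \<kappa>\<^sub>p \<ge> 0\<close> for all \<open>p\<close>. If the first variable is an \<open>x\<close>, the term is holomorphic in it on the disc
  of radius \<open>r\<close> and vanishes at the origin, so the integral is \<open>0\<close> (\<open>term_integral_inner_first\<close>). If it is
  a \<open>y\<close>, the only poles in the unit disc are simple ones at the \<open>x\<^sub>a\<close>. After taking the residue at
  \<open>y = x\<^sub>a\<close>, nearly all factors that link \<open>y\<close> and \<open>x\<^sub>a\<close> to the other variables cancel: with \<open>p\<close> the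
  position of \<open>x\<^sub>a\<close>, what remains is \<open>x\<^sub>a\<close> to the power \<open>\<kappa>\<^sub>0 + \<kappa>\<^sub>p\<close> and a factor
  \<open>(t w - x\<^sub>a) / (w - t x\<^sub>a)\<close> for each variable \<open>w\<close> after \<open>x\<^sub>a\<close> (\<open>residue_factor\<close>). This is holomorphic
  in \<open>x\<^sub>a\<close>, so integrating over \<open>x\<^sub>a\<close> evaluates it at the origin. It gives \<open>0\<close> if \<open>\<kappa>\<^sub>0 + \<kappa>\<^sub>p > 0\<close>,
  and \<open>t\<close> to the number of variables after \<open>x\<^sub>a\<close> if \<open>\<kappa>\<^sub>0 + \<kappa>\<^sub>p = 0\<close>; the pair \<open>y\<close>, \<open>x\<^sub>a\<close> has disappeared, and
  with it the exponents \<open>\<kappa>\<^sub>0\<close> and \<open>\<kappa>\<^sub>p\<close> (\<open>term_integral_outer_first\<close>).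

  Summed over all orderings this is a recursion in \<open>n\<close>. If \<open>\<mu>\<close> starts with \<open>m\<close> and no part of \<open>\<nu>\<close> exceeds
  \<open>m\<close>, only the positions with exponent \<open>-m\<close> contribute. They form the final block of \<open>\<kappa>\<close>, of length the
  multiplicity \<open>c\<close> of \<open>m\<close> in \<open>\<nu>\<close>, and the powers of \<open>t\<close> add up to \<open>[c]\<close> (\<open>total_integral_peel\<close>). Hence
  equal leading parts are removed together, and the integral is \<open>0\<close> as soon as the leading part of \<open>\<mu>\<close>
  is the larger one. The opposite case reduces to this one by complex conjugation, which on the torus
  inverts all variables and so exchanges \<open>\<mu>\<close> and \<open>\<nu>\<close> (\<open>torus_integral_swap\<close>).

  For \<open>\<mu> = \<nu>\<close> the recursion multiplies out. Its instance for the zero weight gives the normalization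
  \<open>Z\<^sub>n\<close>, the product of \<open>1 / (1 - t\<^sup>2\<^sup>i)\<close> over \<open>1 \<le> i \<le> n\<close>; in general the integral is \<open>Z\<^sub>n\<^sub>-\<^sub>l\<close> divided by
  \<open>C_minus_t \<mu> t\<close>, where \<open>l\<close> is the length of \<open>\<mu>\<close> (\<open>torus_integral_equal\<close>), and the quotient \<open>Z\<^sub>n\<^sub>-\<^sub>l / Z\<^sub>n\<close>
  is the \<open>C0\<close>-symbol.
\<close>

section \<open>Integration over circles\<close>

lemma measurable_cis_circle [measurable]: "(\<lambda>\<theta>. cis (2 * pi * \<theta>)) \<in> borel_measurable borel"
  by (intro borel_measurable_continuous_onI continuous_intros)

lemma sets_circle_measure [measurable_cong, simp]: "sets circle_measure = sets borel"
  by (simp add: circle_measure_def)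

lemma space_circle_measure [simp]: "space circle_measure = UNIV"
  by (simp add: circle_measure_def)

lemma prob_space_circle_measure: "prob_space circle_measure"
proof -
  interpret U: prob_space "uniform_measure lborel {0..1::real}"
    by (rule prob_space_uniform_measure) auto
  show ?thesis
    unfolding circle_measure_def by (rule U.prob_space_distr) measurable
qed

interpretation circle: prob_space circle_measure
  by (rule prob_space_circle_measure)

interpretation circles: product_sigma_finite "\<lambda>_::nat. circle_measure"
  by unfold_locales

lemma AE_circle_measure:
  assumes "Measurable.pred borel P" and "AE \<theta> in lborel. 0 \<le> \<theta> \<and> \<theta> \<le> 1 \<longrightarrow> P (cis (2 * pi * \<theta>))"
  shows "AE z in circle_measure. P z"
proof -
  have "AE \<theta> in uniform_measure lborel {0..1::real}. P (cis (2 * pi * \<theta>))"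
    by (rule AE_uniform_measureI) (use assms(2) in auto)
  then show ?thesis
    unfolding circle_measure_def
    by (subst AE_distr_iff) (use assms(1) in auto)
qed

lemma AE_circle_norm: "AE z in circle_measure. norm z = 1"
  by (rule AE_circle_measure) auto

lemma AE_circle_neq: "AE z in circle_measure. z \<noteq> c"
proof (rule AE_circle_measure)
  \<comment> \<open>The parametrization is injective only on the half-open interval.\<close>
  have "{\<theta>. 0 \<le> \<theta> \<and> \<theta> \<le> 1 \<and> cis (2 * pi * \<theta>) = c} \<subseteq> insert 1 {\<theta>. 0 \<le> \<theta> \<and> \<theta> < 1 \<and> cis (2 * pi * \<theta>) = c}"
    by auto
  moreover have "finite {\<theta>. 0 \<le> \<theta> \<and> \<theta> < 1 \<and> cis (2 * pi * \<theta>) = c}" (is "finite ?A")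
  proof (cases "?A = {}")
    case False
    then obtain a where a: "a \<in> ?A" by blast
    have "?A \<subseteq> {a}"
    proof
      fix b assume "b \<in> ?A"
      then have b: "0 \<le> b" "b < 1" "cis (2 * pi * b) = cis (2 * pi * a)" using a by auto
      then have "exp (\<i> * complex_of_real (2 * pi * b)) = exp (\<i> * complex_of_real (2 * pi * a))"
        by (simp add: cis_conv_exp)
      then obtain k :: int where "\<i> * complex_of_real (2 * pi * b) = \<i> * complex_of_real (2 * pi * a) + (of_int (2 * k) * pi) * \<i>"
        unfolding exp_eq by blast
      then have "complex_of_real (2 * pi * b) = complex_of_real (2 * pi * a + of_int (2 * k) * pi)"
        by (simp add: algebra_simps)
          (metis (no_types, lifting) complex_i_not_zero distrib_left mult_left_cancel)
      then have "2 * pi * b = 2 * pi * a + of_int (2 * k) * pi"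
        using of_real_eq_iff by blast
      then have "pi * b = pi * (a + of_int k)" by (simp add: algebra_simps)
      then have "b = a + of_int k" by simp
      moreover have "k = 0" using a b calculation by auto
      ultimately show "b \<in> {a}" by simp
    qed
    then show ?thesis using finite_subset by blast
  qed (simp only: finite.emptyI)
  ultimately have "finite {\<theta>. 0 \<le> \<theta> \<and> \<theta> \<le> 1 \<and> cis (2 * pi * \<theta>) = c}"
    by (meson finite_insert finite_subset)
  then have "{\<theta>. 0 \<le> \<theta> \<and> \<theta> \<le> 1 \<and> cis (2 * pi * \<theta>) = c} \<in> null_sets lborel"
    by (rule finite_imp_null_set_lborel)
  then show "AE \<theta> in lborel. 0 \<le> \<theta> \<and> \<theta> \<le> 1 \<longrightarrow> cis (2 * pi * \<theta>) \<noteq> c"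
    by (rule AE_I') auto
qed measurable

lemma AE_circles_norm:
  fixes V :: "nat set"
  assumes "finite V"
  shows "AE z in PiM V (\<lambda>_. circle_measure). \<forall>i\<in>V. norm (z i) = 1"
  by (rule AE_finite_allI[OF assms]) (rule AE_PiM_component, auto intro: AE_circle_norm prob_space_circle_measure)

lemma AE_circles_insert:
  fixes V :: "nat set"
  assumes "finite V" "i \<notin> V"
    and "{z \<in> space (PiM (insert i V) (\<lambda>_. circle_measure)). P z} \<in> sets (PiM (insert i V) (\<lambda>_. circle_measure))"
    and "AE z in PiM V (\<lambda>_. circle_measure). AE x in circle_measure. P (z(i := x))"
  shows "AE z in PiM (insert i V) (\<lambda>_. circle_measure). P z"
proof -
  let ?M = "PiM (insert i V) (\<lambda>_. circle_measure)"
  let ?N = "{z \<in> space ?M. \<not> P z}"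
  have [measurable]: "?N \<in> sets ?M"
    using assms(3) by (rule sets.sets_Collect_neg)
  have "emeasure ?M ?N = (\<integral>\<^sup>+ z. indicator ?N z \<partial>?M)" by simp
  also have "\<dots> = (\<integral>\<^sup>+ z. (\<integral>\<^sup>+ x. indicator ?N (z(i := x)) \<partial>circle_measure) \<partial>PiM V (\<lambda>_. circle_measure))"
    by (rule circles.product_nn_integral_insert) (use assms in auto)
  also have "\<dots> = (\<integral>\<^sup>+ z. 0 \<partial>PiM V (\<lambda>_. circle_measure))"
  proof (rule nn_integral_cong_AE)
    show "AE z in PiM V (\<lambda>_. circle_measure). (\<integral>\<^sup>+ x. indicator ?N (z(i := x)) \<partial>circle_measure) = 0"
      using assms(4)
    proof eventually_elim
      case (elim z)
      have "(\<integral>\<^sup>+ x. indicator ?N (z(i := x)) \<partial>circle_measure) = (\<integral>\<^sup>+ x. 0 \<partial>circle_measure)"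
        by (rule nn_integral_cong_AE) (use elim in \<open>eventually_elim, auto simp: indicator_def\<close>)
      then show ?case by simp
    qed
  qed
  finally have "emeasure ?M ?N = 0" by simp
  then show ?thesis
    by (subst AE_iff_measurable[OF _ refl]) auto
qed

lemma AE_circles_neq:
  fixes V :: "nat set"
  assumes "finite V" "i \<in> V" "j \<in> V" "i \<noteq> j"
  shows "AE z in PiM V (\<lambda>_. circle_measure). z i \<noteq> z j"
proof -
  have V: "V = insert i (V - {i})" using assms by auto
  have *: "{z \<in> space (PiM V (\<lambda>_. circle_measure)). z i \<noteq> z j} \<in> sets (PiM V (\<lambda>_. circle_measure))"
  proof -
    have "(\<lambda>z. z k) \<in> borel_measurable (PiM V (\<lambda>_. circle_measure))" if "k \<in> V" for k
      using measurable_component_singleton[OF that, of "\<lambda>_. circle_measure"]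
      by (simp cong: measurable_cong_sets)
    then have "(\<lambda>z. z i - z j) \<in> borel_measurable (PiM V (\<lambda>_. circle_measure))"
      using assms by (intro borel_measurable_diff) auto
    then have "(\<lambda>z. z i - z j) -` (- {0}) \<inter> space (PiM V (\<lambda>_. circle_measure)) \<in> sets (PiM V (\<lambda>_. circle_measure))"
      by (rule measurable_sets) simp
    moreover have "(\<lambda>z. z i - z j) -` (- {0}) \<inter> space (PiM V (\<lambda>_. circle_measure)) =
        {z \<in> space (PiM V (\<lambda>_. circle_measure)). z i \<noteq> z j}" by auto
    ultimately show ?thesis by simp
  qed
  have "AE z in PiM (insert i (V - {i})) (\<lambda>_. circle_measure). z i \<noteq> z j"
    by (rule AE_circles_insert) (use assms * AE_circle_neq in \<open>auto simp: insert_absorb\<close>)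
  then show ?thesis by (simp only: V[symmetric])
qed

lemma AE_circles_inj:
  fixes V :: "nat set"
  assumes "finite V"
  shows "AE z in PiM V (\<lambda>_. circle_measure). inj_on z V"
proof -
  have "AE z in PiM V (\<lambda>_. circle_measure). \<forall>i\<in>V. \<forall>j\<in>V. i \<noteq> j \<longrightarrow> z i \<noteq> z j"
    by (intro AE_finite_allI[OF assms]) (use AE_circles_neq[OF assms] in auto)
  then show ?thesis by eventually_elim (auto simp: inj_on_def)
qed

lemma circle_integral_conv_integral:
  assumes [measurable]: "f \<in> borel_measurable borel" and "continuous_on (sphere 0 1) f"
  shows "(LINT z|circle_measure. f z) = integral {0..1} (\<lambda>\<theta>. f (cis (2 * pi * \<theta>)) :: complex)"
proof -
  have "(LINT z|circle_measure. f z) = (LINT \<theta>|uniform_measure lborel {0..1}. f (cis (2 * pi * \<theta>)))"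
    unfolding circle_measure_def by (subst integral_distr) auto
  also have "\<dots> = (LINT \<theta>|lborel. indicator {0..1} \<theta> *\<^sub>R f (cis (2 * pi * \<theta>)))"
  proof -
    have "uniform_measure lborel {0..1::real} = density lborel (\<lambda>\<theta>. ennreal (indicator {0..1} \<theta>))"
      by (simp add: uniform_measure_def divide_ennreal_def ennreal_indicator)
    then show ?thesis by (simp add: integral_density)
  qed
  also have "\<dots> = (LINT \<theta>:{0..1}|lborel. f (cis (2 * pi * \<theta>)))"
    by (simp add: set_lebesgue_integral_def)
  also have "\<dots> = integral {0..1} (\<lambda>\<theta>. f (cis (2 * pi * \<theta>)))"
  proof (rule set_borel_integral_eq_integral)
    have "continuous_on {0..1} (\<lambda>\<theta>. f (cis (2 * pi * \<theta>)))"
      by (rule continuous_on_compose2[OF assms(2)]) (auto intro!: continuous_intros)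
    then show "set_integrable lborel {0..1} (\<lambda>\<theta>. f (cis (2 * pi * \<theta>)))"
      using borel_integrable_atLeastAtMost' by blast
  qed
  finally show ?thesis .
qed

text \<open>Since \<open>d\<theta> = dz / (2 \<pi> \<i> z)\<close>, Cauchy's formula needs the additional factor \<open>z\<close>.\<close>

lemma circle_integral_Cauchy:
  assumes [measurable]: "f \<in> borel_measurable borel"
    and "continuous_on (cball 0 1) f" "f holomorphic_on ball 0 1" "norm w < 1"
  shows "(LINT z|circle_measure. z * f z / (z - w)) = f w"
proof -
  have "continuous_on (sphere 0 1) f" using assms(2) continuous_on_subset sphere_cball by blast
  then have "continuous_on (sphere 0 1) (\<lambda>z. z * f z / (z - w))"
    using assms(4) by (auto intro!: continuous_intros)
  then have "(LINT z|circle_measure. z * f z / (z - w)) =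
      integral {0..1} (\<lambda>\<theta>. cis (2 * pi * \<theta>) * f (cis (2 * pi * \<theta>)) / (cis (2 * pi * \<theta>) - w))"
    by (intro circle_integral_conv_integral) auto
  also have "\<dots> = f w"
  proof (rule integral_unique)
    have "((\<lambda>u. f u / (u - w)) has_contour_integral (2 * of_real pi * \<i> * f w)) (circlepath 0 1)"
      using Cauchy_integral_circlepath[of 0 1 f w] assms by (simp add: dist_norm)
    then have "((\<lambda>\<theta>. f (circlepath 0 1 \<theta>) / (circlepath 0 1 \<theta> - w) * vector_derivative (circlepath 0 1) (at \<theta> within {0..1}))
        has_integral (2 * of_real pi * \<i> * f w)) {0..1}"
      unfolding has_contour_integral_def .
    then have "((\<lambda>\<theta>. (1 / (2 * of_real pi * \<i>)) * (f (circlepath 0 1 \<theta>) / (circlepath 0 1 \<theta> - w) * vector_derivative (circlepath 0 1) (at \<theta> within {0..1})))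
        has_integral (1 / (2 * of_real pi * \<i>)) * (2 * of_real pi * \<i> * f w)) {0..1}"
      by (rule has_integral_mult_right)
    then have "((\<lambda>\<theta>. cis (2 * pi * \<theta>) * f (cis (2 * pi * \<theta>)) / (cis (2 * pi * \<theta>) - w)) has_integral
        (1 / (2 * of_real pi * \<i>)) * (2 * of_real pi * \<i> * f w)) {0..1}"
    proof (rule has_integral_eq[rotated])
      fix \<theta> :: real assume "\<theta> \<in> {0..1}"
      then have v: "vector_derivative (circlepath 0 1) (at \<theta> within {0..1}) = 2 * of_real pi * \<i> * cis (2 * pi * \<theta>)"
        by (simp add: vector_derivative_circlepath01 cis_conv_exp mult_ac)
      have c: "circlepath 0 1 \<theta> = cis (2 * pi * \<theta>)"
        by (simp add: circlepath cis_conv_exp mult_ac)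
      show "(1 / (2 * of_real pi * \<i>)) * (f (circlepath 0 1 \<theta>) / (circlepath 0 1 \<theta> - w) *
            vector_derivative (circlepath 0 1) (at \<theta> within {0..1})) =
          cis (2 * pi * \<theta>) * f (cis (2 * pi * \<theta>)) / (cis (2 * pi * \<theta>) - w)"
        unfolding v c by (simp add: field_simps)
    qed
    then show "((\<lambda>\<theta>. cis (2 * pi * \<theta>) * f (cis (2 * pi * \<theta>)) / (cis (2 * pi * \<theta>) - w)) has_integral f w) {0..1}"
      by simp
  qed
  finally show ?thesis .
qed

lemma circle_integral_mean_value:
  assumes [measurable]: "f \<in> borel_measurable borel"
    and "continuous_on (cball 0 1) f" "f holomorphic_on ball 0 1"
  shows "(LINT z|circle_measure. f z) = f 0"
proof -
  have "(LINT z|circle_measure. f z) = (LINT z|circle_measure. z * f z / (z - 0))"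
    by (rule integral_cong_AE) (measurable, use AE_circle_neq[of 0] in \<open>eventually_elim, auto\<close>)
  with circle_integral_Cauchy[OF assms, of 0] show ?thesis by simp
qed

lemma partial_fractions_simple:
  fixes x :: "'i \<Rightarrow> 'a::field"
  assumes "finite S" "S \<noteq> {}" "inj_on x S" "z \<notin> x ` S"
  shows "1 / (\<Prod>i\<in>S. z - x i) = (\<Sum>i\<in>S. 1 / ((z - x i) * (\<Prod>j\<in>S - {i}. x i - x j)))"
  using assms
proof (induction S arbitrary: z rule: finite_ne_induct)
  case (singleton a)
  then show ?case by simp
next
  case (insert a S)
  define c where "c i = (\<Prod>j\<in>S - {i}. x i - x j)" for i
  have za: "z \<noteq> x a" and zi: "\<And>i. i \<in> S \<Longrightarrow> z \<noteq> x i" using insert.prems by auto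
  have ai: "x i \<noteq> x a" if "i \<in> S" for i using insert.prems insert.hyps that by (auto simp: inj_on_def)
  have IHz: "1 / (\<Prod>i\<in>S. z - x i) = (\<Sum>i\<in>S. 1 / ((z - x i) * c i))"
    unfolding c_def using insert.prems by (intro insert.IH) auto
  have IHa: "1 / (\<Prod>i\<in>S. x a - x i) = (\<Sum>i\<in>S. 1 / ((x a - x i) * c i))"
    unfolding c_def using insert.prems ai by (intro insert.IH) auto
  have ci: "(\<Prod>j\<in>insert a S - {i}. x i - x j) = (x i - x a) * c i" if "i \<in> S" for i
  proof -
    have "insert a S - {i} = insert a (S - {i})" using that insert.hyps by auto
    then show ?thesis using insert.hyps by (simp add: c_def)
  qed
  have "1 / (\<Prod>i\<in>insert a S. z - x i) = 1 / (z - x a) * (1 / (\<Prod>i\<in>S. z - x i))"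
    using insert.hyps by simp
  also have "\<dots> = (\<Sum>i\<in>S. 1 / (z - x a) * (1 / ((z - x i) * c i)))"
    by (simp add: IHz sum_distrib_left)
  also have "\<dots> = (\<Sum>i\<in>S. 1 / ((z - x i) * ((x i - x a) * c i)) + 1 / (z - x a) * (1 / ((x a - x i) * c i)))"
  proof (rule sum.cong[OF refl])
    fix i assume i: "i \<in> S"
    have 1: "1 / (p * q) = 1 / (q * (p - q)) + 1 / (p * (q - p))" if "p \<noteq> 0" "q \<noteq> 0" "p \<noteq> q" for p q :: 'a
      using that by (simp add: divide_simps) (simp add: algebra_simps)
    have "1 / ((z - x a) * (z - x i)) =
        1 / ((z - x i) * (x i - x a)) + 1 / ((z - x a) * (x a - x i))"
      using 1[of "z - x a" "z - x i"] za zi[OF i] ai[OF i] by simp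
    then have "1 / ((z - x a) * (z - x i)) * (1 / c i) =
        (1 / ((z - x i) * (x i - x a)) + 1 / ((z - x a) * (x a - x i))) * (1 / c i)" by simp
    then show "1 / (z - x a) * (1 / ((z - x i) * c i)) =
        1 / ((z - x i) * ((x i - x a) * c i)) + 1 / (z - x a) * (1 / ((x a - x i) * c i))"
      by (simp add: add_divide_distrib mult.assoc)
  qed
  also have "\<dots> = (\<Sum>i\<in>S. 1 / ((z - x i) * (\<Prod>j\<in>insert a S - {i}. x i - x j)))
      + 1 / (z - x a) * (1 / (\<Prod>i\<in>S. x a - x i))"
    by (simp add: sum.distrib IHa sum_distrib_left ci)
  also have "(\<Prod>i\<in>S. x a - x i) = (\<Prod>j\<in>insert a S - {a}. x a - x j)"
    using insert.hyps by simp
  finally show ?case using insert.hyps by (simp add: add.commute)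
qed

text \<open>Partial fractions reduce the residues at several simple poles to Cauchy's formula at each of them.\<close>

lemma circle_integral_residues:
  assumes [measurable]: "f \<in> borel_measurable borel"
    and f: "continuous_on (cball 0 1) f" "f holomorphic_on ball 0 1"
    and S: "finite S" "S \<noteq> {}" "inj_on x S" "\<And>i. i \<in> S \<Longrightarrow> norm (x i) < 1"
  shows "(LINT z|circle_measure. z * f z / (\<Prod>i\<in>S. z - x i)) = (\<Sum>i\<in>S. f (x i) / (\<Prod>j\<in>S - {i}. x i - x j))"
proof -
  have int: "integrable circle_measure (\<lambda>z. z * f z / (z - x i))" if "i \<in> S" for i
  proof -
    have "continuous_on (sphere 0 1) (\<lambda>z. z * f z / (z - x i))"
      using S(4)[OF that] continuous_on_subset[OF f(1) sphere_cball] by (auto intro!: continuous_intros)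
    then have "compact ((\<lambda>z. z * f z / (z - x i)) ` sphere 0 1)"
      by (intro compact_continuous_image) auto
    then obtain B where B: "\<And>z. z \<in> sphere 0 1 \<Longrightarrow> norm (z * f z / (z - x i)) \<le> B"
      using compact_imp_bounded by (force simp: bounded_iff)
    show ?thesis
      by (rule circle.integrable_const_bound[of _ B]) (use AE_circle_norm in \<open>eventually_elim, use B in auto\<close>, measurable)
  qed
  have "(LINT z|circle_measure. z * f z / (\<Prod>i\<in>S. z - x i)) =
      (LINT z|circle_measure. (\<Sum>i\<in>S. z * f z / (z - x i) * (1 / (\<Prod>j\<in>S - {i}. x i - x j))))"
  proof (rule integral_cong_AE)
    show "AE z in circle_measure. z * f z / (\<Prod>i\<in>S. z - x i) =
        (\<Sum>i\<in>S. z * f z / (z - x i) * (1 / (\<Prod>j\<in>S - {i}. x i - x j)))"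
      using AE_circle_norm
    proof eventually_elim
      case (elim z)
      have "z \<notin> x ` S" using elim S(4) by fastforce
      from partial_fractions_simple[OF S(1-3) this]
      have "z * f z * (1 / (\<Prod>i\<in>S. z - x i)) = (\<Sum>i\<in>S. z * f z * (1 / ((z - x i) * (\<Prod>j\<in>S - {i}. x i - x j))))"
        by (simp only: sum_distrib_left)
      then show ?case by simp
    qed
  qed measurable
  also have "\<dots> = (\<Sum>i\<in>S. f (x i) * (1 / (\<Prod>j\<in>S - {i}. x i - x j)))"
  proof (subst Bochner_Integration.integral_sum)
    show "integrable circle_measure (\<lambda>z. z * f z / (z - x i) * (1 / (\<Prod>j\<in>S - {i}. x i - x j)))" if "i \<in> S" for i
      using int[OF that] by (rule integrable_mult_left)
    show "(\<Sum>i\<in>S. LINT z|circle_measure. z * f z / (z - x i) * (1 / (\<Prod>j\<in>S - {i}. x i - x j))) =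
        (\<Sum>i\<in>S. f (x i) * (1 / (\<Prod>j\<in>S - {i}. x i - x j)))"
      by (intro sum.cong refl, subst integral_mult_left_zero, subst circle_integral_Cauchy) (use f S(4) in auto)
  qed
  finally show ?thesis by simp
qed

section \<open>A single term of the symmetrization\<close>

text \<open>The set \<open>X\<close> contains the indices of the variables \<open>x\<^sub>i\<close>; all other indices belong to the \<open>y\<^sub>j\<close>.
  Removing variables shrinks the index set of an integral, while \<open>X\<close> and the shape of the integrand stay
  fixed, and so the recursion never renumbers variables.\<close>

definition pair_density :: "complex \<Rightarrow> nat set \<Rightarrow> (nat \<Rightarrow> complex) \<Rightarrow> nat \<Rightarrow> nat \<Rightarrow> complex" where
  "pair_density t X u v w =
     (if v \<in> X \<longleftrightarrow> w \<in> X then (1 - u v * inverse (u w)) * (1 - u w * inverse (u v))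
      else 1 / ((1 - t * u v * inverse (u w)) * (1 - t * u w * inverse (u v))))"

definition pair_factor :: "complex \<Rightarrow> nat set \<Rightarrow> (nat \<Rightarrow> complex) \<Rightarrow> nat \<Rightarrow> nat \<Rightarrow> complex" where
  "pair_factor t X u v w = (u v - t * u w) / (u v - u w) * pair_density t X u v w"

text \<open>The term of the symmetrization that belongs to the ordering \<open>vs\<close> of the variables, multiplied by the
  density. The density is distributed over the pairs, since the density factors of a pair of variables
  of the same kind cancel the pole of the Hall--Littlewood quotient; and the recursion collects in one
  factor all that involves the first variable, which is integrated first.\<close>

fun ordered_term :: "complex \<Rightarrow> nat set \<Rightarrow> (nat \<Rightarrow> complex) \<Rightarrow> int list \<Rightarrow> nat list \<Rightarrow> complex" where
  "ordered_term t X u (k # ks) (v # vs) =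
     u v powi k * (\<Prod>w\<in>set vs. pair_factor t X u v w) * ordered_term t X u ks vs"
| "ordered_term t X u ks vs = 1"

text \<open>Isolates a variable in the middle of the ordering. It enters the pairs with earlier variables in
  second place and the pairs with later ones in first place.\<close>

lemma ordered_term_insert:
  assumes "length ks = length pre" "distinct (pre @ a # post)"
  shows "ordered_term t X u (ks @ k # ks') (pre @ a # post) =
    ordered_term t X u (ks @ ks') (pre @ post) * (u a powi k *
      (\<Prod>w\<in>set pre. pair_factor t X u w a) * (\<Prod>w\<in>set post. pair_factor t X u a w))"
  using assms
proof (induction ks pre rule: list_induct2)
  case Nil
  then show ?case by simp
next
  case (Cons k0 ks v pre)
  have "set (pre @ a # post) = insert a (set (pre @ post))" "a \<notin> set (pre @ post)"
    "v \<notin> set pre"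
    using Cons.prems by auto
  then show ?case using Cons by simp
qed

lemma norm_one_minus_ge:
  assumes "norm x \<le> c" shows "1 - c \<le> norm (1 - x :: complex)"
  using assms norm_triangle_ineq2[of 1 x] by simp

lemma norm_power_int_le:
  assumes "\<rho> \<le> norm z" "norm z \<le> 1" "0 < \<rho>" "\<rho> \<le> 1"
  shows "norm (z powi k :: complex) \<le> (1 / \<rho>) ^ nat \<bar>k\<bar>"
proof (cases "k \<ge> 0")
  case True
  have "norm z ^ nat k \<le> 1" using assms by (simp add: power_le_one)
  also have "1 \<le> (1 / \<rho>) ^ nat k" using assms by (simp add: one_le_power)
  finally show ?thesis using True by (simp add: power_int_def norm_power)
next
  case False
  have "inverse (norm z) \<le> 1 / \<rho>" using assms by (simp add: inverse_eq_divide frac_le)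
  then have "inverse (norm z) ^ nat (- k) \<le> (1 / \<rho>) ^ nat (- k)"
    by (intro power_mono) auto
  then show ?thesis using False by (simp add: power_int_def norm_power norm_inverse)
qed

text \<open>The variables with index in \<open>X\<close> move on the circle of radius \<open>r\<close> (inner variables), the others on
  the unit circle (outer variables). The bounds on \<open>r\<close> separate the two circles from each
  other and from the disc of radius \<open>|t|\<close>, which contains all points \<open>t w\<close> with \<open>|w| \<le> 1\<close>.\<close>

locale two_radii =
  fixes t :: complex and r :: real and X :: "nat set"
  assumes t_less_r: "norm t < r" and r_less_1: "r < 1"
begin

lemma r_pos: "0 < r"
  using t_less_r norm_ge_zero[of t] by linarith

lemma t_less_1: "norm t < 1"
  using t_less_r r_less_1 by linarith

text \<open>The points of the torus with the two radii at which the quotients in the integrand have nonzero denominators.\<close>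

definition generic :: "nat set \<Rightarrow> (nat \<Rightarrow> complex) \<Rightarrow> bool" where
  "generic V u \<longleftrightarrow> (\<forall>i\<in>V. norm (u i) = (if i \<in> X then r else 1)) \<and> inj_on u V"

lemma generic_subset: "generic V u \<Longrightarrow> W \<subseteq> V \<Longrightarrow> generic W u"
  by (auto simp: generic_def inj_on_subset)

lemma generic_nonzero: "generic V u \<Longrightarrow> v \<in> V \<Longrightarrow> u v \<noteq> 0"
  using r_pos by (auto simp: generic_def dest!: bspec split: if_splits)

lemma generic_bounds:
  assumes "generic V u" "v \<in> V"
  shows "r \<le> norm (u v)" "norm (u v) \<le> 1"
  using assms r_less_1 by (auto simp: generic_def)

lemma generic_neq: "generic V u \<Longrightarrow> v \<in> V \<Longrightarrow> w \<in> V \<Longrightarrow> v \<noteq> w \<Longrightarrow> u v \<noteq> u w"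
  by (auto simp: generic_def inj_on_def)

lemma norm_t_mult_less: "norm c \<le> 1 \<Longrightarrow> norm (t * c) < r"
  using t_less_r mult_left_mono[of "norm c" 1 "norm t"] by (simp add: norm_mult)

lemma generic_neq_t:
  assumes "generic V u" "v \<in> V" "norm c \<le> 1"
  shows "u v \<noteq> t * c"
  using norm_t_mult_less[OF assms(3)] generic_bounds(1)[OF assms(1,2)] by auto

text \<open>The holomorphic part of all factors that involve a first variable \<open>\<zeta>\<close> with exponent \<open>k\<close>: the set
  \<open>S\<close> contains the other variables of the same kind as \<open>\<zeta>\<close>, and \<open>D\<close> those of the other kind. Split off
  are powers of \<open>\<zeta>\<close> and the poles at the variables in \<open>D\<close>.\<close>

definition peeled :: "nat \<Rightarrow> nat set \<Rightarrow> nat set \<Rightarrow> (nat \<Rightarrow> complex) \<Rightarrow> complex \<Rightarrow> complex" where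
  "peeled k S D u \<zeta> = \<zeta> ^ k * (\<Prod>w\<in>S. (\<zeta> - t * u w) * (1 - \<zeta> / u w)) * (\<Prod>w\<in>D. 1 / (1 - t * \<zeta> / u w))"

text \<open>The pole at \<open>u v = u w\<close> cancels against the density.\<close>

lemma pair_factor_same_side:
  assumes "v \<in> X \<longleftrightarrow> w \<in> X" "u v \<noteq> 0" "u w \<noteq> 0" "u v \<noteq> u w"
  shows "pair_factor t X u v w = (u v - t * u w) * (1 - u v / u w) / u v"
proof -
  define B where "B = u v - u w"
  have "B \<noteq> 0" "1 - u w / u v = B / u v" using assms by (simp_all add: B_def diff_divide_distrib)
  then show ?thesis
    using assms(1-3) unfolding pair_factor_def pair_density_def B_def[symmetric]
    by (simp add: divide_inverse[symmetric])
qed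

text \<open>The numerator \<open>u v - t * u w\<close> cancels against the density, so that inside the disc no pole
  at \<open>t * u w\<close> is left.\<close>

lemma pair_factor_other_side:
  assumes "v \<in> X \<longleftrightarrow> w \<notin> X" "u v \<noteq> 0" "u w \<noteq> 0" "u v \<noteq> t * u w"
  shows "pair_factor t X u v w = u v * (1 / (1 - t * u v / u w)) / (u v - u w)"
proof -
  define E where "E = u v - t * u w"
  have E: "E \<noteq> 0" "1 - t * u w * inverse (u v) = E / u v"
    using assms by (simp_all add: E_def diff_divide_distrib) (simp add: divide_inverse mult.assoc)
  have "pair_factor t X u v w = E / (u v - u w) * (1 / ((1 - t * u v / u w) * (E / u v)))"
    using assms(1) unfolding pair_factor_def pair_density_def E(2) by (simp add: E_def divide_inverse[symmetric])
  also have "\<dots> = u v * (1 / (1 - t * u v / u w)) / (u v - u w)"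
    using E(1) by simp
  finally show ?thesis .
qed

text \<open>Each variable in \<open>S\<close> contributes a factor \<open>1 / u v\<close> and each one in \<open>D\<close> a factor \<open>u v\<close>. There is one
  more of the latter, and the surplus factor \<open>u v\<close> is the one that Cauchy's formula asks for.\<close>

lemma head_factor_eq_peeled:
  assumes "finite W" "v \<notin> W" "generic (insert v W) u"
    and S: "S = {w \<in> W. w \<in> X \<longleftrightarrow> v \<in> X}" and D: "D = {w \<in> W. w \<in> X \<longleftrightarrow> v \<notin> X}"
    and "card D = Suc (card S)"
  shows "u v powi int k * (\<Prod>w\<in>W. pair_factor t X u v w) =
    u v * peeled k S D u (u v) / (\<Prod>w\<in>D. u v - u w)"
proof -
  have W: "W = S \<union> D" "S \<inter> D = {}" "finite S" "finite D" using S D assms(1) by auto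
  have inS: "w \<in> W" "w \<in> X \<longleftrightarrow> v \<in> X" if "w \<in> S" for w using that S by auto
  have inD: "w \<in> W" "v \<in> X \<longleftrightarrow> w \<notin> X" if "w \<in> D" for w using that D by auto
  have v0: "u v \<noteq> 0" using assms(3) generic_nonzero by blast
  have w: "u w \<noteq> 0" "u v \<noteq> u w" "u v \<noteq> t * u w" "u w \<noteq> t * u v" if "w \<in> W" for w
    using that assms(1-3) generic_nonzero[of "insert v W" u] generic_neq[of "insert v W" u v w]
      generic_neq_t[of "insert v W" u] generic_bounds(2)[of "insert v W" u] by auto
  have "(\<Prod>w\<in>W. pair_factor t X u v w) =
      (\<Prod>w\<in>S. pair_factor t X u v w) * (\<Prod>w\<in>D. pair_factor t X u v w)"
    using W by (simp add: prod.union_disjoint)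
  also have "(\<Prod>w\<in>S. pair_factor t X u v w) = (\<Prod>w\<in>S. (u v - t * u w) * (1 - u v / u w) / u v)"
    by (intro prod.cong refl pair_factor_same_side v0 w inS inS(2)[symmetric])
  also have "\<dots> = (\<Prod>w\<in>S. (u v - t * u w) * (1 - u v / u w)) / u v ^ card S"
    by (subst prod_dividef) simp
  also have "(\<Prod>w\<in>D. pair_factor t X u v w) = (\<Prod>w\<in>D. u v * (1 / (1 - t * u v / u w)) / (u v - u w))"
    by (intro prod.cong refl pair_factor_other_side v0 w inD)
  also have "\<dots> = u v ^ card D * (\<Prod>w\<in>D. 1 / (1 - t * u v / u w)) / (\<Prod>w\<in>D. u v - u w)"
    by (simp only: prod_dividef prod.distrib prod_constant)
  finally show ?thesis
    using v0 assms(6) by (simp add: peeled_def)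
qed

text \<open>At the residue the first variable takes the value \<open>u a\<close>. The conditional factor on the left is its
  interaction with \<open>w\<close>. Up to a power of \<open>u a\<close> it is inverse to the interaction of \<open>a\<close> itself with a
  variable \<open>w\<close> that precedes \<open>a\<close>.\<close>

lemma peeled_residue_cancel_pre:
  assumes "a \<in> X" "u a \<noteq> 0" "u w \<noteq> 0" "u a \<noteq> u w" "u a \<noteq> t * u w" "u w \<noteq> t * u a"
  shows "(if w \<in> X then 1 / ((1 - t * u a / u w) * (u a - u w)) else (u a - t * u w) * (1 - u a / u w))
      * pair_factor t X u w a = (if w \<in> X then 1 / u a else u a)"
proof -
  define A B E where "A = u w - t * u a" and "B = u a - u w" and "E = u a - t * u w"
  have nz: "A \<noteq> 0" "B \<noteq> 0" "E \<noteq> 0" using assms by (auto simp: A_def B_def E_def)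
  have eqs: "u w - t * u a = A" "u a - u w = B" "u a - t * u w = E" "u w - u a = - B" "t * u w - u a = - E"
    "1 - t * u a / u w = A / u w" "1 - u w / u a = B / u a" "1 - t * u w / u a = E / u a" "1 - u a / u w = - B / u w"
    using assms by (simp_all add: A_def B_def E_def diff_divide_distrib)
  show ?thesis
  proof (cases "w \<in> X")
    case True
    then have "pair_factor t X u w a = A * (B / u a) / u w"
      using assms eqs by (subst pair_factor_same_side) auto
    then show ?thesis using True nz assms(2,3) by (simp add: eqs divide_simps mult_ac)
  next
    case False
    then have "pair_factor t X u w a = u w * (1 / (E / u a)) / (- B)"
      using assms eqs by (subst pair_factor_other_side) auto
    then show ?thesis using False nz assms(2,3) by (simp add: eqs divide_simps mult_ac)
  qed
qed

text \<open>If \<open>w\<close> follows \<open>a\<close>, the Hall--Littlewood quotient of \<open>a\<close> and \<open>w\<close> is the other way round, and the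
  cancellation leaves a quotient of the numerators.\<close>

lemma peeled_residue_cancel_post:
  assumes "a \<in> X" "u a \<noteq> 0" "u w \<noteq> 0" "u a \<noteq> u w" "u a \<noteq> t * u w" "u w \<noteq> t * u a"
  shows "(if w \<in> X then 1 / ((1 - t * u a / u w) * (u a - u w)) else (u a - t * u w) * (1 - u a / u w))
      * pair_factor t X u a w = (if w \<in> X then 1 / u a else u a) * ((t * u w - u a) / (u w - t * u a))"
proof -
  define A B E where "A = u w - t * u a" and "B = u a - u w" and "E = u a - t * u w"
  have nz: "A \<noteq> 0" "B \<noteq> 0" "E \<noteq> 0" using assms by (auto simp: A_def B_def E_def)
  have eqs: "u w - t * u a = A" "u a - u w = B" "u a - t * u w = E" "u w - u a = - B" "t * u w - u a = - E"
    "1 - t * u a / u w = A / u w" "1 - u w / u a = B / u a" "1 - t * u w / u a = E / u a" "1 - u a / u w = - B / u w"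
    using assms by (simp_all add: A_def B_def E_def diff_divide_distrib)
  show ?thesis
  proof (cases "w \<in> X")
    case True
    then have "pair_factor t X u a w = E * (- B / u w) / u a"
      using assms eqs by (subst pair_factor_same_side) auto
    then show ?thesis using True nz assms(2,3) by (simp add: eqs divide_simps mult_ac)
  next
    case False
    then have "pair_factor t X u a w = u a * (1 / (A / u w)) / B"
      using assms eqs by (subst pair_factor_other_side) auto
    then show ?thesis using False nz assms(2,3) by (simp add: eqs divide_simps mult_ac)
  qed
qed

text \<open>The powers of \<open>u a\<close> left by the single variables cancel because the remaining variables are equally
  many of each kind. The factor \<open>1 / (1 - t)\<close> is the interaction of the first variable with \<open>a\<close>.\<close>

lemma residue_factor:
  assumes V: "a \<notin> set (pre @ post)" "a \<in> X" "generic (insert a (set (pre @ post))) u"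
    and dist: "distinct (pre @ post)"
    and card: "card (set (pre @ post) \<inter> X) = card (set (pre @ post) - X)"
  shows "peeled k (set (pre @ post) - X) (insert a (set (pre @ post) \<inter> X)) u (u a)
      / (\<Prod>w\<in>set (pre @ post) \<inter> X. u a - u w) *
      (u a powi k' * (\<Prod>w\<in>set pre. pair_factor t X u w a) * (\<Prod>w\<in>set post. pair_factor t X u a w))
    = 1 / (1 - t) * u a powi (int k + k') * (\<Prod>w\<in>set post. (t * u w - u a) / (u w - t * u a))"
proof -
  define W where "W = set (pre @ post)"
  have fin: "finite W" by (simp add: W_def)
  have a0: "u a \<noteq> 0" using V(3) generic_nonzero by blast
  have w: "u w \<noteq> 0" "u a \<noteq> u w" "u a \<noteq> t * u w" "u w \<noteq> t * u a" if "w \<in> W" for w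
  proof -
    have "generic (insert a W) u" "w \<noteq> a" using V that by (auto simp: W_def)
    then show "u w \<noteq> 0" "u a \<noteq> u w" "u a \<noteq> t * u w" "u w \<noteq> t * u a"
      using that generic_nonzero[of "insert a W" u] generic_neq[of "insert a W" u a w]
      generic_neq_t[of "insert a W" u] generic_bounds(2)[of "insert a W" u] by auto
  qed
  \<comment> \<open>At the residue, \<open>q w\<close> is the interaction of the first variable with \<open>w\<close>;
     \<open>e w\<close> is the power of \<open>u a\<close> that survives the cancellation.\<close>
  define q where "q w = (if w \<in> X then 1 / ((1 - t * u a / u w) * (u a - u w))
    else (u a - t * u w) * (1 - u a / u w))" for w
  define e where "e w = (if w \<in> X then 1 / u a else u a)" for w
  have split: "(\<Prod>w\<in>W. f w) = (\<Prod>w\<in>W \<inter> X. f w) * (\<Prod>w\<in>W - X. f w)" for f :: "nat \<Rightarrow> complex"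
    using fin by (subst prod.union_disjoint[symmetric]) (auto intro!: prod.cong)
  have two: "(\<Prod>w\<in>W. f w) = (\<Prod>w\<in>set pre. f w) * (\<Prod>w\<in>set post. f w)" for f :: "nat \<Rightarrow> complex"
    using dist unfolding W_def set_append by (subst prod.union_disjoint) auto
  have "(\<Prod>w\<in>W. e w) = (1 / u a) ^ card (W \<inter> X) * u a ^ card (W - X)"
    by (subst split) (simp add: e_def)
  also have "\<dots> = 1" using a0 card by (simp add: W_def power_one_over)
  finally have e1: "(\<Prod>w\<in>W. e w) = 1" .
  have "peeled k (W - X) (insert a (W \<inter> X)) u (u a) / (\<Prod>w\<in>W \<inter> X. u a - u w)
      = 1 / (1 - t) * u a ^ k * ((\<Prod>w\<in>W - X. (u a - t * u w) * (1 - u a / u w)) *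
      ((\<Prod>w\<in>W \<inter> X. 1 / (1 - t * u a / u w)) / (\<Prod>w\<in>W \<inter> X. u a - u w)))"
    using fin V(1) a0 by (simp add: peeled_def W_def)
  also have "\<dots> = 1 / (1 - t) * u a ^ k * (\<Prod>w\<in>W. q w)"
    by (subst split) (simp add: q_def prod_dividef[symmetric] prod.distrib)
  finally have *: "peeled k (W - X) (insert a (W \<inter> X)) u (u a) / (\<Prod>w\<in>W \<inter> X. u a - u w) =
      1 / (1 - t) * u a ^ k * (\<Prod>w\<in>W. q w)" .
  have "(\<Prod>w\<in>W. q w) * (\<Prod>w\<in>set pre. pair_factor t X u w a) * (\<Prod>w\<in>set post. pair_factor t X u a w)
     = (\<Prod>w\<in>set pre. q w * pair_factor t X u w a) * (\<Prod>w\<in>set post. q w * pair_factor t X u a w)"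
    by (simp add: two prod.distrib mult_ac)
  also have "(\<Prod>w\<in>set pre. q w * pair_factor t X u w a) = (\<Prod>w\<in>set pre. e w)"
    unfolding q_def e_def using w V(2) a0
    by (intro prod.cong refl peeled_residue_cancel_pre) (auto simp: W_def)
  also have "(\<Prod>w\<in>set post. q w * pair_factor t X u a w) =
      (\<Prod>w\<in>set post. e w * ((t * u w - u a) / (u w - t * u a)))"
    unfolding q_def e_def using w V(2) a0
    by (intro prod.cong refl peeled_residue_cancel_post) (auto simp: W_def)
  also have "(\<Prod>w\<in>set pre. e w) * \<dots> = (\<Prod>w\<in>W. e w) * (\<Prod>w\<in>set post. (t * u w - u a) / (u w - t * u a))"
    by (simp only: two prod.distrib mult_ac)
  finally have **: "(\<Prod>w\<in>W. q w) * (\<Prod>w\<in>set pre. pair_factor t X u w a) * (\<Prod>w\<in>set post. pair_factor t X u a w) =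
      (\<Prod>w\<in>set post. (t * u w - u a) / (u w - t * u a))"
    by (simp add: e1)
  show ?thesis
    unfolding W_def[symmetric] * using ** a0
    by (simp add: power_int_add mult_ac)
qed

lemma pair_factor_bounded:
  assumes "generic V u" "v \<in> V" "w \<in> V" "v \<noteq> w"
  shows "norm (pair_factor t X u v w) \<le> 4 / r + 2 / ((1 - norm t / r) * (1 - r))"
proof -
  note b = generic_bounds[OF assms(1,2)] generic_bounds[OF assms(1,3)]
  have nz: "u v \<noteq> 0" "u w \<noteq> 0" "u v \<noteq> u w" "u v \<noteq> t * u w" "u w \<noteq> t * u v"
    using assms generic_nonzero[of V u] generic_neq[of V u v w] generic_neq_t[of V u]
      generic_bounds(2)[of V u] by auto
  have quot: "norm (u v / u w) \<le> 1 / r"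
    using b r_pos by (simp add: norm_divide frac_le)
  have tq: "norm t / r < 1" using t_less_r r_pos by simp
  have num: "norm (u v - t * u w) \<le> 2"
    using norm_triangle_ineq4[of "u v" "t * u w"] norm_t_mult_less[of "u w"] b r_less_1 by linarith
  show ?thesis
  proof (cases "v \<in> X \<longleftrightarrow> w \<in> X")
    case True
    have "norm (u v - u w) \<le> 2" using norm_triangle_ineq4[of "u v" "u w"] b by linarith
    moreover have "norm (u v) = norm (u w)" using True assms by (auto simp: generic_def)
    ultimately have "norm (1 - u v / u w) \<le> 2"
      using norm_triangle_ineq4[of 1 "u v / u w"] nz by (simp add: norm_divide)
    then have "norm ((u v - t * u w) * (1 - u v / u w)) \<le> 2 * 2"
      unfolding norm_mult using num by (intro mult_mono) auto
    then have "norm (pair_factor t X u v w) \<le> 4 / r"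
      unfolding pair_factor_same_side[OF True nz(1-3)] norm_divide
      using b r_pos by (intro frac_le) auto
    moreover have "0 \<le> 2 / ((1 - norm t / r) * (1 - r))" using tq r_less_1 by simp
    ultimately show ?thesis by linarith
  next
    case False
    then have os: "v \<in> X \<longleftrightarrow> w \<notin> X" by auto
    have "norm (t * u v / u w) \<le> norm t / r"
      using mult_left_mono[OF quot, of "norm t"] by (simp add: norm_mult norm_divide)
    then have 1: "1 - norm t / r \<le> norm (1 - t * u v / u w)" by (rule norm_one_minus_ge)
    have "1 - r \<le> \<bar>norm (u v) - norm (u w)\<bar>"
      using os assms r_less_1 by (auto simp: generic_def)
    then have 2: "1 - r \<le> norm (u v - u w)" using norm_triangle_ineq3[of "u v" "u w"] by linarith
    have "pair_factor t X u v w = u v / ((1 - t * u v / u w) * (u v - u w))"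
      using pair_factor_other_side[OF os nz(1,2,4)] by simp
    then have "norm (pair_factor t X u v w) \<le> 2 / ((1 - norm t / r) * (1 - r))"
      unfolding norm_divide norm_mult using b 1 2 tq r_less_1
      by (auto simp: norm_divide norm_mult intro!: frac_le mult_mono)
    moreover have "0 \<le> 4 / r" using r_pos by simp
    ultimately show ?thesis by linarith
  qed
qed

text \<open>This makes every single term integrable. The bound blows up for \<open>r \<rightarrow> 1\<close> because the two circles
  approach each other.\<close>

lemma ordered_term_bounded:
  assumes "distinct vs"
  shows "\<exists>B. \<forall>u. generic (set vs) u \<longrightarrow> norm (ordered_term t X u ks vs) \<le> B"
  using assms
proof (induction vs arbitrary: ks)
  case Nil
  show ?case by (auto intro!: exI[of _ 1])
next
  case (Cons v vs)
  show ?case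
  proof (cases ks)
    case Nil
    then show ?thesis by (auto intro!: exI[of _ 1])
  next
    case ks: (Cons k ks')
    obtain B where B: "\<And>u. generic (set vs) u \<Longrightarrow> norm (ordered_term t X u ks' vs) \<le> B"
      using Cons by fastforce
    define C where "C = 4 / r + 2 / ((1 - norm t / r) * (1 - r))"
    show ?thesis
    proof (intro exI allI impI)
      fix u assume u: "generic (set (v # vs)) u"
      have "norm (u v powi k) \<le> (1 / r) ^ nat \<bar>k\<bar>"
        using generic_bounds[OF u, of v] r_pos r_less_1 by (intro norm_power_int_le) auto
      moreover have "norm (\<Prod>w\<in>set vs. pair_factor t X u v w) \<le> (\<Prod>w\<in>set vs. C)"
        unfolding prod_norm[symmetric] using Cons.prems u
        by (intro prod_mono) (auto simp: C_def intro!: pair_factor_bounded)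
      moreover have "norm (ordered_term t X u ks' vs) \<le> B"
        by (intro B generic_subset[OF u]) auto
      ultimately show "norm (ordered_term t X u ks (v # vs)) \<le>
          (1 / r) ^ nat \<bar>k\<bar> * (\<Prod>w\<in>set vs. C) * B"
        unfolding ks ordered_term.simps norm_mult
        by (intro mult_mono') (auto intro: mult_nonneg_nonneg)
    qed
  qed
qed

end

section \<open>Integrating out a pair of variables\<close>

lemma borel_measurable_power_int [measurable]:
  fixes f :: "'a \<Rightarrow> complex"
  assumes [measurable]: "f \<in> borel_measurable M"
  shows "(\<lambda>x. f x powi k) \<in> borel_measurable M"
  by (cases "k \<ge> 0") (simp_all add: power_int_def)

lemma borel_measurable_pair_factor:
  assumes [measurable]: "(\<lambda>z. f z v) \<in> borel_measurable M" "(\<lambda>z. f z w) \<in> borel_measurable M"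
  shows "(\<lambda>z. pair_factor t X (f z) v w) \<in> borel_measurable M"
  unfolding pair_factor_def pair_density_def by measurable

lemma borel_measurable_ordered_term:
  assumes "\<And>v. v \<in> set vs \<Longrightarrow> (\<lambda>z. f z v) \<in> borel_measurable M"
  shows "(\<lambda>z. ordered_term t X (f z) ks vs) \<in> borel_measurable M"
  using assms
proof (induction vs arbitrary: ks)
  case Nil
  then show ?case by (cases ks) auto
next
  case (Cons v vs)
  then show ?case
    by (cases ks) (auto intro!: borel_measurable_times borel_measurable_prod
      borel_measurable_power_int borel_measurable_pair_factor)
qed

lemma pair_factor_cong:
  assumes "u v = u' v" "u w = u' w"
  shows "pair_factor t X u v w = pair_factor t X u' v w"
  using assms by (simp add: pair_factor_def pair_density_def)

lemma ordered_term_cong: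
  assumes "\<And>v. v \<in> set vs \<Longrightarrow> u v = u' v"
  shows "ordered_term t X u ks vs = ordered_term t X u' ks vs"
  using assms
proof (induction vs arbitrary: ks)
  case Nil
  then show ?case by (cases ks) auto
next
  case (Cons v vs)
  have "(\<Prod>w\<in>set vs. pair_factor t X u v w) = (\<Prod>w\<in>set vs. pair_factor t X u' v w)"
    using Cons.prems by (intro prod.cong refl pair_factor_cong) auto
  then show ?case using Cons by (cases ks) auto
qed

abbreviation torus :: "nat set \<Rightarrow> (nat \<Rightarrow> complex) measure" where
  "torus V \<equiv> PiM V (\<lambda>_. circle_measure)"

lemma borel_measurable_circle: "borel_measurable circle_measure = borel_measurable borel"
  by (intro measurable_cong_sets) auto

lemma prob_space_torus: "prob_space (torus V)"
  by (rule prob_space_PiM) (rule prob_space_circle_measure)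

lemma measurable_torus_component: "i \<in> V \<Longrightarrow> (\<lambda>z. z i) \<in> borel_measurable (torus V)"
  using measurable_component_singleton[of i V "\<lambda>_. circle_measure"]
  by (simp cong: measurable_cong_sets)

lemma integrable_torus_bounded:
  fixes f :: "(nat \<Rightarrow> complex) \<Rightarrow> complex"
  assumes "f \<in> borel_measurable (torus V)" "AE z in torus V. norm (f z) \<le> B"
  shows "integrable (torus V) f"
proof -
  interpret prob_space "torus V" by (rule prob_space_torus)
  show ?thesis using assms(2,1) by (rule integrable_const_bound)
qed

text \<open>Fubini's theorem. The inner integrals below are residue sums, which are valid only for distinct values
  of the other variables, so they are known almost everywhere.\<close>

lemma torus_integral_insert_AE:
  fixes F G :: "(nat \<Rightarrow> complex) \<Rightarrow> complex"
  assumes V: "finite V" "v \<notin> V" and F: "integrable (torus (insert v V)) F"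
    and G: "G \<in> borel_measurable (torus V)"
    and eq: "AE z in torus V. (LINT x|circle_measure. F (z(v := x))) = G z"
  shows "(LINT z|torus (insert v V). F z) = (LINT z|torus V. G z)"
proof -
  have "F \<in> borel_measurable (torus (insert v V))" using F by simp
  then have "(\<lambda>(z, x). F (z(v := x))) \<in> borel_measurable (torus V \<Otimes>\<^sub>M circle_measure)"
    using measurable_compose[OF measurable_add_dim[of v V "\<lambda>_. circle_measure"]]
    by (simp add: case_prod_unfold)
  then have "(\<lambda>z. LINT x|circle_measure. F (z(v := x))) \<in> borel_measurable (torus V)"
    by (rule circle.borel_measurable_lebesgue_integral)
  then have "(LINT z|torus V. LINT x|circle_measure. F (z(v := x))) = (LINT z|torus V. G z)"
    using G eq by (rule integral_cong_AE)
  then show ?thesis using circles.product_integral_insert[OF V F] by simp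
qed

definition delete_nth :: "nat \<Rightarrow> 'a list \<Rightarrow> 'a list" where
  "delete_nth p xs = take p xs @ drop (Suc p) xs"

context two_radii
begin

definition scaled :: "(nat \<Rightarrow> complex) \<Rightarrow> nat \<Rightarrow> complex" where
  "scaled z = (\<lambda>i. (if i \<in> X then of_real r else 1) * z i)"

lemma scaled_update: "scaled (z(v := x)) = (scaled z)(v := (if v \<in> X then of_real r else 1) * x)"
  by (auto simp: scaled_def)

lemma generic_insert_update:
  assumes "generic V u" "v \<notin> V" "norm x = 1" "(if v \<in> X then of_real r else 1) * x \<notin> u ` V"
  shows "generic (insert v V) (u(v := (if v \<in> X then of_real r else 1) * x))"
proof -
  define c where "c = (if v \<in> X then complex_of_real r else 1) * x"
  have n: "norm c = (if v \<in> X then r else 1)"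
    using assms(3) r_pos by (simp add: c_def norm_mult)
  have "\<forall>i\<in>V. norm ((u(v := c)) i) = (if i \<in> X then r else 1)"
    using assms(1,2) by (auto simp: generic_def)
  moreover have "inj_on (u(v := c)) (insert v V)"
  proof -
    have "inj_on (u(v := c)) V" using assms(1,2) by (auto simp: generic_def inj_on_def)
    moreover have "(u(v := c)) ` V = u ` V" using assms(2) by auto
    ultimately show ?thesis using assms(2,4) by (simp add: c_def[symmetric])
  qed
  ultimately show ?thesis
    unfolding c_def[symmetric] generic_def using n by simp
qed

lemma measurable_scaled: "v \<in> V \<Longrightarrow> (\<lambda>z. scaled z v) \<in> borel_measurable (torus V)"
  unfolding scaled_def by (intro borel_measurable_times measurable_torus_component) auto

lemma AE_generic:
  assumes "finite V"
  shows "AE z in torus V. generic V (scaled z)"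
  using AE_circles_norm[OF assms] AE_circles_inj[OF assms]
proof eventually_elim
  case (elim z)
  have n: "norm (scaled z i) = (if i \<in> X then r else 1)" if "i \<in> V" for i
    using that elim(1) r_pos by (auto simp: scaled_def norm_mult)
  moreover have "inj_on (scaled z) V"
  proof (rule inj_onI)
    fix i j assume ij: "i \<in> V" "j \<in> V" "scaled z i = scaled z j"
    then have "i \<in> X \<longleftrightarrow> j \<in> X"
      using n[of i] n[of j] r_less_1 by (auto split: if_splits)
    then have "z i = z j" using ij(3) r_pos by (auto simp: scaled_def split: if_splits)
    then show "i = j" using elim(2) ij by (auto simp: inj_on_def)
  qed
  ultimately show ?case by (simp add: generic_def)
qed

lemma AE_generic_update:
  assumes "finite V" "v \<notin> V" "generic V u"
  shows "AE x in circle_measure. generic (insert v V) (u(v := (if v \<in> X then of_real r else 1) * x))"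
proof -
  define c where "c = (if v \<in> X then complex_of_real r else 1)"
  have "c \<noteq> 0" using r_pos by (simp add: c_def)
  have "AE x in circle_measure. \<forall>w\<in>V. x \<noteq> u w / c"
    by (intro AE_finite_allI assms AE_circle_neq)
  with AE_circle_norm show ?thesis
  proof eventually_elim
    case (elim x)
    have "c * x \<noteq> u w" if "w \<in> V" for w
      using bspec[OF elim(2) that] \<open>c \<noteq> 0\<close> by (auto simp: field_simps)
    then have "c * x \<notin> u ` V" by auto
    then show ?case using generic_insert_update[OF assms(3,2) elim(1)] by (simp add: c_def)
  qed
qed

lemma integrable_ordered_term:
  assumes "distinct vs" "set vs \<subseteq> V" "finite V"
  shows "integrable (torus V) (\<lambda>z. ordered_term t X (scaled z) ks vs)"
proof -
  obtain B where "\<And>u. generic (set vs) u \<Longrightarrow> norm (ordered_term t X u ks vs) \<le> B"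
    using ordered_term_bounded[OF assms(1)] by blast
  moreover have "AE z in torus V. generic (set vs) (scaled z)"
    using AE_generic[OF assms(3)] by eventually_elim (use assms(2) generic_subset in blast)
  ultimately have "AE z in torus V. norm (ordered_term t X (scaled z) ks vs) \<le> B"
    by (auto elim: eventually_mono)
  then show ?thesis
    using assms by (intro integrable_torus_bounded borel_measurable_ordered_term measurable_scaled) auto
qed

lemma peeled_cong:
  assumes "\<And>w. w \<in> S \<union> D \<Longrightarrow> u w = u' w"
  shows "peeled k S D u \<zeta> = peeled k S D u' \<zeta>"
  unfolding peeled_def using assms
  by (intro arg_cong2[where f = times] refl prod.cong) auto

lemma measurable_peeled [measurable]: "peeled k S D u \<in> borel_measurable borel"
  unfolding peeled_def by measurable

lemma peeled_holomorphic:
  assumes "generic (S \<union> D) u" "0 \<le> c" "c \<le> 1"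
  shows "(\<lambda>\<zeta>. peeled k S D u (of_real c * \<zeta>)) holomorphic_on ball 0 1"
    "continuous_on (cball 0 1) (\<lambda>\<zeta>. peeled k S D u (of_real c * \<zeta>))"
proof -
  have nz: "u w \<noteq> 0" if "w \<in> S \<union> D" for w
    using generic_nonzero[OF assms(1) that] .
  have nz': "1 - t * (of_real c * \<zeta>) / u w \<noteq> 0" if "\<zeta> \<in> cball 0 1" "w \<in> D" for \<zeta> w
  proof -
    have "norm (of_real c * \<zeta>) \<le> 1" using that assms(2,3) by (simp add: norm_mult mult_le_one)
    then have "u w \<noteq> t * (of_real c * \<zeta>)"
      using that by (intro generic_neq_t[OF assms(1)]) auto
    then show ?thesis using nz[of w] that by (simp add: field_simps)
  qed
  show "(\<lambda>\<zeta>. peeled k S D u (of_real c * \<zeta>)) holomorphic_on ball 0 1"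
    unfolding peeled_def
    by (intro holomorphic_intros) (use nz nz' ball_subset_cball in blast)+
  show "continuous_on (cball 0 1) (\<lambda>\<zeta>. peeled k S D u (of_real c * \<zeta>))"
    unfolding peeled_def
    by (intro continuous_intros) (use nz nz' in blast)+
qed

definition term_integral :: "int list \<Rightarrow> nat list \<Rightarrow> complex" where
  "term_integral ks vs = (LINT z|torus (set vs). ordered_term t X (scaled z) ks vs)"

definition head_factor :: "nat \<Rightarrow> nat \<Rightarrow> nat set \<Rightarrow> (nat \<Rightarrow> complex) \<Rightarrow> complex" where
  "head_factor k v W u = u v powi int k * (\<Prod>w\<in>W. pair_factor t X u v w)"

lemma term_integral_Cons:
  assumes "distinct (v # vs)" and "G \<in> borel_measurable (torus (set vs))"
    and "AE z in torus (set vs). (LINT x|circle_measure. head_factor k v (set vs)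
       ((scaled z)(v := (if v \<in> X then of_real r else 1) * x))) * ordered_term t X (scaled z) ks vs = G z"
  shows "term_integral (int k # ks) (v # vs) = (LINT z|torus (set vs). G z)"
proof -
  have "term_integral (int k # ks) (v # vs) =
      (LINT z|torus (insert v (set vs)). ordered_term t X (scaled z) (int k # ks) (v # vs))"
    by (simp add: term_integral_def)
  also have "\<dots> = (LINT z|torus (set vs). G z)"
  proof (rule torus_integral_insert_AE)
    show "integrable (torus (insert v (set vs))) (\<lambda>z. ordered_term t X (scaled z) (int k # ks) (v # vs))"
      using assms(1) by (intro integrable_ordered_term) auto
    have "(LINT x|circle_measure. ordered_term t X (scaled (z(v := x))) (int k # ks) (v # vs)) =
      (LINT x|circle_measure. head_factor k v (set vs)
        ((scaled z)(v := (if v \<in> X then of_real r else 1) * x)) * ordered_term t X (scaled z) ks vs)" for z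
      unfolding scaled_update
    proof (intro Bochner_Integration.integral_cong refl)
      fix x
      have "ordered_term t X ((scaled z)(v := (if v \<in> X then of_real r else 1) * x)) ks vs =
          ordered_term t X (scaled z) ks vs"
        using assms(1) by (intro ordered_term_cong) auto
      then show "ordered_term t X ((scaled z)(v := (if v \<in> X then of_real r else 1) * x)) (int k # ks) (v # vs) =
          head_factor k v (set vs) ((scaled z)(v := (if v \<in> X then of_real r else 1) * x)) * ordered_term t X (scaled z) ks vs"
        by (simp add: head_factor_def)
    qed
    then show "AE z in torus (set vs). (LINT x|circle_measure.
        ordered_term t X (scaled (z(v := x))) (int k # ks) (v # vs)) = G z"
      using assms(3) by simp
  qed (use assms in auto)
  finally show ?thesis .
qed

lemma AE_head_factor:
  assumes "finite W" "v \<notin> W" "generic W u"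
    and S: "S = {w \<in> W. w \<in> X \<longleftrightarrow> v \<in> X}" and D: "D = {w \<in> W. w \<in> X \<longleftrightarrow> v \<notin> X}"
    and "card D = Suc (card S)" and c: "c = (if v \<in> X then complex_of_real r else 1)"
  shows "AE x in circle_measure. head_factor k v W (u(v := c * x)) =
    c * x * peeled k S D u (c * x) / (\<Prod>w\<in>D. c * x - u w)"
  using AE_generic_update[OF assms(1-3)]
proof eventually_elim
  case (elim x)
  have neq: "w \<noteq> v" if "w \<in> S \<union> D" for w using that S D assms(2) by auto
  have "head_factor k v W (u(v := c * x)) =
      c * x * peeled k S D (u(v := c * x)) (c * x) / (\<Prod>w\<in>D. c * x - (u(v := c * x)) w)"
    unfolding head_factor_def
    using head_factor_eq_peeled[OF assms(1,2) elim S D assms(6), of k] by (simp add: c)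
  also have "peeled k S D (u(v := c * x)) (c * x) = peeled k S D u (c * x)"
    using neq by (intro peeled_cong) auto
  also have "(\<Prod>w\<in>D. c * x - (u(v := c * x)) w) = (\<Prod>w\<in>D. c * x - u w)"
    using neq by (intro prod.cong) auto
  finally show ?case .
qed

lemma measurable_head_factor:
  "(\<lambda>x. head_factor k v W (u(v := c * x))) \<in> borel_measurable borel"
proof -
  have "(\<lambda>x. (u(v := c * x)) w) \<in> borel_measurable borel" for w
    by (cases "w = v") auto
  then show ?thesis
    unfolding head_factor_def
    by (intro borel_measurable_times borel_measurable_power_int borel_measurable_prod borel_measurable_pair_factor)
qed

text \<open>The poles at the outer variables have modulus \<open>1 > r\<close>, so the mean value property applies, and the
  factor \<open>u v\<close> of \<open>head_factor_eq_peeled\<close> vanishes at the origin.\<close>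

lemma head_integral_inner:
  assumes "finite W" "v \<notin> W" "generic W u" "v \<in> X" "card (W - X) = Suc (card (W \<inter> X))"
  shows "(LINT x|circle_measure. head_factor k v W (u(v := of_real r * x))) = 0"
proof -
  have D: "W - X = {w \<in> W. w \<in> X \<longleftrightarrow> v \<notin> X}" "W \<inter> X = {w \<in> W. w \<in> X \<longleftrightarrow> v \<in> X}"
    using assms(4) by auto
  define f where "f x = of_real r * x * peeled k (W \<inter> X) (W - X) u (of_real r * x) / (\<Prod>w\<in>W - X. of_real r * x - u w)" for x
  have gen: "generic (W - X) u" using assms(3) generic_subset by blast
  have nz: "of_real r * x \<noteq> u w" if "x \<in> cball 0 1" "w \<in> W - X" for x w
  proof
    assume "of_real r * x = u w"
    then have "norm (of_real r * x) = 1" using that gen by (auto simp: generic_def)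
    moreover have "r * norm x \<le> r * 1" using that r_pos by (intro mult_left_mono) auto
    ultimately show False using r_pos r_less_1 by (simp add: norm_mult)
  qed
  have "(LINT x|circle_measure. head_factor k v W (u(v := of_real r * x))) = (LINT x|circle_measure. f x)"
  proof (rule integral_cong_AE)
    show "AE x in circle_measure. head_factor k v W (u(v := of_real r * x)) = f x"
      using AE_head_factor[OF assms(1-3) D(2,1) assms(5) refl, of k] assms(4) by (simp add: f_def)
  qed (auto simp: f_def borel_measurable_circle measurable_head_factor)
  also have "\<dots> = f 0"
  proof (rule circle_integral_mean_value)
    have "generic (W \<inter> X \<union> (W - X)) u" by (rule generic_subset[OF assms(3)]) blast
    note ph = peeled_holomorphic[OF this, of r k]
    show "f holomorphic_on ball 0 1"
      unfolding f_def using nz r_pos r_less_1 by (intro holomorphic_intros ph) (auto simp: assms(1))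
    show "continuous_on (cball 0 1) f"
      unfolding f_def using nz r_pos r_less_1 by (intro continuous_intros ph) (auto simp: assms(1))
  qed (simp add: f_def)
  finally show ?thesis by (simp add: f_def)
qed

text \<open>The inner variables, of modulus \<open>r < 1\<close>, are the only poles inside the unit circle.\<close>

lemma head_integral_outer:
  assumes "finite W" "v \<notin> W" "generic W u" "v \<notin> X" "card (W \<inter> X) = Suc (card (W - X))"
  shows "(LINT x|circle_measure. head_factor k v W (u(v := x))) =
    (\<Sum>a\<in>W \<inter> X. peeled k (W - X) (W \<inter> X) u (u a) / (\<Prod>w\<in>W \<inter> X - {a}. u a - u w))"
proof -
  have D: "W \<inter> X = {w \<in> W. w \<in> X \<longleftrightarrow> v \<notin> X}" "W - X = {w \<in> W. w \<in> X \<longleftrightarrow> v \<in> X}"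
    using assms(4) by auto
  have gen: "generic (W \<inter> X) u" using assms(3) generic_subset by blast
  have gen': "generic (W - X \<union> W \<inter> X) u" by (rule generic_subset[OF assms(3)]) blast
  have "(LINT x|circle_measure. head_factor k v W (u(v := x))) =
      (LINT x|circle_measure. x * peeled k (W - X) (W \<inter> X) u x / (\<Prod>w\<in>W \<inter> X. x - u w))"
  proof (rule integral_cong_AE)
    show "AE x in circle_measure. head_factor k v W (u(v := x)) =
        x * peeled k (W - X) (W \<inter> X) u x / (\<Prod>w\<in>W \<inter> X. x - u w)"
      using AE_head_factor[OF assms(1-3) D(2,1) assms(5) refl, of k] assms(4) by simp
  qed (use measurable_head_factor[of k v W u 1] in \<open>auto simp: borel_measurable_circle\<close>)
  also have "\<dots> = (\<Sum>a\<in>W \<inter> X. peeled k (W - X) (W \<inter> X) u (u a) / (\<Prod>w\<in>W \<inter> X - {a}. u a - u w))"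
  proof (rule circle_integral_residues)
    show "continuous_on (cball 0 1) (peeled k (W - X) (W \<inter> X) u)"
      "peeled k (W - X) (W \<inter> X) u holomorphic_on ball 0 1"
      using peeled_holomorphic[OF gen', of 1 k] by simp_all
    show "inj_on u (W \<inter> X)" using gen by (simp add: generic_def)
    show "\<And>i. i \<in> W \<inter> X \<Longrightarrow> cmod (u i) < 1" using gen r_less_1 by (simp add: generic_def)
    show "W \<inter> X \<noteq> {}" using assms(5) by force
  qed (use assms(1) in auto)
  finally show ?thesis .
qed

lemma term_integral_inner_first:
  assumes "distinct (v # vs)" "v \<in> X" "card (set vs - X) = Suc (card (set vs \<inter> X))"
  shows "term_integral (int k # ks) (v # vs) = 0"
proof -
  have "term_integral (int k # ks) (v # vs) = (LINT z|torus (set vs). 0)"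
  proof (rule term_integral_Cons[OF assms(1)])
    have "AE z in torus (set vs). generic (set vs) (scaled z)" by (intro AE_generic) simp
    then show "AE z in torus (set vs). (LINT x|circle_measure. head_factor k v (set vs)
       ((scaled z)(v := (if v \<in> X then of_real r else 1) * x))) * ordered_term t X (scaled z) ks vs = 0"
      by eventually_elim (use assms head_integral_inner in auto)
  qed simp
  then show ?thesis by simp
qed

text \<open>What the residue at \<open>a\<close> leaves as a function of \<open>u a\<close>, by \<open>residue_factor\<close>; the set \<open>W\<close> contains the
  variables after \<open>a\<close>.\<close>

definition tail_factor :: "nat \<Rightarrow> nat \<Rightarrow> nat set \<Rightarrow> (nat \<Rightarrow> complex) \<Rightarrow> complex" where
  "tail_factor m a W u = u a ^ m * (\<Prod>w\<in>W. (t * u w - u a) / (u w - t * u a))"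

lemma tail_factor_bounded:
  assumes "finite W" "a \<notin> W" "generic (insert a W) u"
  shows "norm (tail_factor m a W u) \<le> (2 / (r - norm t)) ^ card W"
proof -
  have "norm (u a ^ m) \<le> 1"
    using generic_bounds(2)[OF assms(3), of a] by (simp add: norm_power power_le_one)
  moreover have "norm (\<Prod>w\<in>W. (t * u w - u a) / (u w - t * u a)) \<le> (\<Prod>w\<in>W. 2 / (r - norm t))"
    unfolding prod_norm[symmetric]
  proof (intro prod_mono conjI)
    fix w assume w: "w \<in> W"
    note b = generic_bounds[OF assms(3), of a] generic_bounds[OF assms(3), of w]
    have "norm (t * u w - u a) \<le> 2"
      using norm_triangle_ineq4[of "t * u w" "u a"] norm_t_mult_less[of "u w"] b w r_less_1 by auto
    moreover have "norm (t * u a) \<le> norm t"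
      using b by (simp add: norm_mult mult_left_le)
    then have "r - norm t \<le> norm (u w - t * u a)"
      using norm_triangle_ineq2[of "u w" "t * u a"] b w by auto
    ultimately show "norm ((t * u w - u a) / (u w - t * u a)) \<le> 2 / (r - norm t)"
      unfolding norm_divide using t_less_r by (intro frac_le) auto
  qed simp
  ultimately have "norm (tail_factor m a W u) \<le> 1 * (\<Prod>w\<in>W. 2 / (r - norm t))"
    unfolding tail_factor_def norm_mult by (intro mult_mono') auto
  then show ?thesis by simp
qed

text \<open>The poles \<open>u w / t\<close> lie outside the disc of radius \<open>r\<close>, so the integral is the value at \<open>u a = 0\<close>.\<close>

lemma tail_integral:
  assumes "finite W" "a \<notin> W" "generic W u" "a \<in> X"
  shows "(LINT x|circle_measure. tail_factor m a W (u(a := of_real r * x))) =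
    (if m = 0 then t ^ card W else 0)"
proof -
  define f where "f x = (of_real r * x) ^ m * (\<Prod>w\<in>W. (t * u w - of_real r * x) / (u w - t * (of_real r * x)))" for x
  have nz: "u w - t * (of_real r * x) \<noteq> 0" if "x \<in> cball 0 1" "w \<in> W" for x w
  proof -
    have "norm (of_real r * x) \<le> 1" using that r_pos r_less_1 by (simp add: norm_mult mult_le_one)
    then show ?thesis using generic_neq_t[OF assms(3) that(2)] by auto
  qed
  have "tail_factor m a W (u(a := of_real r * x)) = f x" for x
    unfolding tail_factor_def f_def using assms(2)
    by (intro arg_cong2[where f = times] prod.cong) auto
  then have "(LINT x|circle_measure. tail_factor m a W (u(a := of_real r * x))) = (LINT x|circle_measure. f x)"
    by simp
  also have "\<dots> = f 0"
  proof (rule circle_integral_mean_value)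
    show "f holomorphic_on ball 0 1"
      unfolding f_def using nz by (intro holomorphic_intros) auto
    show "continuous_on (cball 0 1) f"
      unfolding f_def using nz by (intro continuous_intros) auto
  qed (simp add: f_def)
  also have "f 0 = (if m = 0 then t ^ card W else 0)"
  proof -
    have "(\<Prod>w\<in>W. t * u w / u w) = (\<Prod>w\<in>W. t)"
      using generic_nonzero[OF assms(3)] by (intro prod.cong) auto
    then show ?thesis by (simp add: f_def)
  qed
  finally show ?thesis .
qed

text \<open>The variable \<open>a\<close> occurs only in \<open>tail_factor\<close>, so it can be integrated out.\<close>

lemma term_integral_residue:
  fixes m :: nat and ks :: "int list"
  assumes "distinct (pre @ a # post)" "a \<in> X"
  defines "W \<equiv> set (pre @ a # post)"
  defines "F \<equiv> \<lambda>z. 1 / (1 - t) * tail_factor m a (set post) (scaled z) * ordered_term t X (scaled z) ks (pre @ post)"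
  shows "integrable (torus W) F"
    and "(LINT z|torus W. F z) =
      (if m = 0 then t ^ length post / (1 - t) * term_integral ks (pre @ post) else 0)"
proof -
  define V where "V = set (pre @ post)"
  have W: "W = insert a V" by (auto simp: W_def V_def)
  have aV: "a \<notin> V" "finite V" "set post \<subseteq> V" "a \<notin> set post" using assms(1) by (auto simp: V_def)
  obtain B where B: "\<And>u. generic V u \<Longrightarrow> norm (ordered_term t X u ks (pre @ post)) \<le> B"
    using ordered_term_bounded[of "pre @ post" ks] assms(1) by (auto simp: V_def)
  show int: "integrable (torus W) F"
  proof (rule integrable_torus_bounded)
    have "AE z in torus W. generic W (scaled z)" by (intro AE_generic) (simp add: W_def)
    then show "AE z in torus W. norm (F z) \<le> norm (1 / (1 - t)) * (2 / (r - norm t)) ^ card (set post) * B"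
    proof eventually_elim
      case (elim z)
      have "generic (insert a (set post)) (scaled z)" "generic V (scaled z)"
        using generic_subset[OF elim] W aV by blast+
      then show ?case
        unfolding F_def norm_mult using B aV tail_factor_bounded by (intro mult_mono') auto
    qed
    show "F \<in> borel_measurable (torus W)"
      unfolding F_def tail_factor_def
      by (intro borel_measurable_times borel_measurable_const borel_measurable_power borel_measurable_prod
        borel_measurable_divide borel_measurable_diff borel_measurable_ordered_term measurable_scaled) (auto simp: W_def)
  qed
  have "(LINT z|torus W. F z) = (LINT z|torus V. (if m = 0 then t ^ length post / (1 - t) else 0) *
      ordered_term t X (scaled z) ks (pre @ post))"
    unfolding W
  proof (rule torus_integral_insert_AE)
    have "AE z in torus V. generic V (scaled z)" using aV by (intro AE_generic)
    then show "AE z in torus V. (LINT x|circle_measure. F (z(a := x))) =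
        (if m = 0 then t ^ length post / (1 - t) else 0) * ordered_term t X (scaled z) ks (pre @ post)"
    proof eventually_elim
      case (elim z)
      have "F (z(a := x)) = 1 / (1 - t) * tail_factor m a (set post) ((scaled z)(a := of_real r * x)) *
          ordered_term t X (scaled z) ks (pre @ post)" for x
      proof -
        have "ordered_term t X ((scaled z)(a := of_real r * x)) ks (pre @ post) =
            ordered_term t X (scaled z) ks (pre @ post)"
          using aV(1) by (intro ordered_term_cong) (auto simp: V_def)
        then show ?thesis using assms(2) by (simp add: F_def scaled_update)
      qed
      then show ?case
        using tail_integral[OF _ aV(4) generic_subset[OF elim aV(3)] assms(2), of m] assms(1)
        by (simp add: distinct_card)
    qed
    show "integrable (torus (insert a V)) F" using int unfolding W .
    show "(\<lambda>z. (if m = 0 then t ^ length post / (1 - t) else 0) * ordered_term t X (scaled z) ks (pre @ post))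
        \<in> borel_measurable (torus V)"
      by (intro borel_measurable_times borel_measurable_const borel_measurable_ordered_term measurable_scaled)
        (simp add: V_def)
  qed (fact aV)+
  then show "(LINT z|torus W. F z) =
      (if m = 0 then t ^ length post / (1 - t) * term_integral ks (pre @ post) else 0)"
    by (auto simp: term_integral_def V_def)
qed

text \<open>The summand for \<open>p\<close> is the residue at the inner variable \<open>vs ! p\<close>. The hypothesis on the exponents makes
  the total exponent of this variable nonnegative, so that the integral over it is an evaluation at the
  origin.\<close>

lemma term_integral_outer_first:
  assumes "distinct (b # vs)" "b \<notin> X" "card (set vs \<inter> X) = Suc (card (set vs - X))"
    and "length ks = length vs" and nonneg: "\<And>k'. k' \<in> set ks \<Longrightarrow> 0 \<le> int k + k'"
  shows "term_integral (int k # ks) (b # vs) =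
    (\<Sum>p | p < length vs \<and> vs ! p \<in> X. if int k + ks ! p = 0
       then t ^ (length vs - Suc p) / (1 - t) * term_integral (delete_nth p ks) (delete_nth p vs) else 0)"
proof -
  define W where "W = set vs"
  define P where "P = {p. p < length vs \<and> vs ! p \<in> X}"
  define F where "F p z = 1 / (1 - t) * tail_factor (nat (int k + ks ! p)) (vs ! p) (set (drop (Suc p) vs)) (scaled z) *
    ordered_term t X (scaled z) (delete_nth p ks) (delete_nth p vs)" for p z
  have vs: "vs = take p vs @ vs ! p # drop (Suc p) vs" if "p \<in> P" for p
    using that by (auto simp: P_def id_take_nth_drop)
  have ks: "ks = take p ks @ ks ! p # drop (Suc p) ks" if "p \<in> P" for p
    using that assms(4) by (auto simp: P_def id_take_nth_drop)
  have F: "integrable (torus W) (F p)"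
    "(LINT z|torus W. F p z) = (if int k + ks ! p = 0
       then t ^ (length vs - Suc p) / (1 - t) * term_integral (delete_nth p ks) (delete_nth p vs) else 0)"
    if "p \<in> P" for p
  proof -
    have d: "distinct (take p vs @ vs ! p # drop (Suc p) vs)" "vs ! p \<in> X"
      using assms(1) vs[OF that] that by (auto simp: P_def)
    have "nat (int k + ks ! p) = 0 \<longleftrightarrow> int k + ks ! p = 0"
      using nonneg[of "ks ! p"] that assms(4) by (auto simp: P_def)
    then show "integrable (torus W) (F p)"
      "(LINT z|torus W. F p z) = (if int k + ks ! p = 0
       then t ^ (length vs - Suc p) / (1 - t) * term_integral (delete_nth p ks) (delete_nth p vs) else 0)"
      using term_integral_residue[OF d, of "nat (int k + ks ! p)" "delete_nth p ks"]
      unfolding F_def[abs_def] W_def vs[OF that, symmetric] by (simp_all add: delete_nth_def)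
  qed
  have bij: "bij_betw ((!) vs) P (W \<inter> X)"
    using assms(1) by (force simp: bij_betw_def inj_on_def P_def W_def in_set_conv_nth nth_eq_iff_index_eq)
  have "term_integral (int k # ks) (b # vs) = (LINT z|torus (set vs). (\<Sum>p\<in>P. F p z))"
  proof (rule term_integral_Cons[OF assms(1)])
    have "AE z in torus (set vs). generic (set vs) (scaled z)" by (intro AE_generic) simp
    then show "AE z in torus (set vs). (LINT x|circle_measure. head_factor k b (set vs)
       ((scaled z)(b := (if b \<in> X then of_real r else 1) * x))) * ordered_term t X (scaled z) ks vs = (\<Sum>p\<in>P. F p z)"
    proof eventually_elim
      case (elim z)
      define u where "u = scaled z"
      have "(LINT x|circle_measure. head_factor k b (set vs) (u(b := x))) =
          (\<Sum>a\<in>W \<inter> X. peeled k (W - X) (W \<inter> X) u (u a) / (\<Prod>w\<in>W \<inter> X - {a}. u a - u w))"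
        unfolding W_def using assms elim by (intro head_integral_outer) (auto simp: u_def)
      also have "\<dots> = (\<Sum>p\<in>P. peeled k (W - X) (W \<inter> X) u (u (vs ! p)) / (\<Prod>w\<in>W \<inter> X - {vs ! p}. u (vs ! p) - u w))"
        by (rule sum.reindex_bij_betw[OF bij, symmetric])
      finally have "(LINT x|circle_measure. head_factor k b (set vs) (u(b := x))) * ordered_term t X u ks vs =
          (\<Sum>p\<in>P. peeled k (W - X) (W \<inter> X) u (u (vs ! p)) / (\<Prod>w\<in>W \<inter> X - {vs ! p}. u (vs ! p) - u w) *
            ordered_term t X u ks vs)"
        by (simp add: sum_distrib_right)
      also have "\<dots> = (\<Sum>p\<in>P. F p z)"
      proof (rule sum.cong[OF refl])
        fix p assume p: "p \<in> P"
        define a pre post where "a = vs ! p" and "pre = take p vs" and "post = drop (Suc p) vs"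
        have vs': "vs = pre @ a # post" using vs[OF p] by (simp add: a_def pre_def post_def)
        have aX: "a \<in> X" using p by (simp add: a_def P_def)
        have a: "a \<notin> set (pre @ post)" "distinct (pre @ post)" using assms(1) vs' by auto
        have WX: "W \<inter> X = insert a (set (pre @ post) \<inter> X)" "W - X = set (pre @ post) - X"
          "W \<inter> X - {a} = set (pre @ post) \<inter> X"
          using a aX by (auto simp: W_def vs')
        have card: "card (set (pre @ post) \<inter> X) = card (set (pre @ post) - X)"
          using assms(3) a(1) unfolding W_def[symmetric] WX by simp
        have gen: "generic (insert a (set (pre @ post))) u"
          unfolding u_def by (rule generic_subset[OF elim]) (auto simp: vs')
        have "ordered_term t X u ks vs = ordered_term t X u (delete_nth p ks) (pre @ post) *
          (u a powi (ks ! p) * (\<Prod>w\<in>set pre. pair_factor t X u w a) * (\<Prod>w\<in>set post. pair_factor t X u a w))"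
          using ordered_term_insert[of "take p ks" pre a post t X u "ks ! p" "drop (Suc p) ks"]
            assms(1,4) p unfolding ks[OF p, symmetric] vs'[symmetric]
          by (simp add: delete_nth_def pre_def P_def)
        then have "peeled k (W - X) (W \<inter> X) u (u a) / (\<Prod>w\<in>W \<inter> X - {a}. u a - u w) * ordered_term t X u ks vs
          = peeled k (set (pre @ post) - X) (insert a (set (pre @ post) \<inter> X)) u (u a)
      / (\<Prod>w\<in>set (pre @ post) \<inter> X. u a - u w) *
      (u a powi (ks ! p) * (\<Prod>w\<in>set pre. pair_factor t X u w a) * (\<Prod>w\<in>set post. pair_factor t X u a w)) *
            ordered_term t X u (delete_nth p ks) (pre @ post)"
          unfolding WX(3) unfolding WX(1,2) by (simp only: mult_ac)
        also have "\<dots> = 1 / (1 - t) * u a powi (int k + ks ! p) * (\<Prod>w\<in>set post. (t * u w - u a) / (u w - t * u a)) *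
            ordered_term t X u (delete_nth p ks) (pre @ post)"
          by (subst residue_factor[OF a(1) aX gen a(2) card]) simp
        also have "u a powi (int k + ks ! p) = u a ^ nat (int k + ks ! p)"
          using nonneg[of "ks ! p"] p assms(4) by (auto simp: P_def power_int_def)
        finally show "peeled k (W - X) (W \<inter> X) u (u (vs ! p)) / (\<Prod>w\<in>W \<inter> X - {vs ! p}. u (vs ! p) - u w) *
            ordered_term t X u ks vs = F p z"
          by (simp add: F_def tail_factor_def u_def a_def pre_def post_def delete_nth_def)
      qed
      finally show ?case using assms(2) by (simp add: u_def)
    qed
    show "(\<lambda>z. \<Sum>p\<in>P. F p z) \<in> borel_measurable (torus (set vs))"
      using F(1) unfolding W_def by (intro borel_measurable_sum) auto
  qed
  also have "\<dots> = (\<Sum>p\<in>P. LINT z|torus W. F p z)"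
    unfolding W_def[symmetric] by (intro Bochner_Integration.integral_sum F(1))
  also have "\<dots> = (\<Sum>p\<in>P. if int k + ks ! p = 0
       then t ^ (length vs - Suc p) / (1 - t) * term_integral (delete_nth p ks) (delete_nth p vs) else 0)"
    by (intro sum.cong refl F(2))
  finally show ?thesis by (simp add: P_def)
qed

end

section \<open>The recursion for the sum over all orderings\<close>

lemma sum_permutations_of_set_Cons:
  assumes "finite V" "V \<noteq> {}"
  shows "(\<Sum>vs\<in>permutations_of_set V. f vs) = (\<Sum>v\<in>V. \<Sum>vs\<in>permutations_of_set (V - {v}). f (v # vs))"
proof -
  have "(\<Sum>vs\<in>permutations_of_set V. f vs) =
      (\<Sum>v\<in>V. \<Sum>vs\<in>(#) v ` permutations_of_set (V - {v}). f vs)"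
    unfolding permutations_of_set_nonempty[OF assms(2)]
    by (rule sum.UNION_disjoint) (use assms in auto)
  also have "\<dots> = (\<Sum>v\<in>V. \<Sum>vs\<in>permutations_of_set (V - {v}). f (v # vs))"
    by (simp add: sum.reindex)
  finally show ?thesis .
qed

text \<open>An ordering with a given entry \<open>a\<close> at position \<open>p\<close> is recovered from what is left after its deletion.\<close>

lemma sum_permutations_of_set_delete_nth:
  fixes g :: "'a list \<Rightarrow> 'b::comm_monoid_add"
  assumes "finite W" "p < card W"
  shows "(\<Sum>vs | vs \<in> permutations_of_set W \<and> vs ! p \<in> X. g (delete_nth p vs)) =
    (\<Sum>a\<in>W \<inter> X. \<Sum>vs\<in>permutations_of_set (W - {a}). g vs)"
proof -
  have len: "length vs = card W" if "vs \<in> permutations_of_set W" for vs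
    using length_finite_permutations_of_set[OF that] .
  have "(\<Sum>a\<in>W \<inter> X. \<Sum>vs\<in>permutations_of_set (W - {a}). g vs) =
      (\<Sum>(a, vs)\<in>(SIGMA a:W \<inter> X. permutations_of_set (W - {a})). g vs)"
    by (rule sum.Sigma) (use assms in auto)
  also have "\<dots> = (\<Sum>vs | vs \<in> permutations_of_set W \<and> vs ! p \<in> X. g (delete_nth p vs))"
  proof (rule sum.reindex_bij_witness[where i = "\<lambda>vs. (vs ! p, delete_nth p vs)" and
        j = "\<lambda>(a, vs). take p vs @ a # drop p vs"])
    fix avs assume avs: "avs \<in> (SIGMA a:W \<inter> X. permutations_of_set (W - {a}))"
    obtain a vs where eq: "avs = (a, vs)" by (cases avs)
    have a: "a \<in> W" "a \<in> X" and vs: "vs \<in> permutations_of_set (W - {a})" using avs eq by auto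
    have l: "length vs = card W - 1"
      using length_finite_permutations_of_set[OF vs] a assms(1) by simp
    have d: "set (take p vs) \<union> set (drop p vs) = W - {a}" "distinct (take p vs @ drop p vs)"
      using permutations_of_setD[OF vs] by (simp_all only: set_append[symmetric] append_take_drop_id)
    have p: "p \<le> length vs" using l assms(2) by simp
    show "(\<lambda>vs. (vs ! p, delete_nth p vs)) ((\<lambda>(a, vs). take p vs @ a # drop p vs) avs) = avs"
      using p by (simp add: eq nth_append delete_nth_def)
    show "(case avs of (a, vs) \<Rightarrow> take p vs @ a # drop p vs) \<in> {vs \<in> permutations_of_set W. vs ! p \<in> X}"
    proof -
      have "set (take p vs @ a # drop p vs) = insert a (set (take p vs) \<union> set (drop p vs))" by simp
      also have "\<dots> = W" unfolding d(1) using a by blast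
      finally have s: "set (take p vs @ a # drop p vs) = W" .
      have "a \<notin> set (take p vs) \<union> set (drop p vs)" unfolding d(1) by simp
      then have "distinct (take p vs @ a # drop p vs)"
        using permutations_of_setD(2)[OF vs] set_take_disj_set_drop_if_distinct[of vs p p] by auto
      moreover have "(take p vs @ a # drop p vs) ! p \<in> X" using p a by (simp add: nth_append)
      ultimately show ?thesis using s by (simp only: eq prod.case mem_Collect_eq permutations_of_setI)
    qed
    show "g (delete_nth p (case avs of (a, vs) \<Rightarrow> take p vs @ a # drop p vs)) = (case avs of (a, vs) \<Rightarrow> g vs)"
      using p by (simp add: eq delete_nth_def)
  next
    fix vs assume vs: "vs \<in> {vs \<in> permutations_of_set W. vs ! p \<in> X}"
    then have l: "p < length vs" using len assms(2) by auto
    have e: "vs = take p vs @ vs ! p # drop (Suc p) vs" using l by (rule id_take_nth_drop)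
    have "distinct vs" "set vs = W" using vs permutations_of_setD by auto
    then have d: "distinct (take p vs @ vs ! p # drop (Suc p) vs)" "set (take p vs @ vs ! p # drop (Suc p) vs) = W"
      using e by auto
    show "(case (vs ! p, delete_nth p vs) of (a, vs) \<Rightarrow> take p vs @ a # drop p vs) = vs"
      using l e by (simp add: delete_nth_def)
    show "(vs ! p, delete_nth p vs) \<in> (SIGMA a:W \<inter> X. permutations_of_set (W - {a}))"
    proof -
      have "set (delete_nth p vs) = W - {vs ! p}" using d by (auto simp: delete_nth_def)
      moreover have "distinct (delete_nth p vs)" using d by (simp add: delete_nth_def)
      moreover have "vs ! p \<in> W \<inter> X" using vs d(2) by auto
      ultimately show ?thesis by (simp add: permutations_of_setI)
    qed
  qed
  finally show ?thesis by simp
qed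

lemma t_int_conv_sum: "t \<noteq> 1 \<Longrightarrow> t_int t n = (\<Sum>i<n. t ^ i)"
  unfolding t_int_def by (subst sum_gp_strict) simp

lemma is_partition_Cons: "is_partition (m # \<mu>) \<longleftrightarrow> is_partition \<mu> \<and> 0 < m \<and> (\<forall>k\<in>set \<mu>. k \<le> m)"
  by (auto simp: is_partition_def)

lemma sorted_eq_replicate_append:
  assumes "sorted_wrt (\<ge>) \<nu>" "\<forall>k\<in>set \<nu>. k \<le> (m :: nat)"
  shows "\<exists>\<nu>'. \<nu> = replicate (count_list \<nu> m) m @ \<nu>' \<and> (\<forall>k\<in>set \<nu>'. k < m)"
  using assms
proof (induction \<nu>)
  case (Cons a \<nu>)
  show ?case
  proof (cases "a = m")
    case True
    then show ?thesis using Cons by auto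
  next
    case False
    then have "a < m" using Cons.prems by auto
    then have "\<forall>k\<in>set (a # \<nu>). k < m" using Cons.prems by auto
    moreover from this have "count_list (a # \<nu>) m = 0" by (auto simp: count_list_0_iff)
    ultimately show ?thesis by (intro exI[of _ "a # \<nu>"]) simp
  qed
qed simp

text \<open>The form required by \<open>total_integral_peel\<close>: \<open>A\<close> contains the exponents greater than \<open>-m\<close> after the
  first one. Dropping the first exponent \<open>m\<close> and one exponent \<open>-m\<close> removes the leading parts of both
  partitions.\<close>

lemma weight_of_Cons:
  assumes "is_partition (m # \<mu>)" "is_partition \<nu>" "\<forall>k\<in>set \<nu>. k \<le> m"
  obtains A where "\<And>k. k \<in> set A \<Longrightarrow> - int m < k"
    and "weight_of N (m # \<mu>) \<nu> = int m # A @ replicate (count_list \<nu> m) (- int m)"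
    and "\<And>\<nu>\<^sub>1. \<nu> = m # \<nu>\<^sub>1 \<Longrightarrow> A @ replicate (count_list \<nu> m - 1) (- int m) = weight_of (N - 2) \<mu> \<nu>\<^sub>1"
proof -
  define c where "c = count_list \<nu> m"
  obtain \<nu>' where \<nu>': "\<nu> = replicate c m @ \<nu>'" "\<forall>k\<in>set \<nu>'. k < m"
    using sorted_eq_replicate_append[of \<nu> m] assms by (auto simp: is_partition_def c_def)
  define A where "A = map int \<mu> @ replicate (N - (Suc (length \<mu>) + (c + length \<nu>'))) 0 @
      rev (map (\<lambda>k. - int k) \<nu>')"
  have "weight_of N (m # \<mu>) \<nu> = int m # A @ replicate c (- int m)"
    unfolding weight_of_def \<nu>'(1) by (simp add: A_def)
  moreover have "- int m < k" if "k \<in> set A" for k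
    using that assms(1) \<nu>'(2) by (auto simp: is_partition_Cons A_def)
  moreover have "A @ replicate (c - 1) (- int m) = weight_of (N - 2) \<mu> \<nu>\<^sub>1" if "\<nu> = m # \<nu>\<^sub>1" for \<nu>\<^sub>1
  proof -
    have "0 < c" using that by (simp add: c_def)
    then obtain d where d: "c = Suc d" by (cases c) auto
    then have "\<nu>\<^sub>1 = replicate d m @ \<nu>'" using \<nu>'(1) that by simp
    then show ?thesis by (simp add: weight_of_def A_def d)
  qed
  ultimately show ?thesis using that unfolding c_def by blast
qed

lemma length_weight_of: "length \<mu> + length \<nu> \<le> N \<Longrightarrow> length (weight_of N \<mu> \<nu>) = N"
  by (simp add: weight_of_def)

lemma t_mult_Cons: "t_mult s (x # xs) = t_int s (Suc (count_list xs x)) * t_mult s xs"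
proof -
  have f: "t_fact s (Suc k) = t_int s (Suc k) * t_fact s k" for k
    by (simp add: t_fact_def mult.commute)
  have *: "t_mult s ys = t_fact s (count_list ys x) * (\<Prod>i\<in>set ys - {x}. t_fact s (count_list ys i))" for ys
    by (cases "x \<in> set ys") (simp_all add: t_mult_def prod.remove t_fact_def count_list_0_iff[THEN iffD2])
  have "(\<Prod>i\<in>set (x # xs) - {x}. t_fact s (count_list (x # xs) i)) =
      (\<Prod>i\<in>set xs - {x}. t_fact s (count_list xs i))"
    by (rule prod.cong) auto
  then show ?thesis
    using *[of "x # xs"] *[of xs] by (simp add: f)
qed

text \<open>The value of the summed integrals for the zero weight: the step from \<open>i + 1\<close> to \<open>i\<close> variables of each kind
  contributes \<open>(i + 1)\<^sup>2 [2i + 1] / (1 - t)\<close>.\<close>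

definition zero_weight_value :: "complex \<Rightarrow> nat \<Rightarrow> complex" where
  "zero_weight_value t n = (fact n)\<^sup>2 * (\<Prod>i<n. t_int t (2 * i + 1) / (1 - t))"

context two_radii
begin

lemma t_neq_1: "t \<noteq> 1"
  using t_less_1 by auto

definition total_integral :: "int list \<Rightarrow> nat set \<Rightarrow> complex" where
  "total_integral ks V = (\<Sum>vs\<in>permutations_of_set V. term_integral ks vs)"

definition balanced :: "nat \<Rightarrow> nat set \<Rightarrow> bool" where
  "balanced n V \<longleftrightarrow> finite V \<and> card (V \<inter> X) = n \<and> card (V - X) = n"

lemma balanced_card: "balanced n V \<Longrightarrow> card V = 2 * n"
  using card_Un_disjoint[of "V \<inter> X" "V - X"] by (simp add: balanced_def Int_Diff_Un Int_Diff_disjoint)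

lemma balanced_remove:
  assumes "balanced (Suc n) V" "b \<in> V - X" "a \<in> V \<inter> X"
  shows "balanced n (V - {b} - {a})"
proof -
  have "(V - {b} - {a}) \<inter> X = V \<inter> X - {a}" "V - {b} - {a} - X = V - X - {b}" using assms by auto
  then show ?thesis using assms by (simp add: balanced_def)
qed

text \<open>All orderings of \<open>V\<close> in which \<open>b\<close> is first and \<open>a\<close> stands at position \<open>p\<close> of the rest contribute the same
  multiple of the integrals over the orderings of \<open>V - {b} - {a}\<close>.\<close>

lemma total_integral_step:
  assumes V: "balanced (Suc n) V" and len: "length ks = 2 * n + 1"
    and nonneg: "\<And>k'. k' \<in> set ks \<Longrightarrow> 0 \<le> int k + k'"
  shows "total_integral (int k # ks) V = (\<Sum>b\<in>V - X. \<Sum>a\<in>V \<inter> X. \<Sum>p<length ks.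
    if int k + ks ! p = 0 then t ^ (length ks - Suc p) / (1 - t) *
      total_integral (delete_nth p ks) (V - {b} - {a}) else 0)"
proof -
  have fin: "finite V" and ne: "V \<noteq> {}" using V by (auto simp: balanced_def)
  define c where "c p = (if int k + ks ! p = 0 then t ^ (length ks - Suc p) / (1 - t) else 0)" for p
  have "total_integral (int k # ks) V =
      (\<Sum>v\<in>V. \<Sum>vs\<in>permutations_of_set (V - {v}). term_integral (int k # ks) (v # vs))"
    unfolding total_integral_def by (rule sum_permutations_of_set_Cons[OF fin ne])
  also have "\<dots> = (\<Sum>v\<in>V - X. \<Sum>vs\<in>permutations_of_set (V - {v}). term_integral (int k # ks) (v # vs))"
  proof (rule sum.mono_neutral_right)
    \<comment> \<open>Orderings that start with an inner variable contribute nothing.\<close>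
    show "\<forall>v\<in>V - (V - X). (\<Sum>vs\<in>permutations_of_set (V - {v}). term_integral (int k # ks) (v # vs)) = 0"
    proof (intro ballI sum.neutral)
      fix v vs assume v: "v \<in> V - (V - X)" and vs: "vs \<in> permutations_of_set (V - {v})"
      have s: "set vs = V - {v}" "distinct vs" using permutations_of_setD[OF vs] by auto
      have "V - {v} - X = V - X" "(V - {v}) \<inter> X = V \<inter> X - {v}" using v by auto
      then have "card (set vs - X) = Suc (card (set vs \<inter> X))"
        using V v unfolding s by (simp add: balanced_def)
      then show "term_integral (int k # ks) (v # vs) = 0"
        using v s by (intro term_integral_inner_first) auto
    qed
  qed (use fin in auto)
  also have "\<dots> = (\<Sum>b\<in>V - X. \<Sum>a\<in>V \<inter> X. \<Sum>p<length ks. c p * total_integral (delete_nth p ks) (V - {b} - {a}))"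
  proof (rule sum.cong[OF refl])
    fix b assume b: "b \<in> V - X"
    define W where "W = V - {b}"
    have W: "finite W" "W \<inter> X = V \<inter> X" "W - X = V - X - {b}" using fin b by (auto simp: W_def)
    have cW: "card W = length ks" using balanced_card[OF V] b fin len by (simp add: W_def)
    have "(\<Sum>vs\<in>permutations_of_set W. term_integral (int k # ks) (b # vs)) =
      (\<Sum>vs\<in>permutations_of_set W. \<Sum>p<length ks.
        (if vs ! p \<in> X then c p * term_integral (delete_nth p ks) (delete_nth p vs) else 0))"
    proof (rule sum.cong[OF refl])
      fix vs assume vs: "vs \<in> permutations_of_set W"
      have s: "set vs = W" "distinct vs" using permutations_of_setD[OF vs] by auto
      have l: "length vs = length ks" using s cW distinct_card by force
      have "card (set vs \<inter> X) = Suc (card (set vs - X))"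
        using V b unfolding s W(2,3) by (simp add: balanced_def)
      then have "term_integral (int k # ks) (b # vs) = (\<Sum>p | p < length vs \<and> vs ! p \<in> X. if int k + ks ! p = 0
       then t ^ (length vs - Suc p) / (1 - t) * term_integral (delete_nth p ks) (delete_nth p vs) else 0)"
        using b s l nonneg by (intro term_integral_outer_first) (auto simp: W_def)
      also have "\<dots> = (\<Sum>p\<in>{p \<in> {..<length ks}. vs ! p \<in> X}. c p * term_integral (delete_nth p ks) (delete_nth p vs))"
        unfolding l by (intro sum.cong) (auto simp: c_def)
      also have "\<dots> = (\<Sum>p<length ks. if vs ! p \<in> X then c p * term_integral (delete_nth p ks) (delete_nth p vs) else 0)"
        by (simp only: sum.inter_filter finite_lessThan)
      finally show "term_integral (int k # ks) (b # vs) = \<dots>" .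
    qed
    also have "\<dots> = (\<Sum>p<length ks. \<Sum>vs | vs \<in> permutations_of_set W \<and> vs ! p \<in> X.
        c p * term_integral (delete_nth p ks) (delete_nth p vs))"
      by (subst sum.swap) (simp only: sum.inter_filter[symmetric] finite_permutations_of_set)
    also have "\<dots> = (\<Sum>p<length ks. \<Sum>a\<in>W \<inter> X. \<Sum>vs\<in>permutations_of_set (W - {a}). c p * term_integral (delete_nth p ks) vs)"
      using W(1) cW by (intro sum.cong refl sum_permutations_of_set_delete_nth) auto
    also have "\<dots> = (\<Sum>a\<in>V \<inter> X. \<Sum>p<length ks. c p * total_integral (delete_nth p ks) (W - {a}))"
      by (subst sum.swap) (simp add: W(2) total_integral_def sum_distrib_left)
    finally show "(\<Sum>vs\<in>permutations_of_set (V - {b}). term_integral (int k # ks) (b # vs)) =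
        (\<Sum>a\<in>V \<inter> X. \<Sum>p<length ks. c p * total_integral (delete_nth p ks) (V - {b} - {a}))"
      by (simp add: W_def)
  qed
  finally show ?thesis
    unfolding c_def by (simp add: if_distrib[of "\<lambda>x. x * _"] cong: if_cong)
qed

text \<open>Only the final block of exponents \<open>-k\<close> can cancel the leading \<open>k\<close>. Deleting any entry of the block gives the
  same list, and the number of variables after it runs through \<open>0, \<dots>, c - 1\<close>.\<close>

lemma total_integral_peel:
  assumes V: "balanced (Suc n) V" and len: "length A + c = 2 * n + 1"
    and A: "\<And>k'. k' \<in> set A \<Longrightarrow> - int k < k'"
  shows "total_integral (int k # A @ replicate c (- int k)) V =
    (\<Sum>b\<in>V - X. \<Sum>a\<in>V \<inter> X. t_int t c / (1 - t) *
      total_integral (A @ replicate (c - 1) (- int k)) (V - {b} - {a}))"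
proof -
  define ks where "ks = A @ replicate c (- int k)"
  have l: "length ks = 2 * n + 1" using len by (simp add: ks_def)
  have "(\<Sum>p<length ks. if int k + ks ! p = 0 then t ^ (length ks - Suc p) / (1 - t) *
      total_integral (delete_nth p ks) U else 0) =
    t_int t c / (1 - t) * total_integral (A @ replicate (c - 1) (- int k)) U" for U
  proof -
    have "(\<Sum>p<length ks. if int k + ks ! p = 0 then t ^ (length ks - Suc p) / (1 - t) *
      total_integral (delete_nth p ks) U else 0) =
      (\<Sum>p\<in>{length A..<length A + c}. if int k + ks ! p = 0 then t ^ (length ks - Suc p) / (1 - t) *
      total_integral (delete_nth p ks) U else 0)"
    proof (rule sum.mono_neutral_right)
      show "\<forall>i\<in>{..<length ks} - {length A..<length A + c}. (if int k + ks ! i = 0 then t ^ (length ks - Suc i) / (1 - t) *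
        total_integral (delete_nth i ks) U else 0) = 0"
      proof
        fix i assume "i \<in> {..<length ks} - {length A..<length A + c}"
        then have "i < length A" by (auto simp: ks_def)
        then have "ks ! i \<in> set A" by (simp add: ks_def nth_append)
        from A[OF this] show "(if int k + ks ! i = 0 then t ^ (length ks - Suc i) / (1 - t) *
        total_integral (delete_nth i ks) U else 0) = 0" by simp
      qed
    qed (auto simp: ks_def)
    also have "\<dots> = (\<Sum>i<c. t ^ (c - Suc i) / (1 - t) * total_integral (A @ replicate (c - 1) (- int k)) U)"
    proof (rule sum.reindex_bij_witness[where i = "\<lambda>i. length A + i" and j = "\<lambda>p. p - length A"])
      fix p assume p: "p \<in> {length A..<length A + c}"
      then obtain i where i: "p = length A + i" "i < c" by (metis add_less_cancel_left atLeastLessThan_iff le_Suc_ex)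
      have "replicate i x @ replicate (c - Suc i) x = replicate (c - 1) x" for x :: int
        using i by (simp flip: replicate_add)
      then have "delete_nth p ks = A @ replicate (c - 1) (- int k)"
        using i by (simp add: delete_nth_def ks_def)
      moreover have "ks ! p = - int k" using i by (simp add: ks_def nth_append)
      moreover have "length ks - Suc p = c - Suc i" using i by (simp add: ks_def)
      ultimately show "t ^ (c - Suc (p - length A)) / (1 - t) * total_integral (A @ replicate (c - 1) (- int k)) U =
        (if int k + ks ! p = 0 then t ^ (length ks - Suc p) / (1 - t) * total_integral (delete_nth p ks) U else 0)"
        using i by simp
    qed auto
    also have "\<dots> = (\<Sum>i<c. t ^ (c - Suc i)) / (1 - t) * total_integral (A @ replicate (c - 1) (- int k)) U"
      by (simp add: sum_distrib_right sum_divide_distrib)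
    also have "(\<Sum>i<c. t ^ (c - Suc i)) = t_int t c"
      by (subst sum.nat_diff_reindex) (simp add: t_int_conv_sum[OF t_neq_1])
    finally show ?thesis .
  qed
  then show ?thesis
    unfolding ks_def[symmetric]
    by (subst total_integral_step[OF V l]) (use A in \<open>force simp: ks_def\<close>)+
qed

lemma total_integral_peel_const:
  assumes V: "balanced (Suc n) V" and len: "length A + c = 2 * n + 1"
    and A: "\<And>k'. k' \<in> set A \<Longrightarrow> - int k < k'"
    and rest: "\<And>U. balanced n U \<Longrightarrow> total_integral (A @ replicate (c - 1) (- int k)) U = T"
  shows "total_integral (int k # A @ replicate c (- int k)) V = of_nat (Suc n) ^ 2 * t_int t c / (1 - t) * T"
proof -
  have "total_integral (int k # A @ replicate c (- int k)) V =
      (\<Sum>b\<in>V - X. \<Sum>a\<in>V \<inter> X. t_int t c / (1 - t) * T)"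
    by (subst total_integral_peel[OF V len A], assumption, intro sum.cong refl)
      (use rest balanced_remove[OF V] in auto)
  then show ?thesis using V by (simp add: balanced_def power2_eq_square)
qed

lemma total_integral_zero_weight:
  "balanced n V \<Longrightarrow> total_integral (replicate (2 * n) 0) V = zero_weight_value t n"
proof (induction n arbitrary: V)
  case 0
  then have "V \<inter> X = {}" "V - X = {}" by (auto simp: balanced_def)
  then have "V = {}" by blast
  moreover have "prob_space (torus {})" by (rule prob_space_torus)
  ultimately show ?case
    by (simp add: total_integral_def term_integral_def zero_weight_value_def prob_space.prob_space)
next
  case (Suc n)
  have "total_integral (int 0 # [] @ replicate (2 * n + 1) (- int 0)) V =
      of_nat (Suc n) ^ 2 * t_int t (2 * n + 1) / (1 - t) * zero_weight_value t n"
    by (rule total_integral_peel_const[OF Suc.prems]) (use Suc.IH in auto)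
  then show ?case
    by (simp add: zero_weight_value_def power_mult_distrib mult_ac)
qed

text \<open>Here \<open>\<mu>\<close> is lexicographically larger than \<open>\<nu>\<close>. Common leading parts are peeled off; at the first
  difference the leading part of \<open>\<mu>\<close> exceeds all parts of \<open>\<nu>\<close>, so no exponent cancels it.\<close>

lemma total_integral_unequal:
  assumes "is_partition \<mu>" "is_partition \<nu>" "length \<mu> + length \<nu> \<le> 2 * n" "balanced n V"
    and "(\<nu>, \<mu>) \<in> lexord less_than"
  shows "total_integral (weight_of (2 * n) \<mu> \<nu>) V = 0"
  using assms
proof (induction \<mu> arbitrary: \<nu> n V)
  case Nil
  then show ?case by simp
next
  case (Cons m \<mu>)
  obtain n' where n: "n = Suc n'" using Cons.prems(3) by (cases n) auto
  have le: "\<forall>k\<in>set \<nu>. k \<le> m"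
    using Cons.prems(2,5) by (cases \<nu>) (auto simp: is_partition_Cons less_imp_le)
  obtain A where A: "\<And>k. k \<in> set A \<Longrightarrow> - int m < k"
    "weight_of (2 * n) (m # \<mu>) \<nu> = int m # A @ replicate (count_list \<nu> m) (- int m)"
    "\<And>\<nu>\<^sub>1. \<nu> = m # \<nu>\<^sub>1 \<Longrightarrow> A @ replicate (count_list \<nu> m - 1) (- int m) = weight_of (2 * n - 2) \<mu> \<nu>\<^sub>1"
    using weight_of_Cons[OF Cons.prems(1,2) le] by metis
  have len: "length A + count_list \<nu> m = 2 * n' + 1"
    using arg_cong[OF A(2), of length] length_weight_of[OF Cons.prems(3)] by (simp add: n)
  have V: "balanced (Suc n') V" using Cons.prems(4) n by simp
  have step: "total_integral (weight_of (2 * n) (m # \<mu>) \<nu>) V = (\<Sum>b\<in>V - X. \<Sum>a\<in>V \<inter> X. t_int t (count_list \<nu> m) / (1 - t) *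
      total_integral (A @ replicate (count_list \<nu> m - 1) (- int m)) (V - {b} - {a}))"
    unfolding A(2) by (rule total_integral_peel[OF V len A(1)])
  show ?case
  proof (cases "\<exists>\<nu>\<^sub>1. \<nu> = m # \<nu>\<^sub>1")
    case True
    then obtain \<nu>\<^sub>1 where \<nu>: "\<nu> = m # \<nu>\<^sub>1" by blast
    have "total_integral (A @ replicate (count_list \<nu> m - 1) (- int m)) U = 0" if "balanced n' U" for U
    proof -
      have "total_integral (weight_of (2 * n') \<mu> \<nu>\<^sub>1) U = 0"
        using Cons.prems that by (intro Cons.IH) (auto simp: \<nu> n is_partition_Cons)
      then show ?thesis unfolding A(3)[OF \<nu>] by (simp add: n)
    qed
    then show ?thesis unfolding step using balanced_remove[OF V] by (intro sum.neutral ballI) simp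
  next
    case False
    have "m \<notin> set \<nu>"
      using False Cons.prems(2,5) by (cases \<nu>) (auto simp: is_partition_Cons)
    then have "count_list \<nu> m = 0" by (simp add: count_list_0_iff)
    then show ?thesis unfolding step by (simp add: t_int_def)
  qed
qed

text \<open>Every peeled part contributes \<open>k\<^sup>2 [c] / (1 - t)\<close>, where \<open>k\<close> is the current number of variables of
  each kind and \<open>c\<close> the multiplicity of the part among the remaining ones. After all parts are gone the zero
  weight is left.\<close>

lemma total_integral_equal:
  assumes "is_partition \<mu>" "length \<mu> \<le> n" "balanced n V"
  shows "total_integral (weight_of (2 * n) \<mu> \<mu>) V =
    (fact n / fact (n - length \<mu>))\<^sup>2 * (t_mult t \<mu> / (1 - t) ^ length \<mu>) * zero_weight_value t (n - length \<mu>)"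
  using assms
proof (induction \<mu> arbitrary: n V)
  case Nil
  then show ?case using total_integral_zero_weight[of n V]
    by (simp add: weight_of_def t_mult_def)
next
  case (Cons m \<mu>)
  obtain n' where n: "n = Suc n'" using Cons.prems(2) by (cases n) auto
  have le: "\<forall>k\<in>set (m # \<mu>). k \<le> m"
    using Cons.prems(1) by (auto simp: is_partition_Cons)
  obtain A where A: "\<And>k. k \<in> set A \<Longrightarrow> - int m < k"
    "weight_of (2 * n) (m # \<mu>) (m # \<mu>) = int m # A @ replicate (count_list (m # \<mu>) m) (- int m)"
    "A @ replicate (count_list (m # \<mu>) m - 1) (- int m) = weight_of (2 * n - 2) \<mu> \<mu>"
    using weight_of_Cons[OF Cons.prems(1,1) le] by metis
  have len: "length A + count_list (m # \<mu>) m = 2 * n' + 1"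
    using arg_cong[OF A(2), of length] length_weight_of[of "m # \<mu>" "m # \<mu>" "2 * n"] Cons.prems(2) by (simp add: n)
  have V: "balanced (Suc n') V" using Cons.prems(3) n by simp
  have "total_integral (weight_of (2 * n) (m # \<mu>) (m # \<mu>)) V =
    of_nat (Suc n') ^ 2 * t_int t (count_list (m # \<mu>) m) / (1 - t) *
    ((fact n' / fact (n' - length \<mu>))\<^sup>2 * (t_mult t \<mu> / (1 - t) ^ length \<mu>) * zero_weight_value t (n' - length \<mu>))"
    unfolding A(2)
  proof (rule total_integral_peel_const[OF V len A(1)])
    fix U assume "balanced n' U"
    then show "total_integral (A @ replicate (count_list (m # \<mu>) m - 1) (- int m)) U =
      (fact n' / fact (n' - length \<mu>))\<^sup>2 * (t_mult t \<mu> / (1 - t) ^ length \<mu>) * zero_weight_value t (n' - length \<mu>)"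
      unfolding A(3) using Cons.IH[of n' U] Cons.prems by (simp add: n is_partition_Cons)
  qed
  then show ?case
    by (simp add: n t_mult_Cons power_mult_distrib power_divide mult_ac)
qed

end

section \<open>Hall--Littlewood polynomials are Laurent polynomials\<close>

text \<open>Laurent polynomials as functions. Boundedness, continuity and divisibility below all follow by induction
  from sums and products, which is why the class is generated by them.\<close>

inductive laurent :: "((nat \<Rightarrow> complex) \<Rightarrow> complex) \<Rightarrow> bool" where
  const: "laurent (\<lambda>z. c)"
| coord: "laurent (\<lambda>z. z i)"
| inverse_coord: "laurent (\<lambda>z. inverse (z i))"
| add: "laurent f \<Longrightarrow> laurent g \<Longrightarrow> laurent (\<lambda>z. f z + g z)"
| mult: "laurent f \<Longrightarrow> laurent g \<Longrightarrow> laurent (\<lambda>z. f z * g z)"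

lemma laurent_diff:
  assumes "laurent f" "laurent g" shows "laurent (\<lambda>z. f z - g z)"
  using laurent.add[OF assms(1) laurent.mult[OF laurent.const[of "-1"] assms(2)]] by simp

lemma laurent_sum: "(\<And>i. i \<in> S \<Longrightarrow> laurent (f i)) \<Longrightarrow> laurent (\<lambda>z. \<Sum>i\<in>S. f i z)"
  by (induction S rule: infinite_finite_induct) (auto intro: laurent.intros)

lemma laurent_prod: "(\<And>i. i \<in> S \<Longrightarrow> laurent (f i)) \<Longrightarrow> laurent (\<lambda>z. \<Prod>i\<in>S. f i z)"
  by (induction S rule: infinite_finite_induct) (auto intro: laurent.intros)

lemma laurent_power: "laurent f \<Longrightarrow> laurent (\<lambda>z. f z ^ k)"
  by (induction k) (auto intro: laurent.intros)

lemma laurent_coord_powi: "laurent (\<lambda>z. z i powi k)"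
  by (cases "k \<ge> 0") (simp_all add: power_int_def laurent_power laurent.intros)

lemma laurent_rename: "laurent f \<Longrightarrow> laurent (\<lambda>z. f (\<lambda>i. z (\<sigma> i)))"
  by (induction rule: laurent.induct) (auto intro: laurent.intros)

lemma laurent_bounded:
  assumes "laurent f" "0 < \<rho>"
  shows "\<exists>C. \<forall>z. (\<forall>i. \<rho> \<le> norm (z i) \<and> norm (z i) \<le> 1) \<longrightarrow> norm (f z) \<le> C"
  using assms(1)
proof (induction rule: laurent.induct)
  case (inverse_coord i)
  show ?case
    using assms(2) by (intro exI[of _ "inverse \<rho>"]) (auto simp: norm_inverse intro!: le_imp_inverse_le)
next
  case (add f g)
  then obtain C D where "\<And>z. (\<forall>i. \<rho> \<le> norm (z i) \<and> norm (z i) \<le> 1) \<Longrightarrow> norm (f z) \<le> C"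
    "\<And>z. (\<forall>i. \<rho> \<le> norm (z i) \<and> norm (z i) \<le> 1) \<Longrightarrow> norm (g z) \<le> D" by blast
  then show ?case by (intro exI[of _ "C + D"]) (auto intro!: norm_triangle_mono)
next
  case (mult f g)
  then obtain C D where "\<And>z. (\<forall>i. \<rho> \<le> norm (z i) \<and> norm (z i) \<le> 1) \<Longrightarrow> norm (f z) \<le> C"
    "\<And>z. (\<forall>i. \<rho> \<le> norm (z i) \<and> norm (z i) \<le> 1) \<Longrightarrow> norm (g z) \<le> D" by blast
  then show ?case by (intro exI[of _ "C * D"]) (auto simp: norm_mult intro!: mult_mono')
qed auto

lemma laurent_continuous_coord:
  assumes "laurent f" "z m \<noteq> 0"
  shows "((\<lambda>x. f (z(m := x))) \<longlongrightarrow> f z) (at (z m))"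
  using assms(1)
proof (induction rule: laurent.induct)
  case (coord i)
  show ?case by (cases "i = m") (auto intro!: tendsto_eq_intros)
next
  case (inverse_coord i)
  show ?case using assms(2) by (cases "i = m") (auto intro!: tendsto_eq_intros)
qed (auto intro: tendsto_intros)

text \<open>The product rule for difference quotients; on the generators the quotient is explicit.\<close>

lemma laurent_difference_quotient:
  assumes "laurent f" "i \<noteq> j"
  shows "\<exists>h. laurent h \<and> (\<forall>z. (\<forall>k. z k \<noteq> 0) \<longrightarrow> f z - f (z(i := z j)) = (z i - z j) * h z)"
  using assms(1)
proof (induction rule: laurent.induct)
  case (const c)
  show ?case by (intro exI[of _ "\<lambda>_. 0"]) (auto intro: laurent.const)
next
  case (coord k)
  show ?case
    by (intro exI[of _ "\<lambda>_. if k = i then 1 else 0"]) (auto intro: laurent.const)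
next
  case (inverse_coord k)
  show ?case
  proof (cases "k = i")
    case True
    have "laurent (\<lambda>z. (- 1) * (inverse (z i) * inverse (z j)))" by (intro laurent.intros)
    moreover have "inverse a - inverse b = (a - b) * (- 1 * (inverse a * inverse b))"
      if "a \<noteq> 0" "b \<noteq> 0" for a b :: complex using that by (simp add: field_simps)
    ultimately show ?thesis using True by (intro exI[of _ "\<lambda>z. (- 1) * (inverse (z i) * inverse (z j))"]) auto
  qed (auto intro!: exI[of _ "\<lambda>_. 0"] laurent.const)
next
  case (add f g)
  then obtain h h' where h: "laurent h" "\<And>z. (\<forall>k. z k \<noteq> 0) \<Longrightarrow> f z - f (z(i := z j)) = (z i - z j) * h z"
    "laurent h'" "\<And>z. (\<forall>k. z k \<noteq> 0) \<Longrightarrow> g z - g (z(i := z j)) = (z i - z j) * h' z" by blast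
  show ?case
  proof (intro exI[of _ "\<lambda>z. h z + h' z"] conjI allI impI)
    show "laurent (\<lambda>z. h z + h' z)" using h by (intro laurent.add)
    fix z :: "nat \<Rightarrow> complex" assume z: "\<forall>k. z k \<noteq> 0"
    show "f z + g z - (f (z(i := z j)) + g (z(i := z j))) = (z i - z j) * (h z + h' z)"
      by (simp only: add_diff_add distrib_left h(2)[OF z] h(4)[OF z])
  qed
next
  case (mult f g)
  then obtain h h' where h: "laurent h" "\<And>z. (\<forall>k. z k \<noteq> 0) \<Longrightarrow> f z - f (z(i := z j)) = (z i - z j) * h z"
    "laurent h'" "\<And>z. (\<forall>k. z k \<noteq> 0) \<Longrightarrow> g z - g (z(i := z j)) = (z i - z j) * h' z" by blast
  have "laurent (\<lambda>z. g (\<lambda>k. z ((id(i := j)) k)))" by (rule laurent_rename[OF mult(2)])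
  moreover have "(\<lambda>k. z ((id(i := j)) k)) = z(i := z j)" for z :: "nat \<Rightarrow> complex" by auto
  ultimately have g': "laurent (\<lambda>z. g (z(i := z j)))" by (simp only:)
  show ?case
  proof (intro exI[of _ "\<lambda>z. f z * h' z + h z * g (z(i := z j))"] conjI allI impI)
    show "laurent (\<lambda>z. f z * h' z + h z * g (z(i := z j)))"
      using h mult g' by (intro laurent.add laurent.mult)
    fix z :: "nat \<Rightarrow> complex" assume z: "\<forall>k. z k \<noteq> 0"
    have "f z * g z - f (z(i := z j)) * g (z(i := z j)) =
        f z * (g z - g (z(i := z j))) + (f z - f (z(i := z j))) * g (z(i := z j))"
      by (simp only: left_diff_distrib right_diff_distrib) simp
    also have "\<dots> = (z i - z j) * (f z * h' z + h z * g (z(i := z j)))"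
      unfolding h(2)[OF z] h(4)[OF z] by (simp only: distrib_left mult_ac)
    finally show "f z * g z - f (z(i := z j)) * g (z(i := z j)) =
        (z i - z j) * (f z * h' z + h z * g (z(i := z j)))" .
  qed
qed

lemma laurent_divide:
  assumes "laurent g" "i \<noteq> j"
    and "\<And>z. (\<forall>k. z k \<noteq> 0) \<Longrightarrow> z i = z j \<Longrightarrow> g z = 0"
  obtains h where "laurent h" "\<And>z. (\<forall>k. z k \<noteq> 0) \<Longrightarrow> g z = (z i - z j) * h z"
proof -
  obtain h where h: "laurent h" "\<And>z. (\<forall>k. z k \<noteq> 0) \<Longrightarrow> g z - g (z(i := z j)) = (z i - z j) * h z"
    using laurent_difference_quotient[OF assms(1,2)] by blast
  have "g (z(i := z j)) = 0" if "\<forall>k. z k \<noteq> 0" for z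
    using that assms(2) by (intro assms(3)) auto
  with h that show ?thesis by simp
qed

text \<open>Divisions by different \<open>z i - z j\<close> can be iterated. On the hyperplane \<open>z k = z l\<close> the quotient vanishes where
  \<open>z i \<noteq> z j\<close>. One of \<open>i\<close>, \<open>j\<close> differs from both \<open>k\<close> and \<open>l\<close>, and moving this coordinate reaches the points
  with \<open>z i = z j\<close> by continuity.\<close>

lemma laurent_quotient_vanishes:
  assumes h: "laurent h" "\<And>z. (\<forall>k. z k \<noteq> 0) \<Longrightarrow> g z = (z i - z j) * h z"
    and g: "\<And>z. (\<forall>k. z k \<noteq> 0) \<Longrightarrow> z k = z l \<Longrightarrow> g z = 0"
    and "i \<noteq> j" "{k, l} \<noteq> {i, j}" "k \<noteq> l"
    and z: "\<forall>k. z k \<noteq> 0" "z k = z l"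
  shows "h z = 0"
proof (cases "z i = z j")
  case False
  then show ?thesis using g[OF z] h(2)[OF z(1)] by simp
next
  case True
  obtain m where m: "m \<in> {i, j}" "m \<noteq> k" "m \<noteq> l" using assms(4-6) by blast
  have "\<forall>\<^sub>F x in at (z m). h (z(m := x)) = 0"
    unfolding eventually_at
  proof (intro exI[of _ "norm (z m)"] conjI ballI impI)
    show "0 < norm (z m)" using z by simp
    fix x assume x: "x \<noteq> z m \<and> dist x (z m) < norm (z m)"
    then have "x \<noteq> 0" by auto
    then have nz: "\<forall>k. (z(m := x)) k \<noteq> 0" using z by simp
    have "g (z(m := x)) = 0" using nz m z(2) by (intro g) auto
    moreover have "(z(m := x)) i \<noteq> (z(m := x)) j" using m(1) x True assms(4) by auto
    ultimately show "h (z(m := x)) = 0"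
      using h(2)[OF nz] by (metis mult_eq_0_iff right_minus_eq)
  qed
  then have "((\<lambda>x. h (z(m := x))) \<longlongrightarrow> 0) (at (z m))" by (rule tendsto_eventually)
  moreover have "((\<lambda>x. h (z(m := x))) \<longlongrightarrow> h z) (at (z m))"
    using h(1) z(1) by (intro laurent_continuous_coord) auto
  ultimately show ?thesis using tendsto_unique[OF at_neq_bot] by blast
qed

lemma laurent_divide_pairs:
  assumes "finite P" "\<And>i j. (i, j) \<in> P \<Longrightarrow> i < j" "laurent g"
    and "\<And>i j z. (i, j) \<in> P \<Longrightarrow> (\<forall>k. z k \<noteq> 0) \<Longrightarrow> z i = z j \<Longrightarrow> g z = 0"
  shows "\<exists>h. laurent h \<and> (\<forall>z. (\<forall>k. z k \<noteq> 0) \<longrightarrow> g z = (\<Prod>(i, j)\<in>P. z i - z j) * h z)"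
  using assms
proof (induction P arbitrary: g rule: finite_induct)
  case empty
  then show ?case by auto
next
  case (insert p P)
  obtain i j where p: "p = (i, j)" by (cases p)
  have ij: "i < j" using insert.prems(1) p by auto
  obtain h where h: "laurent h" "\<And>z. (\<forall>k. z k \<noteq> 0) \<Longrightarrow> g z = (z i - z j) * h z"
    using laurent_divide[OF insert.prems(2), of i j] insert.prems(3)[of i j] ij p by auto
  have "h z = 0" if kl: "(k, l) \<in> P" and z: "\<forall>k. z k \<noteq> 0" "z k = z l" for k l z
  proof (rule laurent_quotient_vanishes[OF h, of k l])
    have "k < l" using insert.prems(1) kl by auto
    then show "k \<noteq> l" "{k, l} \<noteq> {i, j}" using insert.hyps kl ij p by (auto simp: doubleton_eq_iff)
  qed (use insert.prems(3) kl z ij in auto)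
  then obtain h' where h': "laurent h'" "\<And>z. (\<forall>k. z k \<noteq> 0) \<Longrightarrow> h z = (\<Prod>(i, j)\<in>P. z i - z j) * h' z"
    using insert.IH[of h] insert.prems(1) h(1) by auto
  show ?case
  proof (intro exI[of _ h'] conjI allI impI h')
    fix z :: "nat \<Rightarrow> complex" assume "\<forall>k. z k \<noteq> 0"
    then show "g z = (\<Prod>(i, j)\<in>insert p P. z i - z j) * h' z"
      using h(2)[of z] h'(2)[of z] insert.hyps p by (simp add: mult.assoc)
  qed
qed

definition ordered_pairs :: "nat \<Rightarrow> (nat \<times> nat) set" where
  "ordered_pairs N = {(i, j). i < j \<and> j < N}"

lemma finite_ordered_pairs [simp]: "finite (ordered_pairs N)"
  by (rule finite_subset[of _ "{..<N} \<times> {..<N}"]) (auto simp: ordered_pairs_def)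

definition vandermonde :: "nat \<Rightarrow> (nat \<Rightarrow> complex) \<Rightarrow> complex" where
  "vandermonde N z = (\<Prod>(i, j)\<in>ordered_pairs N. z i - z j)"

text \<open>The sign of a permutation \<open>w\<close> of \<open>{..<N}\<close>, computed from its inversions. In this form it is visibly the factor by which
  \<open>w\<close> changes the Vandermonde product.\<close>

definition inversion_sign :: "nat \<Rightarrow> (nat \<Rightarrow> nat) \<Rightarrow> complex" where
  "inversion_sign N w = (\<Prod>(i, j)\<in>ordered_pairs N. if w i < w j then 1 else - 1)"

lemma vandermonde_nonzero: "inj_on z {..<N} \<Longrightarrow> vandermonde N z \<noteq> 0"
  unfolding vandermonde_def prod_zero_iff[OF finite_ordered_pairs]
  by (auto simp: ordered_pairs_def inj_on_def)

lemma vandermonde_permute: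
  assumes w: "w permutes {..<N}"
  shows "vandermonde N (\<lambda>i. z (w i)) = inversion_sign N w * vandermonde N z"
proof -
  define s where "s = (\<lambda>(i, j). (min (w i) (w j), max (w i) (w j)))"
  have inj: "w i = w j \<longleftrightarrow> i = j" for i j using permutes_inj[OF w] by (auto simp: inj_def)
  have lt: "w i < N \<longleftrightarrow> i < N" for i using permutes_in_image[OF w, of i] by simp
  have "s ` ordered_pairs N \<subseteq> ordered_pairs N"
  proof (rule image_subsetI)
    fix p assume "p \<in> ordered_pairs N"
    then obtain i j where p: "p = (i, j)" "i < j" "j < N" by (auto simp: ordered_pairs_def)
    then have "w i \<noteq> w j" "w i < N" "w j < N" using inj[of i j] lt[of i] lt[of j] by auto
    then show "s p \<in> ordered_pairs N" by (auto simp: s_def p(1) ordered_pairs_def min_def max_def)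
  qed
  moreover have "inj_on s (ordered_pairs N)"
    using inj by (auto simp: inj_on_def s_def ordered_pairs_def min_def max_def split: if_splits)
  ultimately have "bij_betw s (ordered_pairs N) (ordered_pairs N)"
    by (simp add: bij_betw_def endo_inj_surj)
  then have "vandermonde N z = (\<Prod>p\<in>ordered_pairs N. case s p of (i, j) \<Rightarrow> z i - z j)"
    unfolding vandermonde_def by (rule prod.reindex_bij_betw[symmetric])
  then have "inversion_sign N w * vandermonde N z =
      (\<Prod>p\<in>ordered_pairs N. (case p of (i, j) \<Rightarrow> if w i < w j then 1 else - 1) * (case s p of (i, j) \<Rightarrow> z i - z j))"
    unfolding inversion_sign_def by (simp add: prod.distrib)
  also have "\<dots> = vandermonde N (\<lambda>i. z (w i))"
    unfolding vandermonde_def by (intro prod.cong) (auto simp: s_def min_def max_def)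
  finally show ?thesis by simp
qed

text \<open>The inverted pairs are \<open>(a, b)\<close>, and \<open>(a, c)\<close> and \<open>(c, b)\<close> for each \<open>c\<close> strictly between, an odd number
  altogether.\<close>

lemma inversion_sign_transpose:
  assumes "a < b" "b < N"
  shows "inversion_sign N (Transposition.transpose a b) = - 1"
proof -
  let ?I = "{p \<in> ordered_pairs N. \<not> (case p of (i, j) \<Rightarrow> Transposition.transpose a b i < Transposition.transpose a b j)}"
  have I: "?I = {(a, b)} \<union> ({a} \<times> {a<..<b} \<union> {a<..<b} \<times> {b})"
    using assms by (auto simp: ordered_pairs_def Transposition.transpose_def split: if_splits)
  have "inversion_sign N (Transposition.transpose a b) = (\<Prod>p\<in>ordered_pairs N. if \<not> (case p of (i, j) \<Rightarrow> Transposition.transpose a b i < Transposition.transpose a b j) then - 1 else 1)"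
    unfolding inversion_sign_def by (intro prod.cong) auto
  also have "\<dots> = (\<Prod>p\<in>?I. - 1)"
    by (rule prod.inter_filter[symmetric]) simp
  also have "\<dots> = (- 1) ^ card ?I" by simp
  also have "card ?I = Suc (card {a<..<b} + card {a<..<b})"
    unfolding I by (subst card_Un_disjoint | force simp: card_cartesian_product)+
  finally show ?thesis by (simp flip: mult_2)
qed

lemma inversion_sign_transpose_compose:
  assumes "a < b" "b < N" "w permutes {..<N}"
  shows "inversion_sign N (Transposition.transpose a b \<circ> w) = - inversion_sign N w"
proof -
  \<comment> \<open>Any point with distinct coordinates serves to compare the signs.\<close>
  define z where "z = (of_nat :: nat \<Rightarrow> complex)"
  have "vandermonde N z \<noteq> 0" by (rule vandermonde_nonzero) (auto simp: z_def inj_on_def)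
  have t: "Transposition.transpose a b permutes {..<N}" using assms by (intro permutes_swap_id) auto
  have "inversion_sign N (Transposition.transpose a b \<circ> w) * vandermonde N z = vandermonde N (\<lambda>i. z ((Transposition.transpose a b \<circ> w) i))"
    by (rule vandermonde_permute[symmetric]) (rule permutes_compose[OF assms(3) t])
  also have "\<dots> = vandermonde N (\<lambda>i. (\<lambda>i. z (Transposition.transpose a b i)) (w i))" by simp
  also have "\<dots> = inversion_sign N w * (inversion_sign N (Transposition.transpose a b) * vandermonde N z)"
    by (subst vandermonde_permute[OF assms(3)], subst vandermonde_permute[OF t]) simp
  also have "\<dots> = - inversion_sign N w * vandermonde N z"
    by (simp add: inversion_sign_transpose[OF assms(1,2)])
  finally show ?thesis
    using \<open>vandermonde N z \<noteq> 0\<close> mult_right_cancel by blast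
qed

text \<open>Over the common denominator \<open>vandermonde N z\<close> the symmetrization becomes an alternating sum of Laurent
  polynomials. This numerator changes sign when two coordinates are exchanged, so it vanishes where they agree, and
  the denominator divides it.\<close>

lemma hall_littlewood_laurent:
  shows "\<exists>h. laurent h \<and> (\<forall>z. (\<forall>k. z k \<noteq> 0) \<longrightarrow> inj_on z {..<length \<kappa>} \<longrightarrow> hall_littlewood \<kappa> t z = h z)"
proof -
  define N where "N = length \<kappa>"
  define f where "f z = (\<Prod>i<N. z i powi (\<kappa> ! i)) * (\<Prod>(i, j)\<in>ordered_pairs N. z i - t * z j)" for z :: "nat \<Rightarrow> complex"
  define g where "g z = (\<Sum>w | w permutes {..<N}. inversion_sign N w * f (\<lambda>i. z (w i)))" for z
  have "laurent f"
    unfolding f_def case_prod_unfold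
    by (intro laurent.mult laurent_prod laurent_coord_powi laurent_diff laurent.coord laurent.const)
  then have "laurent (\<lambda>z. f (\<lambda>i. z (w i)))" for w
    using laurent_rename[of f w] by simp
  then have "laurent g"
    unfolding g_def by (intro laurent_sum laurent.mult[OF laurent.const])
  have "g z = 0" if ij: "(i, j) \<in> ordered_pairs N" and z: "z i = z j" for i j z
  proof -
    have l: "i < j" "j < N" using ij by (auto simp: ordered_pairs_def)
    have t: "Transposition.transpose i j permutes {..<N}" using l by (intro permutes_swap_id) auto
    have zt: "z (Transposition.transpose i j k) = z k" for k using z by (auto simp: Transposition.transpose_def)
    have "g z = (\<Sum>w | w permutes {..<N}. inversion_sign N (Transposition.transpose i j \<circ> w) * f (\<lambda>k. z ((Transposition.transpose i j \<circ> w) k)))"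
      unfolding g_def
      by (rule sum.reindex_bij_witness[where i = "\<lambda>w. Transposition.transpose i j \<circ> w" and j = "\<lambda>w. Transposition.transpose i j \<circ> w"])
        (auto intro: permutes_compose[OF _ t] simp: comp_assoc[symmetric])
    also have "\<dots> = (\<Sum>w | w permutes {..<N}. - (inversion_sign N w * f (\<lambda>k. z (w k))))"
      using l by (intro sum.cong refl) (simp add: inversion_sign_transpose_compose zt)
    also have "\<dots> = - g z" by (simp add: g_def sum_negf)
    finally show ?thesis by simp
  qed
  then obtain h where h: "laurent h" "\<And>z. (\<forall>k. z k \<noteq> 0) \<Longrightarrow> g z = vandermonde N z * h z"
    using laurent_divide_pairs[OF finite_ordered_pairs _ \<open>laurent g\<close>, of N]
    unfolding vandermonde_def by (auto simp: ordered_pairs_def)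
  show ?thesis
  proof (intro exI[of _ "\<lambda>z. 1 / t_mult t \<kappa> * h z"] conjI allI impI laurent.mult laurent.const h)
    fix z :: "nat \<Rightarrow> complex" assume z: "\<forall>k. z k \<noteq> 0" "inj_on z {..<length \<kappa>}"
    have v: "vandermonde N z \<noteq> 0" using z(2) by (intro vandermonde_nonzero) (simp add: N_def)
    have sq: "inversion_sign N w * inversion_sign N w = 1" for w
      unfolding inversion_sign_def prod.distrib[symmetric] by (rule prod.neutral) auto
    have "(\<Prod>i<length \<kappa>. z (w i) powi (\<kappa> ! i)) *
        (\<Prod>(i, j)\<in>{(i, j). i < j \<and> j < length \<kappa>}. (z (w i) - t * z (w j)) / (z (w i) - z (w j)))
        = inversion_sign N w * f (\<lambda>i. z (w i)) / vandermonde N z" if w: "w permutes {..<N}" for w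
    proof -
      have "(\<Prod>(i, j)\<in>ordered_pairs N. (z (w i) - t * z (w j)) / (z (w i) - z (w j))) =
          (\<Prod>(i, j)\<in>ordered_pairs N. z (w i) - t * z (w j)) / vandermonde N (\<lambda>i. z (w i))"
        unfolding vandermonde_def case_prod_unfold by (rule prod_dividef)
      then have "(\<Prod>i<length \<kappa>. z (w i) powi (\<kappa> ! i)) *
        (\<Prod>(i, j)\<in>{(i, j). i < j \<and> j < length \<kappa>}. (z (w i) - t * z (w j)) / (z (w i) - z (w j)))
        = f (\<lambda>i. z (w i)) / vandermonde N (\<lambda>i. z (w i))"
        by (simp add: f_def N_def ordered_pairs_def)
      also have "\<dots> = inversion_sign N w * f (\<lambda>i. z (w i)) / vandermonde N z"
        unfolding vandermonde_permute[OF w] using sq[of w] v by (auto simp: divide_simps)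
      finally show ?thesis .
    qed
    then have "hall_littlewood \<kappa> t z = 1 / t_mult t \<kappa> * (g z / vandermonde N z)"
      unfolding hall_littlewood_def g_def N_def[symmetric] by (simp add: sum_divide_distrib)
    then show "hall_littlewood \<kappa> t z = 1 / t_mult t \<kappa> * h z"
      using h(2)[OF z(1)] v by simp
  qed
qed

lemma hall_littlewood_cong:
  assumes "\<And>i. i < length \<kappa> \<Longrightarrow> z i = z' i"
  shows "hall_littlewood \<kappa> t z = hall_littlewood \<kappa> t z'"
proof -
  have "z (w i) = z' (w i)" if "w permutes {..<length \<kappa>}" "i < length \<kappa>" for w i
    using assms permutes_in_image[OF that(1), of i] that(2) by simp
  then show ?thesis
    unfolding hall_littlewood_def
    by (intro arg_cong2[where f = times] refl sum.cong prod.cong) auto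
qed

text \<open>Together with \<open>full_density_bounded\<close> this dominates the integrands of \<open>deformed_integral_tendsto\<close>
  uniformly in the radius.\<close>

lemma hall_littlewood_bounded:
  assumes "0 < \<rho>" "\<rho> \<le> 1"
  shows "\<exists>C. \<forall>z. (\<forall>i<length \<kappa>. \<rho> \<le> norm (z i) \<and> norm (z i) \<le> 1) \<longrightarrow> inj_on z {..<length \<kappa>} \<longrightarrow>
    norm (hall_littlewood \<kappa> t z) \<le> C"
proof -
  obtain h where h: "laurent h" "\<And>z. (\<forall>k. z k \<noteq> 0) \<Longrightarrow> inj_on z {..<length \<kappa>} \<Longrightarrow> hall_littlewood \<kappa> t z = h z"
    using hall_littlewood_laurent by blast
  obtain C where C: "\<And>z. (\<forall>i. \<rho> \<le> norm (z i) \<and> norm (z i) \<le> 1) \<Longrightarrow> norm (h z) \<le> C"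
    using laurent_bounded[OF h(1) assms(1)] by blast
  show ?thesis
  proof (intro exI[of _ C] allI impI)
    fix z :: "nat \<Rightarrow> complex"
    assume z: "\<forall>i<length \<kappa>. \<rho> \<le> norm (z i) \<and> norm (z i) \<le> 1" "inj_on z {..<length \<kappa>}"
    \<comment> \<open>The bound on \<open>h\<close> concerns all coordinates, the polynomial depends on the first ones only.\<close>
    define z' where "z' i = (if i < length \<kappa> then z i else 1)" for i
    have "\<rho> \<le> norm (z' i) \<and> norm (z' i) \<le> 1" for i using z assms by (simp add: z'_def)
    moreover from this have "z' i \<noteq> 0" for i using assms(1) by (metis norm_zero not_less)
    moreover have "inj_on z' {..<length \<kappa>}" using z(2) by (auto simp: inj_on_def z'_def)
    moreover have "hall_littlewood \<kappa> t z = hall_littlewood \<kappa> t z'"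
      by (rule hall_littlewood_cong) (simp add: z'_def)
    ultimately show "norm (hall_littlewood \<kappa> t z) \<le> C" using h(2) C by simp
  qed
qed

section \<open>The integrand as a sum over orderings\<close>

text \<open>The density as a product over ordered pairs of distinct indices, a form that refers to no ordering of the
  variables and hence is common to all terms of the symmetrization.\<close>

definition oriented_density :: "complex \<Rightarrow> nat set \<Rightarrow> (nat \<Rightarrow> complex) \<Rightarrow> nat \<Rightarrow> nat \<Rightarrow> complex" where
  "oriented_density t X u v w =
     (if v \<in> X \<longleftrightarrow> w \<in> X then 1 - u v * inverse (u w) else 1 / (1 - t * u v * inverse (u w)))"

definition full_density :: "complex \<Rightarrow> nat set \<Rightarrow> (nat \<Rightarrow> complex) \<Rightarrow> nat set \<Rightarrow> complex" where
  "full_density t X u V = (\<Prod>v\<in>V. \<Prod>w\<in>V - {v}. oriented_density t X u v w)"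

lemma full_density_insert:
  assumes "finite V" "v \<notin> V"
  shows "full_density t X u (insert v V) = (\<Prod>w\<in>V. pair_density t X u v w) * full_density t X u V"
proof -
  have "(\<Prod>w\<in>insert v V - {v'}. oriented_density t X u v' w) =
      oriented_density t X u v' v * (\<Prod>w\<in>V - {v'}. oriented_density t X u v' w)" if "v' \<in> V" for v'
  proof -
    have "insert v V - {v'} = insert v (V - {v'})" using that assms by auto
    then show ?thesis using assms by simp
  qed
  moreover have "insert v V - {v} = V" using assms by auto
  moreover have "oriented_density t X u v w * oriented_density t X u w v = pair_density t X u v w" for w
    by (auto simp: oriented_density_def pair_density_def)
  ultimately show ?thesis
    using assms by (simp add: full_density_def prod.distrib[symmetric] mult.assoc[symmetric])
qed

lemma prod_ordered_pairs_Suc: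
  fixes F :: "nat \<Rightarrow> nat \<Rightarrow> complex"
  shows "(\<Prod>(i, j)\<in>ordered_pairs (Suc N). F i j) =
    (\<Prod>j<N. F 0 (Suc j)) * (\<Prod>(i, j)\<in>ordered_pairs N. F (Suc i) (Suc j))"
proof -
  have eq: "ordered_pairs (Suc N) = (\<lambda>j. (0, Suc j)) ` {..<N} \<union> (\<lambda>(i, j). (Suc i, Suc j)) ` ordered_pairs N"
  proof (intro equalityI subsetI)
    fix p assume "p \<in> ordered_pairs (Suc N)"
    then obtain i j where p: "p = (i, Suc j)" "i < Suc j" "j < N"
      by (auto simp: ordered_pairs_def dest: less_imp_Suc_add)
    then show "p \<in> (\<lambda>j. (0, Suc j)) ` {..<N} \<union> (\<lambda>(i, j). (Suc i, Suc j)) ` ordered_pairs N"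
      by (cases i) (auto simp: ordered_pairs_def)
  qed (auto simp: ordered_pairs_def)
  have "(\<Prod>(i, j)\<in>ordered_pairs (Suc N). F i j) =
      (\<Prod>(i, j)\<in>(\<lambda>j. (0, Suc j)) ` {..<N}. F i j) * (\<Prod>(i, j)\<in>(\<lambda>(i, j). (Suc i, Suc j)) ` ordered_pairs N. F i j)"
    unfolding eq by (rule prod.union_disjoint) auto
  also have "(\<Prod>(i, j)\<in>(\<lambda>j. (0, Suc j)) ` {..<N}. F i j) = (\<Prod>j<N. F 0 (Suc j))"
    by (subst prod.reindex) (auto simp: inj_on_def)
  also have "(\<Prod>(i, j)\<in>(\<lambda>(i, j). (Suc i, Suc j)) ` ordered_pairs N. F i j) =
      (\<Prod>(i, j)\<in>ordered_pairs N. F (Suc i) (Suc j))"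
    by (subst prod.reindex) (auto simp: inj_on_def case_prod_unfold)
  finally show ?thesis .
qed

lemma prod_set_conv_nth:
  assumes "distinct vs"
  shows "(\<Prod>w\<in>set vs. f w) = (\<Prod>j<length vs. f (vs ! j))"
  by (rule prod.reindex_bij_betw[symmetric]) (use assms bij_betw_nth in blast)

lemma ordered_term_eq:
  assumes "length ks = length vs" "distinct vs"
  shows "ordered_term t X u ks vs = (\<Prod>i<length vs. u (vs ! i) powi (ks ! i)) *
    (\<Prod>(i, j)\<in>ordered_pairs (length vs). (u (vs ! i) - t * u (vs ! j)) / (u (vs ! i) - u (vs ! j))) *
    full_density t X u (set vs)"
  using assms
proof (induction ks vs rule: list_induct2)
  case Nil
  then show ?case by (simp add: full_density_def ordered_pairs_def)
next
  case (Cons k ks v vs)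
  have "(\<Prod>w\<in>set vs. pair_factor t X u v w) =
      (\<Prod>j<length vs. (u v - t * u (vs ! j)) / (u v - u (vs ! j))) * (\<Prod>w\<in>set vs. pair_density t X u v w)"
    unfolding pair_factor_def prod.distrib using Cons.prems by (subst prod_set_conv_nth) auto
  then show ?case
    using Cons by (simp add: prod_ordered_pairs_Suc full_density_insert prod.lessThan_Suc_shift mult_ac
      del: prod.lessThan_Suc)
qed

lemma sum_permutes_conv_lists:
  "(\<Sum>w | w permutes {..<N}. F (map w [0..<N])) = (\<Sum>vs\<in>permutations_of_set {..<N}. F vs)"
proof (rule sum.reindex_bij_witness[where i = "\<lambda>vs i. if i < N then vs ! i else i" and j = "\<lambda>w. map w [0..<N]"])
  fix w assume "w \<in> {w. w permutes {..<N}}"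
  then have w: "w permutes {..<N}" by simp
  show "(\<lambda>i. if i < N then map w [0..<N] ! i else i) = w"
    using permutes_not_in[OF w] by (auto simp: fun_eq_iff)
  show "map w [0..<N] \<in> permutations_of_set {..<N}"
    using permutes_image[OF w] permutes_inj_on[OF w]
    by (intro permutations_of_setI) (simp_all add: distinct_map atLeast0LessThan)
next
  fix vs assume vs: "vs \<in> permutations_of_set {..<N}"
  have len: "length vs = N" using length_finite_permutations_of_set[OF vs] by simp
  have s: "set vs = {..<N}" "distinct vs" using permutations_of_setD[OF vs] by auto
  show "map (\<lambda>i. if i < N then vs ! i else i) [0..<N] = vs"
    by (rule nth_equalityI) (simp_all add: len)
  have "bij_betw (\<lambda>i. vs ! i) {..<N} {..<N}"
    by (rule bij_betw_nth) (simp_all only: len s)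
  then have "bij_betw (\<lambda>i. if i < N then vs ! i else i) {..<N} {..<N}"
    by (rule bij_betw_cong[THEN iffD1, rotated]) simp
  then show "(\<lambda>i. if i < N then vs ! i else i) \<in> {w. w permutes {..<N}}"
    by (auto intro!: bij_imp_permutes split: if_splits)
qed simp

lemma hall_littlewood_times_density:
  "hall_littlewood \<kappa> t u * full_density t X u {..<length \<kappa>} =
    1 / t_mult t \<kappa> * (\<Sum>vs\<in>permutations_of_set {..<length \<kappa>}. ordered_term t X u \<kappa> vs)"
proof -
  let ?N = "length \<kappa>"
  define F where "F vs = (\<Prod>i<?N. u (vs ! i) powi (\<kappa> ! i)) *
    (\<Prod>(i, j)\<in>ordered_pairs ?N. (u (vs ! i) - t * u (vs ! j)) / (u (vs ! i) - u (vs ! j)))" for vs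
  have "hall_littlewood \<kappa> t u = 1 / t_mult t \<kappa> * (\<Sum>w | w permutes {..<?N}. F (map w [0..<?N]))"
    unfolding hall_littlewood_def F_def
    by (intro arg_cong2[where f = times] refl sum.cong prod.cong) (auto simp: ordered_pairs_def)
  also have "\<dots> = 1 / t_mult t \<kappa> * (\<Sum>vs\<in>permutations_of_set {..<?N}. F vs)"
    by (simp only: sum_permutes_conv_lists)
  finally have "hall_littlewood \<kappa> t u * full_density t X u {..<?N} =
      1 / t_mult t \<kappa> * (\<Sum>vs\<in>permutations_of_set {..<?N}. F vs * full_density t X u {..<?N})"
    by (simp add: sum_distrib_right)
  also have "(\<Sum>vs\<in>permutations_of_set {..<?N}. F vs * full_density t X u {..<?N}) =
      (\<Sum>vs\<in>permutations_of_set {..<?N}. ordered_term t X u \<kappa> vs)"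
  proof (rule sum.cong[OF refl])
    fix vs assume vs: "vs \<in> permutations_of_set {..<?N}"
    then show "F vs * full_density t X u {..<?N} = ordered_term t X u \<kappa> vs"
      using length_finite_permutations_of_set[OF vs] permutations_of_setD[OF vs]
      by (simp add: ordered_term_eq F_def)
  qed
  finally show ?thesis .
qed

lemma density_factor_eq_full_density:
  "density_factor n t u (\<lambda>j. u (n + j)) = 1 / (fact n)\<^sup>2 * full_density t {..<n} u {..<2 * n}"
proof -
  define d where "d = oriented_density t {..<n} u"
  have shift: "(\<Prod>y\<in>{n..<2 * n}. f y) = (\<Prod>j<n. f (n + j))" for f :: "nat \<Rightarrow> complex"
    by (rule prod.reindex_bij_witness[where i = "\<lambda>j. n + j" and j = "\<lambda>y. y - n"]) auto
  have split: "(\<Prod>w\<in>{..<2 * n} - {v}. f w) = (\<Prod>w\<in>{..<n} - {v}. f w) * (\<Prod>w\<in>{n..<2 * n} - {v}. f w)"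
    for f :: "nat \<Rightarrow> complex" and v
    by (subst prod.union_disjoint[symmetric]) (auto intro!: prod.cong)
  have "full_density t {..<n} u {..<2 * n} =
      (\<Prod>v<n. \<Prod>w\<in>{..<2 * n} - {v}. d v w) * (\<Prod>v\<in>{n..<2 * n}. \<Prod>w\<in>{..<2 * n} - {v}. d v w)"
    unfolding full_density_def d_def[symmetric]
    by (subst prod.union_disjoint[symmetric]) (auto intro!: prod.cong)
  also have "(\<Prod>v<n. \<Prod>w\<in>{..<2 * n} - {v}. d v w) =
      (\<Prod>i<n. \<Prod>j\<in>{..<n} - {i}. d i j) * (\<Prod>i<n. \<Prod>j<n. d i (n + j))"
    unfolding split prod.distrib by (simp flip: shift)
  also have "(\<Prod>v\<in>{n..<2 * n}. \<Prod>w\<in>{..<2 * n} - {v}. d v w) =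
      (\<Prod>i<n. \<Prod>j<n. d (n + i) j) * (\<Prod>i<n. \<Prod>j\<in>{..<n} - {i}. d (n + i) (n + j))"
  proof -
    have "(\<Prod>w\<in>{n..<2 * n} - {n + i}. f w) = (\<Prod>j\<in>{..<n} - {i}. f (n + j))" for i and f :: "nat \<Rightarrow> complex"
      by (rule prod.reindex_bij_witness[where i = "\<lambda>j. n + j" and j = "\<lambda>y. y - n"]) auto
    then show ?thesis
      unfolding split prod.distrib by (simp add: shift)
  qed
  also have "(\<Prod>i<n. \<Prod>j\<in>{..<n} - {i}. d i j) * (\<Prod>i<n. \<Prod>j<n. d i (n + j)) *
      ((\<Prod>i<n. \<Prod>j<n. d (n + i) j) * (\<Prod>i<n. \<Prod>j\<in>{..<n} - {i}. d (n + i) (n + j))) =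
      (\<Prod>i<n. \<Prod>j<n. d i (n + j) * d (n + i) j) * (\<Prod>i<n. \<Prod>j\<in>{..<n} - {i}. d i j * d (n + i) (n + j))"
    by (simp add: prod.distrib mult_ac)
  also have "(\<Prod>i<n. \<Prod>j<n. d i (n + j) * d (n + i) j) =
      (\<Prod>i<n. \<Prod>j<n. 1 / ((1 - t * u i * inverse (u (n + j))) * (1 - t * u (n + i) * inverse (u j))))"
    by (intro prod.cong refl) (simp add: d_def oriented_density_def)
  also have "(\<Prod>i<n. \<Prod>j\<in>{..<n} - {i}. d i j * d (n + i) (n + j)) =
      (\<Prod>i<n. \<Prod>j\<in>{..<n} - {i}. (1 - u i * inverse (u j)) * (1 - u (n + i) * inverse (u (n + j))))"
    by (intro prod.cong refl) (simp add: d_def oriented_density_def)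
  also have "\<dots> = (\<Prod>(i, j)\<in>(SIGMA i:{..<n}. {..<n} - {i}). (1 - u i * inverse (u j)) * (1 - u (n + i) * inverse (u (n + j))))"
    by (rule prod.Sigma) auto
  also have "(SIGMA i:{..<n}. {..<n} - {i}) = {(i, j). i < n \<and> j < n \<and> i \<noteq> j}" by auto
  finally show ?thesis unfolding density_factor_def by (simp add: mult.assoc)
qed

lemma torus_integral_eq_LINT:
  "torus_integral n t \<mu> \<nu> = 1 / (fact n)\<^sup>2 * (LINT z|torus {..<2 * n}.
     hall_littlewood (weight_of (2 * n) \<mu> \<nu>) t z * full_density t {..<n} z {..<2 * n})"
  unfolding torus_integral_def torus_measure_def density_factor_eq_full_density
  by (subst integral_mult_right_zero[symmetric]) (simp add: mult_ac)

lemma measurable_hall_littlewood: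
  assumes "\<And>i. i < length \<kappa> \<Longrightarrow> (\<lambda>z. f z i) \<in> borel_measurable M"
  shows "(\<lambda>z. hall_littlewood \<kappa> t (f z)) \<in> borel_measurable M"
proof -
  have "w i < length \<kappa>" if "w permutes {..<length \<kappa>}" "i < length \<kappa>" for w i
    using permutes_in_image[OF that(1), of i] that(2) by simp
  then show ?thesis
    unfolding hall_littlewood_def case_prod_unfold
    by (intro borel_measurable_times borel_measurable_const borel_measurable_sum borel_measurable_prod
      borel_measurable_divide borel_measurable_diff borel_measurable_power_int assms) auto
qed

lemma measurable_full_density:
  assumes "\<And>i. i \<in> V \<Longrightarrow> (\<lambda>z. f z i) \<in> borel_measurable M"
  shows "(\<lambda>z. full_density t X (f z) V) \<in> borel_measurable M"
proof -
  have "(\<lambda>z. oriented_density t X (f z) v w) \<in> borel_measurable M" if "v \<in> V" "w \<in> V" for v w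
  proof -
    note [measurable] = assms[OF that(1)] assms[OF that(2)]
    show ?thesis unfolding oriented_density_def by measurable
  qed
  then show ?thesis unfolding full_density_def by (intro borel_measurable_prod) auto
qed

lemma (in two_radii) deformed_integral:
  assumes "length \<kappa> = N"
  shows "(LINT z|torus {..<N}. hall_littlewood \<kappa> t (scaled z) * full_density t X (scaled z) {..<N}) =
    1 / t_mult t \<kappa> * total_integral \<kappa> {..<N}"
proof -
  have "(LINT z|torus {..<N}. hall_littlewood \<kappa> t (scaled z) * full_density t X (scaled z) {..<N}) =
      1 / t_mult t \<kappa> * (LINT z|torus {..<N}. (\<Sum>vs\<in>permutations_of_set {..<N}. ordered_term t X (scaled z) \<kappa> vs))"
    unfolding assms[symmetric] hall_littlewood_times_density by (rule integral_mult_right_zero)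
  also have "(LINT z|torus {..<N}. (\<Sum>vs\<in>permutations_of_set {..<N}. ordered_term t X (scaled z) \<kappa> vs)) =
      (\<Sum>vs\<in>permutations_of_set {..<N}. LINT z|torus {..<N}. ordered_term t X (scaled z) \<kappa> vs)"
    by (intro Bochner_Integration.integral_sum integrable_ordered_term) (auto dest: permutations_of_setD)
  also have "\<dots> = total_integral \<kappa> {..<N}"
    unfolding total_integral_def term_integral_def
    by (intro sum.cong refl) (simp add: permutations_of_setD)
  finally show ?thesis .
qed

lemma full_density_bounded:
  assumes "norm t < \<rho>" "\<rho> \<le> 1" "finite V" "\<And>i. i \<in> V \<Longrightarrow> \<rho> \<le> norm (u i) \<and> norm (u i) \<le> 1"
  shows "norm (full_density t X u V) \<le> (\<Prod>v\<in>V. \<Prod>w\<in>V - {v}. 1 + 1 / \<rho> + 1 / (1 - norm t / \<rho>))"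
proof -
  have \<rho>: "0 < \<rho>" using assms(1) norm_ge_zero[of t] by linarith
  have "norm (oriented_density t X u v w) \<le> 1 + 1 / \<rho> + 1 / (1 - norm t / \<rho>)" if "v \<in> V" "w \<in> V" for v w
  proof -
    have q: "norm (u v * inverse (u w)) \<le> 1 / \<rho>"
      using assms(4)[OF that(1)] assms(4)[OF that(2)] \<rho>
      by (simp add: norm_mult norm_inverse norm_divide divide_inverse[symmetric] frac_le)
    have t1: "norm t / \<rho> < 1" using assms(1) \<rho> by simp
    have "norm (t * (u v * inverse (u w))) \<le> norm t * (1 / \<rho>)"
      unfolding norm_mult[of t] by (intro mult_left_mono q) simp
    then have "1 - norm t / \<rho> \<le> norm (1 - t * u v * inverse (u w))"
      using norm_triangle_ineq2[of 1 "t * u v * inverse (u w)"] by (simp add: mult.assoc)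
    then have "norm (1 / (1 - t * u v * inverse (u w))) \<le> 1 / (1 - norm t / \<rho>)"
      unfolding norm_divide using t1 by (simp add: frac_le)
    moreover have "norm (1 - u v * inverse (u w)) \<le> 1 + 1 / \<rho>"
      using norm_triangle_ineq4[of 1 "u v * inverse (u w)"] q by simp
    moreover have "0 \<le> 1 / (1 - norm t / \<rho>)" "0 \<le> 1 / \<rho>" using t1 \<rho> by simp_all
    ultimately have "norm (1 - u v * inverse (u w)) \<le> 1 + 1 / \<rho> + 1 / (1 - norm t / \<rho>)"
      "norm (1 / (1 - t * u v * inverse (u w))) \<le> 1 + 1 / \<rho> + 1 / (1 - norm t / \<rho>)"
      by linarith+
    then show ?thesis
      unfolding oriented_density_def by (rule if_split[THEN iffD2, OF conjI, OF impI impI])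
  qed
  then show ?thesis
    unfolding full_density_def prod_norm[symmetric] by (intro prod_mono conjI prod_nonneg) auto
qed

section \<open>Returning to the torus\<close>

lemma tendsto_hall_littlewood:
  assumes "\<And>i. i < length \<kappa> \<Longrightarrow> ((\<lambda>m. u m i) \<longlongrightarrow> z i) F"
    and "\<And>i. i < length \<kappa> \<Longrightarrow> z i \<noteq> 0" "inj_on z {..<length \<kappa>}"
  shows "((\<lambda>m. hall_littlewood \<kappa> t (u m)) \<longlongrightarrow> hall_littlewood \<kappa> t z) F"
proof -
  have w: "w i < length \<kappa>" if "w permutes {..<length \<kappa>}" "i < length \<kappa>" for w i
    using permutes_in_image[OF that(1), of i] that(2) by simp
  have neq: "z (w i) - z (w j) \<noteq> 0" if "w permutes {..<length \<kappa>}" "i < j" "j < length \<kappa>" for w i j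
  proof -
    have "w i \<noteq> w j" using permutes_inj[OF that(1)] that(2) by (auto simp: inj_def)
    then show ?thesis using assms(3) w[OF that(1)] that by (auto simp: inj_on_def)
  qed
  show ?thesis
    unfolding hall_littlewood_def case_prod_unfold
    by (intro tendsto_mult tendsto_const tendsto_sum tendsto_prod tendsto_divide tendsto_diff tendsto_power_int assms(1))
      (use w neq assms(2) in auto)
qed

lemma tendsto_full_density:
  assumes "norm t < 1" "\<And>i. i \<in> V \<Longrightarrow> ((\<lambda>m. u m i) \<longlongrightarrow> z i) F" "\<And>i. i \<in> V \<Longrightarrow> norm (z i) = 1"
  shows "((\<lambda>m. full_density t X (u m) V) \<longlongrightarrow> full_density t X z V) F"
proof -
  have "((\<lambda>m. oriented_density t X (u m) v w) \<longlongrightarrow> oriented_density t X z v w) F"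
    if v: "v \<in> V" and w: "w \<in> V" for v w
  proof -
    have "z w \<noteq> 0" using assms(3)[OF w] by auto
    moreover have "1 - t * z v * inverse (z w) \<noteq> 0"
    proof
      assume "1 - t * z v * inverse (z w) = 0"
      then have "norm (t * z v * inverse (z w)) = 1" by simp
      then show False using assms(1) assms(3)[OF v] assms(3)[OF w] by (simp add: norm_mult norm_inverse)
    qed
    ultimately show ?thesis
      unfolding oriented_density_def by (auto intro!: tendsto_intros assms(2) v w)
  qed
  then show ?thesis unfolding full_density_def by (intro tendsto_prod) auto
qed

lemma deformed_integral_tendsto:
  fixes r :: "nat \<Rightarrow> real"
  assumes r: "r \<longlonglongrightarrow> 1" and radii: "\<And>m. two_radii t (r m)" and low: "norm t < \<rho>" "\<And>m. \<rho> \<le> r m"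
    and N: "length \<kappa> = N"
  shows "(\<lambda>m. LINT z|torus {..<N}. hall_littlewood \<kappa> t (two_radii.scaled (r m) X z) *
      full_density t X (two_radii.scaled (r m) X z) {..<N})
    \<longlonglongrightarrow> (LINT z|torus {..<N}. hall_littlewood \<kappa> t z * full_density t X z {..<N})"
proof -
  let ?s = "\<lambda>m. two_radii.scaled (r m) X"
  have r1: "r m < 1" for m using two_radii.r_less_1[OF radii] .
  have \<rho>: "0 < \<rho>" "\<rho> \<le> 1" using low(1) norm_ge_zero[of t] low(2)[of 0] r1[of 0] by linarith+
  have s: "?s m z = (\<lambda>i. (if i \<in> X then of_real (r m) else 1) * z i)" for m z
    by (rule two_radii.scaled_def[OF radii])
  obtain C where C: "\<And>z. \<forall>i<N. \<rho> \<le> norm (z i) \<and> norm (z i) \<le> 1 \<Longrightarrow> inj_on z {..<N} \<Longrightarrow>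
      norm (hall_littlewood \<kappa> t z) \<le> C"
    using hall_littlewood_bounded[OF \<rho>, of \<kappa> t] unfolding N by blast
  define B where "B = (\<Prod>v<N. \<Prod>w\<in>{..<N} - {v}. 1 + 1 / \<rho> + 1 / (1 - norm t / \<rho>))"
  interpret P: prob_space "torus {..<N}" by (rule prob_space_torus)
  have meas: "(\<lambda>z. z i) \<in> borel_measurable (torus {..<N})" "(\<lambda>z. ?s m z i) \<in> borel_measurable (torus {..<N})"
    if "i < N" for i m
    using that measurable_torus_component[of i "{..<N}"] two_radii.measurable_scaled[OF radii, of i "{..<N}"] by auto
  show ?thesis
  proof (rule integral_dominated_convergence[where w = "\<lambda>_. C * B"])
    show "(\<lambda>z. hall_littlewood \<kappa> t z * full_density t X z {..<N}) \<in> borel_measurable (torus {..<N})"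
      using meas(1) N by (intro borel_measurable_times measurable_hall_littlewood measurable_full_density) auto
    show "(\<lambda>z. hall_littlewood \<kappa> t (?s m z) * full_density t X (?s m z) {..<N}) \<in> borel_measurable (torus {..<N})" for m
      using meas(2) N by (intro borel_measurable_times measurable_hall_littlewood measurable_full_density) auto
    show "AE z in torus {..<N}. (\<lambda>m. hall_littlewood \<kappa> t (?s m z) * full_density t X (?s m z) {..<N})
        \<longlonglongrightarrow> hall_littlewood \<kappa> t z * full_density t X z {..<N}"
      using AE_circles_norm[OF finite_lessThan, of N] AE_circles_inj[OF finite_lessThan, of N]
    proof eventually_elim
      case (elim z)
      have "(\<lambda>m. ?s m z i) \<longlonglongrightarrow> z i" for i
      proof -
        have "(\<lambda>m. (if i \<in> X then of_real (r m) else 1) * z i) \<longlonglongrightarrow> (if i \<in> X then of_real 1 else 1) * z i"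
          by (cases "i \<in> X") (auto intro!: tendsto_intros tendsto_of_real r simp del: of_real_1)
        then show ?thesis unfolding s by (simp only: of_real_1 if_cancel mult_1)
      qed
      moreover have "z i \<noteq> 0" if "i < N" for i using elim(1) that by force
      moreover have "norm t < 1" using low(1) \<rho>(2) by linarith
      ultimately show ?case
        using elim N by (intro tendsto_mult tendsto_hall_littlewood tendsto_full_density) auto
    qed
    show "AE z in torus {..<N}. norm (hall_littlewood \<kappa> t (?s m z) * full_density t X (?s m z) {..<N}) \<le> C * B" for m
      using two_radii.AE_generic[OF radii[of m] finite_lessThan, of X N]
    proof eventually_elim
      case (elim z)
      have b: "\<rho> \<le> norm (?s m z i) \<and> norm (?s m z i) \<le> 1" if "i < N" for i
        using two_radii.generic_bounds[OF radii elim, of i] that low(2)[of m] by auto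
      have "inj_on (?s m z) {..<N}"
        using elim unfolding two_radii.generic_def[OF radii] by simp
      then have "norm (hall_littlewood \<kappa> t (?s m z)) \<le> C" using b by (intro C) auto
      moreover have "norm (full_density t X (?s m z) {..<N}) \<le> B"
        unfolding B_def using b low(1) \<rho> by (intro full_density_bounded) auto
      ultimately show ?case unfolding norm_mult by (intro mult_mono') auto
    qed
  qed simp
qed

text \<open>The integrals over the deformed tori all have the same value, so this value is their limit.\<close>

lemma torus_integral_eq:
  assumes t: "norm t < 1" and len: "length \<mu> + length \<nu> \<le> 2 * n"
    and c: "\<And>r. two_radii t r \<Longrightarrow> two_radii.total_integral t r {..<n} (weight_of (2 * n) \<mu> \<nu>) {..<2 * n} = c"
  shows "torus_integral n t \<mu> \<nu> = 1 / (fact n)\<^sup>2 * (1 / t_mult t (weight_of (2 * n) \<mu> \<nu>) * c)"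
proof -
  let ?\<kappa> = "weight_of (2 * n) \<mu> \<nu>"
  \<comment> \<open>Radii in \<open>[(1 + |t|) / 2, 1)\<close> keep the uniform distance from \<open>|t|\<close> that the dominating bound requires.\<close>
  define r where "r m = 1 - (1 - norm t) / 2 * inverse (real (Suc m))" for m
  have le: "(1 - norm t) / 2 * inverse (real (Suc m)) \<le> (1 - norm t) / 2 * 1" for m
    using t by (intro mult_left_mono) (auto simp: inverse_le_1_iff)
  have pos: "0 < (1 - norm t) / 2 * inverse (real (Suc m))" for m
    using t by simp
  have low: "(1 + norm t) / 2 \<le> r m" for m using le[of m] by (simp add: r_def field_simps)
  have radii: "two_radii t (r m)" for m
    using low[of m] pos[of m] t by unfold_locales (auto simp: r_def)
  have "r \<longlonglongrightarrow> 1 - (1 - norm t) / 2 * 0"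
    unfolding r_def by (intro tendsto_intros LIMSEQ_inverse_real_of_nat)
  then have "r \<longlonglongrightarrow> 1" by simp
  from deformed_integral_tendsto[OF this radii _ low length_weight_of[OF len], of "{..<n}"]
  have "(\<lambda>m. LINT z|torus {..<2 * n}. hall_littlewood ?\<kappa> t (two_radii.scaled (r m) {..<n} z) *
      full_density t {..<n} (two_radii.scaled (r m) {..<n} z) {..<2 * n})
    \<longlonglongrightarrow> (LINT z|torus {..<2 * n}. hall_littlewood ?\<kappa> t z * full_density t {..<n} z {..<2 * n})"
    using t by simp
  then have "(\<lambda>m::nat. 1 / t_mult t ?\<kappa> * c)
    \<longlonglongrightarrow> (LINT z|torus {..<2 * n}. hall_littlewood ?\<kappa> t z * full_density t {..<n} z {..<2 * n})"
    by (simp only: two_radii.deformed_integral[OF radii length_weight_of[OF len]] c[OF radii])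
  then have "1 / t_mult t ?\<kappa> * c = (LINT z|torus {..<2 * n}. hall_littlewood ?\<kappa> t z * full_density t {..<n} z {..<2 * n})"
    using LIMSEQ_unique tendsto_const by blast
  then show ?thesis unfolding torus_integral_eq_LINT by simp
qed

section \<open>Exchanging the two partitions\<close>

text \<open>Inverting the variables turns the quotient of a pair into that of the reversed pair. Reading the orderings
  backwards compensates this, and reverses the list of exponents.\<close>

lemma hall_littlewood_inverse:
  assumes "\<And>i. i < length \<kappa> \<Longrightarrow> z i \<noteq> 0"
  shows "hall_littlewood \<kappa> t (\<lambda>i. inverse (z i)) = hall_littlewood (map uminus (rev \<kappa>)) t z"
proof -
  define N where "N = length \<kappa>"
  \<comment> \<open>The longest permutation, which reverses the positions.\<close>
  define \<rho> where "\<rho> i = (if i < N then N - 1 - i else i)" for i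
  have \<rho>\<rho>: "\<rho> (\<rho> i) = i" for i by (auto simp: \<rho>_def)
  have "bij_betw \<rho> {..<N} {..<N}"
    by (rule bij_betw_byWitness[where f' = \<rho>]) (auto simp: \<rho>\<rho>, auto simp: \<rho>_def)
  then have \<rho>: "\<rho> permutes {..<N}" by (rule bij_imp_permutes) (simp add: \<rho>_def)
  have mult: "t_mult t (map uminus (rev \<kappa>)) = t_mult t \<kappa>"
  proof -
    have "count_list (map uminus (rev \<kappa>)) (- x) = count_list \<kappa> x" for x
      by (induction \<kappa>) (auto simp: count_list_append)
    then show ?thesis
      unfolding t_mult_def by (simp add: prod.reindex)
  qed
  have quot: "(inverse a - t * inverse b) / (inverse a - inverse b) = (b - t * a) / (b - a)"
    if "a \<noteq> 0" "b \<noteq> 0" for a b :: complex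
  proof (cases "a = b")
    case False
    have "inverse a - t * inverse b = (b - t * a) / (a * b)" "inverse a - inverse b = (b - a) / (a * b)"
      using that by (simp_all add: field_simps)
    then show ?thesis using that by simp
  qed simp
  have "(\<Prod>i<N. inverse (z (w (\<rho> i))) powi (\<kappa> ! i)) *
      (\<Prod>(i, j)\<in>ordered_pairs N. (inverse (z (w (\<rho> i))) - t * inverse (z (w (\<rho> j)))) / (inverse (z (w (\<rho> i))) - inverse (z (w (\<rho> j)))))
    = (\<Prod>i<N. z (w i) powi (map uminus (rev \<kappa>) ! i)) *
      (\<Prod>(i, j)\<in>ordered_pairs N. (z (w i) - t * z (w j)) / (z (w i) - z (w j)))" if w: "w permutes {..<N}" for w
  proof (rule arg_cong2[where f = times])
    have z0: "z (w i) \<noteq> 0" if "i < N" for i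
      using assms permutes_in_image[OF w, of i] that by (simp add: N_def)
    show "(\<Prod>i<N. inverse (z (w (\<rho> i))) powi (\<kappa> ! i)) = (\<Prod>i<N. z (w i) powi (map uminus (rev \<kappa>) ! i))"
    proof (rule prod.reindex_bij_witness[where i = \<rho> and j = \<rho>])
      fix i assume "i \<in> {..<N}"
      then have i: "i < N" by simp
      then have "map uminus (rev \<kappa>) ! \<rho> i = - (\<kappa> ! i)"
        by (simp add: \<rho>_def N_def rev_nth)
      then show "z (w (\<rho> i)) powi (map uminus (rev \<kappa>) ! \<rho> i) = inverse (z (w (\<rho> i))) powi (\<kappa> ! i)"
        by (simp add: power_int_minus power_int_inverse)
    qed (auto simp: \<rho>\<rho>, auto simp: \<rho>_def)
    show "(\<Prod>(i, j)\<in>ordered_pairs N. (inverse (z (w (\<rho> i))) - t * inverse (z (w (\<rho> j)))) / (inverse (z (w (\<rho> i))) - inverse (z (w (\<rho> j))))) =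
        (\<Prod>(i, j)\<in>ordered_pairs N. (z (w i) - t * z (w j)) / (z (w i) - z (w j)))"
    proof (rule prod.reindex_bij_witness[where i = "\<lambda>(i, j). (\<rho> j, \<rho> i)" and j = "\<lambda>(i, j). (\<rho> j, \<rho> i)"])
      fix p assume "p \<in> ordered_pairs N"
      then obtain i j where p: "p = (i, j)" "i < j" "j < N" by (auto simp: ordered_pairs_def)
      then have "\<rho> i < N" "\<rho> j < N" by (auto simp: \<rho>_def)
      then show "(case (case p of (i, j) \<Rightarrow> (\<rho> j, \<rho> i)) of (i, j) \<Rightarrow> (z (w i) - t * z (w j)) / (z (w i) - z (w j))) =
          (case p of (i, j) \<Rightarrow> (inverse (z (w (\<rho> i))) - t * inverse (z (w (\<rho> j)))) / (inverse (z (w (\<rho> i))) - inverse (z (w (\<rho> j)))))"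
        unfolding p(1) prod.case by (intro quot[symmetric] z0)
    qed (auto simp: ordered_pairs_def \<rho>\<rho>, auto simp: \<rho>_def)
  qed
  then have *: "(\<Sum>w | w permutes {..<N}. (\<Prod>i<N. inverse (z (w (\<rho> i))) powi (\<kappa> ! i)) *
      (\<Prod>(i, j)\<in>ordered_pairs N. (inverse (z (w (\<rho> i))) - t * inverse (z (w (\<rho> j)))) / (inverse (z (w (\<rho> i))) - inverse (z (w (\<rho> j))))))
    = (\<Sum>w | w permutes {..<N}. (\<Prod>i<N. z (w i) powi (map uminus (rev \<kappa>) ! i)) *
      (\<Prod>(i, j)\<in>ordered_pairs N. (z (w i) - t * z (w j)) / (z (w i) - z (w j))))"
    by (intro sum.cong) auto
  have "hall_littlewood \<kappa> t (\<lambda>i. inverse (z i)) = 1 / t_mult t \<kappa> * (\<Sum>w | w permutes {..<N}. (\<Prod>i<N. inverse (z (w i)) powi (\<kappa> ! i)) *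
      (\<Prod>(i, j)\<in>ordered_pairs N. (inverse (z (w i)) - t * inverse (z (w j))) / (inverse (z (w i)) - inverse (z (w j)))))"
    by (simp add: hall_littlewood_def N_def ordered_pairs_def)
  also have "(\<Sum>w | w permutes {..<N}. (\<Prod>i<N. inverse (z (w i)) powi (\<kappa> ! i)) *
      (\<Prod>(i, j)\<in>ordered_pairs N. (inverse (z (w i)) - t * inverse (z (w j))) / (inverse (z (w i)) - inverse (z (w j))))) =
    (\<Sum>w | w permutes {..<N}. (\<Prod>i<N. inverse (z (w (\<rho> i))) powi (\<kappa> ! i)) *
      (\<Prod>(i, j)\<in>ordered_pairs N. (inverse (z (w (\<rho> i))) - t * inverse (z (w (\<rho> j)))) / (inverse (z (w (\<rho> i))) - inverse (z (w (\<rho> j))))))"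
    by (rule sum.reindex_bij_witness[where i = "\<lambda>w. w \<circ> \<rho>" and j = "\<lambda>w. w \<circ> \<rho>"])
      (auto simp: \<rho>\<rho> fun_eq_iff intro: permutes_compose[OF \<rho>])
  also note *
  finally show ?thesis
    unfolding hall_littlewood_def mult by (simp add: N_def ordered_pairs_def)
qed

lemma density_factor_inverse:
  "density_factor n t (\<lambda>i. inverse (x i)) (\<lambda>i. inverse (y i)) = density_factor n t x y"
proof -
  have "(\<Prod>(i, j)\<in>{(i, j). i < n \<and> j < n \<and> i \<noteq> j}. (1 - inverse (x i) * x j) * (1 - inverse (y i) * y j)) =
      (\<Prod>(i, j)\<in>{(i, j). i < n \<and> j < n \<and> i \<noteq> j}. (1 - x i * inverse (x j)) * (1 - y i * inverse (y j)))"
    by (rule prod.reindex_bij_witness[where i = prod.swap and j = prod.swap]) (auto simp: mult_ac)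
  moreover have "(\<Prod>i<n. \<Prod>j<n. 1 / ((1 - t * inverse (x i) * y j) * (1 - t * inverse (y i) * x j))) =
      (\<Prod>i<n. \<Prod>j<n. 1 / ((1 - t * x i * inverse (y j)) * (1 - t * y i * inverse (x j))))"
  proof -
    have "(\<Prod>i<n. \<Prod>j<n. 1 / ((1 - t * inverse (x i) * y j) * (1 - t * inverse (y i) * x j))) =
      (\<Prod>i<n. \<Prod>j<n. 1 / (1 - t * y j * inverse (x i))) * (\<Prod>i<n. \<Prod>j<n. 1 / (1 - t * x j * inverse (y i)))"
      by (simp add: prod.distrib[symmetric] mult_ac)
    also have "\<dots> = (\<Prod>i<n. \<Prod>j<n. 1 / (1 - t * y i * inverse (x j))) * (\<Prod>i<n. \<Prod>j<n. 1 / (1 - t * x i * inverse (y j)))"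
      by (subst (1 2) prod.swap) simp
    finally show ?thesis by (simp add: prod.distrib[symmetric] mult_ac)
  qed
  ultimately show ?thesis unfolding density_factor_def by simp
qed

lemma cnj_t_mult: "cnj (t_mult t \<kappa>) = t_mult (cnj t) \<kappa>"
  by (simp add: t_mult_def t_fact_def t_int_def)

lemma cnj_hall_littlewood: "cnj (hall_littlewood \<kappa> t z) = hall_littlewood \<kappa> (cnj t) (\<lambda>i. cnj (z i))"
  by (simp add: hall_littlewood_def cnj_t_mult case_prod_unfold)

lemma cnj_density_factor: "cnj (density_factor n t x y) = density_factor n (cnj t) (\<lambda>i. cnj (x i)) (\<lambda>i. cnj (y i))"
  by (simp add: density_factor_def case_prod_unfold)

text \<open>Conjugation inverts the variables on the torus, which reverses and negates the weight. It also acts on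
  the coefficients, hence the conjugate of \<open>t\<close>.\<close>

lemma torus_integral_swap:
  assumes "length \<mu> + length \<nu> \<le> 2 * n"
  shows "torus_integral n t \<nu> \<mu> = cnj (torus_integral n (cnj t) \<mu> \<nu>)"
proof -
  let ?\<kappa> = "weight_of (2 * n) \<mu> \<nu>"
  have \<kappa>: "map uminus (rev ?\<kappa>) = weight_of (2 * n) \<nu> \<mu>"
    by (simp add: weight_of_def rev_map add.commute o_def)
  have meas: "(\<lambda>z. hall_littlewood \<kappa> s (f z) * density_factor n s (f z) (\<lambda>j. f z (n + j))) \<in> borel_measurable (torus {..<2 * n})"
    if f: "\<And>i. i < 2 * n \<Longrightarrow> (\<lambda>z. f z i) \<in> borel_measurable (torus {..<2 * n})" and "length \<kappa> = 2 * n" for s \<kappa> f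
    unfolding density_factor_eq_full_density
    using that by (intro borel_measurable_times borel_measurable_const measurable_hall_littlewood measurable_full_density) auto
  have "cnj (torus_integral n (cnj t) \<mu> \<nu>) = (LINT z|torus {..<2 * n}.
      hall_littlewood ?\<kappa> t (\<lambda>i. cnj (z i)) * density_factor n t (\<lambda>i. cnj (z i)) (\<lambda>j. cnj (z (n + j))))"
    unfolding torus_integral_def torus_measure_def Bochner_Integration.integral_cnj[symmetric]
    by (simp only: complex_cnj_mult cnj_hall_littlewood cnj_density_factor complex_cnj_cnj)
  also have "\<dots> = (LINT z|torus {..<2 * n}.
      hall_littlewood (weight_of (2 * n) \<nu> \<mu>) t z * density_factor n t z (\<lambda>j. z (n + j)))"
  proof (rule integral_cong_AE)
    show "(\<lambda>z. hall_littlewood ?\<kappa> t (\<lambda>i. cnj (z i)) * density_factor n t (\<lambda>i. cnj (z i)) (\<lambda>j. cnj (z (n + j))))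
        \<in> borel_measurable (torus {..<2 * n})"
    proof (rule meas[of "\<lambda>z i. cnj (z i)"])
      show "(\<lambda>z. cnj (z i)) \<in> borel_measurable (torus {..<2 * n})" if "i < 2 * n" for i
        by (rule measurable_compose[OF measurable_torus_component])
          (use that in \<open>auto intro!: borel_measurable_continuous_onI continuous_intros\<close>)
    qed (rule length_weight_of[OF assms])
    show "(\<lambda>z. hall_littlewood (weight_of (2 * n) \<nu> \<mu>) t z * density_factor n t z (\<lambda>j. z (n + j)))
        \<in> borel_measurable (torus {..<2 * n})"
      using measurable_torus_component[of _ "{..<2 * n}"] length_weight_of[of \<nu> \<mu> "2 * n"] assms
      by (intro meas[of "\<lambda>z. z"]) auto
    show "AE z in torus {..<2 * n}. hall_littlewood ?\<kappa> t (\<lambda>i. cnj (z i)) * density_factor n t (\<lambda>i. cnj (z i)) (\<lambda>j. cnj (z (n + j))) =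
        hall_littlewood (weight_of (2 * n) \<nu> \<mu>) t z * density_factor n t z (\<lambda>j. z (n + j))"
      using AE_circles_norm[OF finite_lessThan, of "2 * n"]
    proof eventually_elim
      case (elim z)
      have inv: "cnj (z i) = inverse (z i)" if "i < 2 * n" for i
      proof -
        have "z i * cnj (z i) = 1" using elim that by (simp add: complex_norm_square[symmetric])
        then show ?thesis using inverse_unique by metis
      qed
      have "hall_littlewood ?\<kappa> t (\<lambda>i. cnj (z i)) = hall_littlewood ?\<kappa> t (\<lambda>i. inverse (z i))"
        by (rule hall_littlewood_cong) (simp add: inv length_weight_of[OF assms])
      also have "\<dots> = hall_littlewood (weight_of (2 * n) \<nu> \<mu>) t z"
        unfolding \<kappa>[symmetric]
        by (rule hall_littlewood_inverse) (use elim length_weight_of[OF assms] in force)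
      moreover have "density_factor n t (\<lambda>i. cnj (z i)) (\<lambda>j. cnj (z (n + j))) =
          density_factor n t (\<lambda>i. inverse (z i)) (\<lambda>j. inverse (z (n + j)))"
        unfolding density_factor_def
        by (intro arg_cong2[where f = times] refl prod.cong) (auto simp: inv)
      ultimately show ?case by (simp add: density_factor_inverse)
    qed
  qed
  finally show ?thesis unfolding torus_integral_def torus_measure_def by simp
qed

lemma balanced_lessThan:
  assumes "two_radii t r"
  shows "two_radii.balanced {..<n} n {..<2 * n}"
proof -
  have "{..<2 * n} \<inter> {..<n} = {..<n}" "{..<2 * n} - {..<n} = {n..<2 * n}" by auto
  then show ?thesis by (simp add: two_radii.balanced_def[OF assms])
qed

lemma torus_integral_unequal:
  assumes "norm t < 1" "is_partition \<mu>" "is_partition \<nu>" "length \<mu> + length \<nu> \<le> 2 * n" "\<mu> \<noteq> \<nu>"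
  shows "torus_integral n t \<mu> \<nu> = 0"
proof -
  have *: "torus_integral n s \<mu> \<nu> = 0"
    if pre: "norm s < 1" "is_partition \<mu>" "is_partition \<nu>" "length \<mu> + length \<nu> \<le> 2 * n" "(\<nu>, \<mu>) \<in> lexord less_than" for s \<mu> \<nu>
  proof -
    have "two_radii.total_integral s r {..<n} (weight_of (2 * n) \<mu> \<nu>) {..<2 * n} = 0" if r: "two_radii s r" for r
      using two_radii.total_integral_unequal[OF r pre(2-4) balanced_lessThan[OF r] pre(5)] .
    from torus_integral_eq[OF pre(1,4) this] show ?thesis by simp
  qed
  have "(\<nu>, \<mu>) \<in> lexord less_than \<or> (\<mu>, \<nu>) \<in> lexord less_than"
  proof -
    have "\<forall>a b. (a, b) \<in> less_than \<or> a = b \<or> (b, a) \<in> less_than" by auto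
    from lexord_linear[OF this, of \<mu> \<nu>] show ?thesis using assms(5) by blast
  qed
  then show ?thesis
  proof
    assume "(\<mu>, \<nu>) \<in> lexord less_than"
    then have "torus_integral n (cnj t) \<nu> \<mu> = 0" using assms by (intro *) auto
    then show ?thesis using torus_integral_swap[of \<nu> \<mu> n t] assms(4) by simp
  qed (use assms * in auto)
qed

section \<open>The closed formula\<close>

lemma t_mult_append:
  assumes "set xs \<inter> set ys = {}"
  shows "t_mult t (xs @ ys) = t_mult t xs * t_mult t ys"
proof -
  have "count_list xs i = 0" if "i \<in> set ys" for i using that assms by (auto simp: count_list_0_iff)
  moreover have "count_list ys i = 0" if "i \<in> set xs" for i using that assms by (auto simp: count_list_0_iff)
  ultimately show ?thesis
    unfolding t_mult_def set_append by (subst prod.union_disjoint) (use assms in \<open>auto simp: count_list_append\<close>)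
qed

lemma t_mult_map_inj:
  assumes "inj f" shows "t_mult t (map f xs) = t_mult t xs"
proof -
  have "count_list (map f xs) (f x) = count_list xs x" for x
    using assms by (induction xs) (auto simp: inj_def)
  then show ?thesis
    using assms by (simp add: t_mult_def prod.reindex inj_on_subset)
qed

lemma t_mult_rev: "t_mult t (rev xs) = t_mult t xs"
  by (simp add: t_mult_def)

lemma t_mult_replicate: "t_mult t (replicate k x) = t_fact t k"
proof -
  have "count_list (replicate k x) x = k" by (induction k) auto
  then show ?thesis by (cases "k = 0") (simp_all add: t_mult_def t_fact_def)
qed

lemma t_mult_weight_of:
  assumes "is_partition \<mu>"
  shows "t_mult t (weight_of N \<mu> \<mu>) = t_mult t \<mu> * t_fact t (N - 2 * length \<mu>) * t_mult t \<mu>"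
proof -
  have pos: "0 \<notin> set \<mu>" using assms by (simp add: is_partition_def)
  then have neg: "int a \<noteq> - int b" if "a \<in> set \<mu>" for a b
    using that by (cases "a = 0") auto
  have "t_mult t (map (\<lambda>k. - int k) \<mu>) = t_mult t \<mu>"
    by (rule t_mult_map_inj) (auto simp: inj_def)
  moreover have "t_mult t (map int \<mu>) = t_mult t \<mu>"
    by (rule t_mult_map_inj) (auto simp: inj_def)
  moreover have "set (map int \<mu>) \<inter> set (replicate (N - (length \<mu> + length \<mu>)) 0 @ rev (map (\<lambda>k. - int k) \<mu>)) = {}"
    "set (replicate (N - (length \<mu> + length \<mu>)) 0) \<inter> set (rev (map (\<lambda>k. - int k) \<mu>)) = {}"
    using pos neg by auto
  ultimately show ?thesis
    unfolding weight_of_def by (simp only: t_mult_append t_mult_rev t_mult_replicate mult_2 mult.assoc)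
qed

lemma one_minus_power_nonzero:
  assumes "norm t < 1" "0 < k" shows "1 - t ^ k \<noteq> (0 :: complex)"
proof -
  have "norm (t ^ k) < 1" using assms by (simp add: norm_power power_less_one_iff)
  then show ?thesis by auto
qed

lemma t_int_nonzero: "norm t < 1 \<Longrightarrow> 0 < k \<Longrightarrow> t_int t k \<noteq> 0"
proof -
  assume t: "norm t < 1" "0 < k"
  have "norm (t ^ k) < 1" using t by (simp add: norm_power power_less_one_iff)
  then have "t ^ k \<noteq> 1" "t \<noteq> 1" using t by auto
  then show ?thesis by (simp add: t_int_def)
qed

lemma t_fact_nonzero: "norm t < 1 \<Longrightarrow> t_fact t k \<noteq> 0"
  by (auto simp: t_fact_def t_int_nonzero)

lemma t_mult_nonzero: "norm t < 1 \<Longrightarrow> t_mult t \<kappa> \<noteq> 0"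
  by (auto simp: t_mult_def t_fact_nonzero)

text \<open>The value of the integral for \<open>\<mu> = \<nu> = 0\<close>, by \<open>torus_integral_equal\<close>.\<close>

definition normalization :: "complex \<Rightarrow> nat \<Rightarrow> complex" where
  "normalization t n = (\<Prod>i<n. 1 / (1 - t ^ (2 * Suc i)))"

text \<open>The odd-index factors \<open>[2i + 1]\<close> are completed to \<open>[2n]!\<close>, and \<open>[2i + 2] (1 - t) = 1 - t\<^sup>2\<^sup>i\<^sup>+\<^sup>2\<close>.\<close>

lemma zero_weight_value_eq:
  assumes "norm t < 1"
  shows "zero_weight_value t n = (fact n)\<^sup>2 * t_fact t (2 * n) * normalization t n"
proof -
  have "(\<Prod>i<n. t_int t (2 * i + 1) / (1 - t)) = t_fact t (2 * n) * normalization t n"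
  proof (induction n)
    case (Suc n)
    have f: "t_fact t (2 * Suc n) = t_fact t (2 * n) * t_int t (2 * n + 1) * t_int t (2 * Suc n)"
      by (simp add: t_fact_def)
    have "1 - t \<noteq> 0" using assms by auto
    moreover have "t_int t (2 * Suc n) \<noteq> 0" using assms by (intro t_int_nonzero) auto
    ultimately have "t_int t (2 * Suc n) * (1 / (1 - t ^ (2 * Suc n))) = 1 / (1 - t)"
      by (auto simp: t_int_def)
    moreover have "normalization t (Suc n) = normalization t n * (1 / (1 - t ^ (2 * Suc n)))"
      by (simp only: normalization_def prod.lessThan_Suc)
    then have "t_fact t (2 * Suc n) * normalization t (Suc n) =
        t_fact t (2 * n) * normalization t n * t_int t (2 * n + 1) * (t_int t (2 * Suc n) * (1 / (1 - t ^ (2 * Suc n))))"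
      unfolding f by (simp only: mult_ac)
    ultimately show ?case
      by (simp only: Suc.IH prod.lessThan_Suc) simp
  qed (simp add: t_fact_def normalization_def)
  then show ?thesis by (simp add: zero_weight_value_def)
qed

lemma torus_integral_equal:
  assumes t: "norm t < 1" and \<mu>: "is_partition \<mu>" "length \<mu> \<le> n"
  shows "torus_integral n t \<mu> \<mu> = normalization t (n - length \<mu>) / C_minus_t \<mu> t"
proof -
  let ?l = "length \<mu>"
  have len: "?l + ?l \<le> 2 * n" using \<mu> by simp
  have c: "two_radii.total_integral t r {..<n} (weight_of (2 * n) \<mu> \<mu>) {..<2 * n} =
    (fact n / fact (n - ?l))\<^sup>2 * (t_mult t \<mu> / (1 - t) ^ ?l) * zero_weight_value t (n - ?l)" if r: "two_radii t r" for r
    using two_radii.total_integral_equal[OF r \<mu> balanced_lessThan[OF r]] .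
  have sub: "2 * n - 2 * ?l = 2 * (n - ?l)" by (simp add: right_diff_distrib')
  have "torus_integral n t \<mu> \<mu> = 1 / (fact n)\<^sup>2 * (1 / (t_mult t \<mu> * t_fact t (2 * (n - ?l)) * t_mult t \<mu>) *
      ((fact n / fact (n - ?l))\<^sup>2 * (t_mult t \<mu> / (1 - t) ^ ?l) *
      ((fact (n - ?l))\<^sup>2 * t_fact t (2 * (n - ?l)) * normalization t (n - ?l))))"
    by (subst torus_integral_eq[OF t len c], assumption)
      (simp only: t_mult_weight_of[OF \<mu>(1)] zero_weight_value_eq[OF t] sub)
  also have "\<dots> = normalization t (n - ?l) / C_minus_t \<mu> t"
    using t_mult_nonzero[OF t, of \<mu>] t_fact_nonzero[OF t, of "2 * (n - ?l)"]
    by (simp add: C_minus_t_def power_divide mult_ac)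
  finally show ?thesis .
qed

lemma C0_pair_eq:
  assumes "length \<mu> \<le> n"
  shows "C0_pair \<mu> (t ^ n) (- (t ^ n)) t = (\<Prod>i<length \<mu>. 1 - t ^ (2 * (n - i)))"
proof -
  \<comment> \<open>For \<open>t = 0\<close> both sides vanish when \<open>0 < i\<close>, because \<open>i < n\<close>.\<close>
  have "t powi (- int i) * t ^ n = t ^ (n - i)" if "i < length \<mu>" for i
  proof (cases "t = 0")
    case True
    then show ?thesis using that assms by (cases "i = 0") (auto simp: power_int_minus power_0_left)
  next
    case False
    have "t ^ n = t ^ (n - i) * t ^ i" using that assms by (simp flip: power_add)
    then show ?thesis using False by (simp add: power_int_minus field_simps)
  qed
  then have "C0_pair \<mu> (t ^ n) (- (t ^ n)) t = (\<Prod>i<length \<mu>. (1 - t ^ (n - i)) * (1 + t ^ (n - i)))"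
    by (simp add: C0_pair_def C0_def prod.distrib)
  also have "\<dots> = (\<Prod>i<length \<mu>. 1 - t ^ (2 * (n - i)))"
  proof (intro prod.cong refl)
    fix i
    have "t ^ (2 * (n - i)) = t ^ (n - i) * t ^ (n - i)" by (simp only: mult_2 power_add)
    then show "(1 - t ^ (n - i)) * (1 + t ^ (n - i)) = 1 - t ^ (2 * (n - i))"
      by (simp add: algebra_simps)
  qed
  finally show ?thesis .
qed

lemma normalization_diff:
  assumes "norm t < 1" "l \<le> n"
  shows "normalization t (n - l) = normalization t n * (\<Prod>i<l. 1 - t ^ (2 * (n - i)))"
  using assms(2)
proof (induction l)
  case (Suc l)
  then obtain k where k: "n - l = Suc k" by (metis Suc_diff_le diff_Suc_Suc)
  then have "n - Suc l = k" by simp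
  moreover have "normalization t k = normalization t (Suc k) * (1 - t ^ (2 * Suc k))"
    using one_minus_power_nonzero[OF assms(1), of "2 * Suc k"] by (simp add: normalization_def)
  ultimately show ?case using Suc k by simp
qed simp

lemma normalization_nonzero:
  assumes "norm t < 1" shows "normalization t n \<noteq> 0"
proof -
  have "1 / (1 - t ^ (2 * Suc i)) \<noteq> 0" for i
    using one_minus_power_nonzero[OF assms, of "2 * Suc i"] by simp
  then show ?thesis unfolding normalization_def prod_zero_iff[OF finite_lessThan] by blast
qed

theorem theorem8p2:
  fixes t :: complex and n :: nat and \<mu> \<nu> :: "nat list"
  assumes "norm t < 1"
    and "is_partition \<mu>" and "is_partition \<nu>"
    and "length \<mu> + length \<nu> \<le> 2 * n"
  shows "1 / torus_integral n t [] [] * torus_integral n t \<mu> \<nu> =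
    (if \<mu> = \<nu>
     then C0_pair \<mu> (t ^ n) (- (t ^ n)) t / (C_minus_t \<mu> t * C_plus \<mu> (t powi (2 * int n - 2) * t) t)
     else 0)"
proof (cases "\<mu> = \<nu>")
  case True
  then have l: "length \<mu> \<le> n" using assms(4) by simp
  have "torus_integral n t [] [] = normalization t n"
    using torus_integral_equal[OF assms(1), of "[]" n]
    by (simp add: is_partition_def C_minus_t_def t_mult_def)
  moreover have "torus_integral n t \<mu> \<mu> =
      normalization t n * (\<Prod>i<length \<mu>. 1 - t ^ (2 * (n - i))) / C_minus_t \<mu> t"
    using torus_integral_equal[OF assms(1,2) l] normalization_diff[OF assms(1) l] by simp
  ultimately show ?thesis
    using True normalization_nonzero[OF assms(1), of n] C0_pair_eq[OF l, of t] by (simp add: C_plus_def)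
next
  case False
  then show ?thesis using torus_integral_unequal[OF assms False] by simp
qed

end
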